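(* Let $\mathcal{O}$ be the ring of integers of a number field and let $\mathbf{G}$ be a unipotent group scheme over $\mathcal{O}$. Then, as Dirichlet series in $s$, $$\mathcal{Z}^{\mathrm{irr}}_{\mathbf{G}(\mathcal{O})}(0,s)=\mathcal{Z}^{\mathrm{cc}}_{\mathbf{G}(\mathcal{O})}(0,s)=\zeta^{\mathrm{k}}_{\mathbf{G}(\mathcal{O})}(s).$$
   Context: Group schemes are affine and of finite type over $\mathcal{O}$. For a finite group $G$, let $r_n(G)$ be the number of isomorphism classes of $n$-dimensional irreducible complex representations of $G$ and $c_n(G)$ the number of conjugacy classes of $G$ of cardinality $n$; put $\zeta^{\mathrm{irr}}_G(s)=\sum_{n\ge1}r_n(G)n^{-s}$ and $\zeta^{\mathrm{cc}}_G(s)=\sum_{n\ge1}c_n(G)n^{-s}$. Let $\mathrm{k}(G)$ denote the class number of $G$, i.e. its number of conjugacy classes. Define, with sums over all nonzero ideals $I$ of $\mathcal{O}$, $$\mathcal{Z}^{\ast}_{\mathbf{G}(\mathcal{O})}(s_1,s_2)=\sum_{(0)\ne I\unlhd\mathcal{O}}\zeta^{\ast}_{\mathbf{G}(\mathcal{O}/I)}(s_1)|\mathcal{O}:I|^{-s_2}\quad(\ast\in\{\mathrm{irr},\mathrm{cc}\}),\qquad \zeta^{\mathrm{k}}_{\mathbf{G}(\mathcal{O})}(s)=\sum_{(0)\ne I\unlhd\mathcal{O}}\mathrm{k}(\mathbf{G}(\mathcal{O}/I))|\mathcal{O}:I|^{-s}.$$ *)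

theory Defs
  imports
    "HOL-Analysis.Infinite_Sum"
    "HOL-Analysis.Complex_Transcendental"
    "HOL-Library.Poly_Mapping"
    "HOL-Computational_Algebra.Polynomial"
    "Jordan_Normal_Form.Matrix"
    "HOL-Algebra.QuotRing"
    "HOL-Algebra.Module"
    "HOL-Algebra.Generated_Rings"
    "HOL-Algebra.Group_Action"
begin

hide_const (open) Multiset.mult Polynomial.smult

section \<open>Rings of integers of number fields\<close>

text \<open>A number field is a type \<open>'k\<close> of class \<open>field_char_0\<close> that has finite dimension over the
  rationals.  It is also viewed as a ring record, so that ideals and quotients of its ring of
  integers are those of \<^theory>\<open>HOL-Algebra.QuotRing\<close>.\<close>

definition number_field :: "'k::field_char_0 itself \<Rightarrow> bool" where
  "number_field _ \<longleftrightarrow>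
     (\<exists>B. finite_dimensional_vector_space (\<lambda>(q::rat) (x::'k). of_rat q * x) B)"

definition field_ring :: "'k::field_char_0 ring" where
  "field_ring = \<lparr>carrier = UNIV, mult = (*), one = 1, zero = 0, add = (+)\<rparr>"

definition ring_of_integers :: "'k::field_char_0 ring" where
  "ring_of_integers =
     \<lparr>carrier = {x. algebraic_int x}, mult = (*), one = 1, zero = 0, add = (+)\<rparr>"

definition nonzero_ideals :: "('r, 'm) ring_scheme \<Rightarrow> 'r set set" where
  "nonzero_ideals R = {I. ideal I R \<and> I \<noteq> {\<zero>\<^bsub>R\<^esub>}}"

definition ideal_index :: "('r, 'm) ring_scheme \<Rightarrow> 'r set \<Rightarrow> nat" where
  "ideal_index R I = order (R Quot I)"

section \<open>Commutative algebras and their tensor products\<close>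

text \<open>A commutative \<open>R\<close>-algebra is a record \<open>A\<close> satisfying the library locale
  \<open>algebra R A\<close>.\<close>

definition alg_hom ::
    "('r, 'm) ring_scheme \<Rightarrow> ('r, 'a, 'n) module_scheme \<Rightarrow> ('r, 'b, 'p) module_scheme \<Rightarrow> ('a \<Rightarrow> 'b) set"
  where
  "alg_hom R A B =
     {f \<in> ring_hom A B. \<forall>r\<in>carrier R. \<forall>a\<in>carrier A. f (r \<odot>\<^bsub>A\<^esub> a) = r \<odot>\<^bsub>B\<^esub> f a}"

definition algebra_of :: "('b, 'm) ring_scheme \<Rightarrow> ('r \<Rightarrow> 'b) \<Rightarrow> ('r, 'b) module" where
  "algebra_of B \<phi> =
     \<lparr>carrier = carrier B, mult = mult B, one = one B, zero = zero B, add = add B,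
      smult = (\<lambda>r b. \<phi> r \<otimes>\<^bsub>B\<^esub> b)\<rparr>"

text \<open>\<open>A \<otimes>\<^sub>R B\<close> is the monoid ring \<open>\<int>[A \<times> B]\<close> of the multiplicative monoid \<open>A \<times> B\<close> modulo the
  bilinearity relations.  These span an ideal because multiplying a relation by a pair
  \<open>(c, d)\<close> gives a relation of the same shape.\<close>

definition pair_ring :: "('a, 'n) ring_scheme \<Rightarrow> ('b, 'p) ring_scheme \<Rightarrow> (('a \<times> 'b) \<Rightarrow>\<^sub>0 int) ring"
  where
  "pair_ring A B =
     \<lparr>carrier = {P. Poly_Mapping.keys P \<subseteq> carrier A \<times> carrier B},
      mult = (\<lambda>P Q. \<Sum>p\<in>Poly_Mapping.keys P. \<Sum>q\<in>Poly_Mapping.keys Q.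
        Poly_Mapping.single (fst p \<otimes>\<^bsub>A\<^esub> fst q, snd p \<otimes>\<^bsub>B\<^esub> snd q)
          (Poly_Mapping.lookup P p * Poly_Mapping.lookup Q q)),
      one = Poly_Mapping.single (\<one>\<^bsub>A\<^esub>, \<one>\<^bsub>B\<^esub>) 1,
      zero = 0,
      add = (+)\<rparr>"

definition tensor_ideal ::
    "('r, 'm) ring_scheme \<Rightarrow> ('r, 'a, 'n) module_scheme \<Rightarrow> ('r, 'b, 'p) module_scheme
      \<Rightarrow> (('a \<times> 'b) \<Rightarrow>\<^sub>0 int) set" where
  "tensor_ideal R A B = Idl\<^bsub>pair_ring A B\<^esub>
     ({Poly_Mapping.single (a \<oplus>\<^bsub>A\<^esub> a', b) 1 - Poly_Mapping.single (a, b) 1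
          - Poly_Mapping.single (a', b) 1 | a a' b.
          a \<in> carrier A \<and> a' \<in> carrier A \<and> b \<in> carrier B}
      \<union> {Poly_Mapping.single (a, b \<oplus>\<^bsub>B\<^esub> b') 1 - Poly_Mapping.single (a, b) 1
          - Poly_Mapping.single (a, b') 1 | a b b'.
          a \<in> carrier A \<and> b \<in> carrier B \<and> b' \<in> carrier B}
      \<union> {Poly_Mapping.single (r \<odot>\<^bsub>A\<^esub> a, b) 1 - Poly_Mapping.single (a, r \<odot>\<^bsub>B\<^esub> b) 1 | r a b.
          r \<in> carrier R \<and> a \<in> carrier A \<and> b \<in> carrier B})"

definition pure_tensor ::
    "('r, 'm) ring_scheme \<Rightarrow> ('r, 'a, 'n) module_scheme \<Rightarrow> ('r, 'b, 'p) module_scheme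
      \<Rightarrow> 'a \<Rightarrow> 'b \<Rightarrow> (('a \<times> 'b) \<Rightarrow>\<^sub>0 int) set" where
  "pure_tensor R A B a b =
     tensor_ideal R A B +>\<^bsub>pair_ring A B\<^esub> Poly_Mapping.single (a, b) 1"

definition tensor ::
    "('r, 'm) ring_scheme \<Rightarrow> ('r, 'a, 'n) module_scheme \<Rightarrow> ('r, 'b, 'p) module_scheme
      \<Rightarrow> ('r, (('a \<times> 'b) \<Rightarrow>\<^sub>0 int) set) module" where
  "tensor R A B =
     algebra_of (pair_ring A B Quot tensor_ideal R A B)
       (\<lambda>r. pure_tensor R A B (r \<odot>\<^bsub>A\<^esub> \<one>\<^bsub>A\<^esub>) \<one>\<^bsub>B\<^esub>)"

text \<open>The homomorphism \<open>A \<otimes>\<^sub>R B \<rightarrow> C\<close> with \<open>a \<otimes> b \<mapsto> f a \<cdot> g b\<close> induced by \<open>R\<close>-algebra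
  homomorphisms \<open>f : A \<rightarrow> C\<close> and \<open>g : B \<rightarrow> C\<close>; it does not depend on the chosen representative.\<close>

definition tensor_lift ::
    "('c, 'm) ring_scheme \<Rightarrow> ('a \<Rightarrow> 'c) \<Rightarrow> ('b \<Rightarrow> 'c) \<Rightarrow> (('a \<times> 'b) \<Rightarrow>\<^sub>0 int) set \<Rightarrow> 'c" where
  "tensor_lift C f g Y =
     (let P = (SOME P. P \<in> Y) in
        \<Oplus>\<^bsub>C\<^esub>p\<in>Poly_Mapping.keys P. [Poly_Mapping.lookup P p] \<cdot>\<^bsub>C\<^esub> (f (fst p) \<otimes>\<^bsub>C\<^esub> g (snd p)))"

section \<open>Affine group schemes\<close>

text \<open>An affine group scheme over \<open>R\<close> is given by its coordinate ring, a commutative Hopf algebra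
  over \<open>R\<close>.  The Hopf algebra axioms are written with the product
  \<open>(f \<cdot> g)(a) = \<Sum> f(a\<^sub>1) g(a\<^sub>2)\<close> of \<open>C\<close>-valued points, where \<open>\<Delta> a = \<Sum> a\<^sub>1 \<otimes> a\<^sub>2\<close>: coassociativity says that
  the three universal points with values in \<open>(A \<otimes> A) \<otimes> A\<close> multiply associatively, and so on.\<close>

record ('r, 'a) hopf_algebra = "('r, 'a) module" +
  comult :: "'a \<Rightarrow> (('a \<times> 'a) \<Rightarrow>\<^sub>0 int) set"
  counit :: "'a \<Rightarrow> 'r"
  antipode :: "'a \<Rightarrow> 'a"

definition point_mult ::
    "('r, 'a, 'n) hopf_algebra_scheme \<Rightarrow> ('c, 'm) ring_scheme \<Rightarrow> ('a \<Rightarrow> 'c) \<Rightarrow> ('a \<Rightarrow> 'c) \<Rightarrow> 'a \<Rightarrow> 'c"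
  where
  "point_mult G C f g = (\<lambda>a\<in>carrier G. tensor_lift C f g (comult G a))"

definition point_one ::
    "('r, 'a, 'n) hopf_algebra_scheme \<Rightarrow> ('r, 'c, 'm) module_scheme \<Rightarrow> 'a \<Rightarrow> 'c" where
  "point_one G C = (\<lambda>a\<in>carrier G. counit G a \<odot>\<^bsub>C\<^esub> \<one>\<^bsub>C\<^esub>)"

locale affine_group_scheme = Module.algebra R G
  for R :: "('r, 'm) ring_scheme" (structure) and G :: "('r, 'a, 'n) hopf_algebra_scheme" (structure) +
  assumes comult_hom: "comult G \<in> alg_hom R G (tensor R G G)"
    and counit_hom: "counit G \<in> alg_hom R G (algebra_of R (\<lambda>r. r))"
    and antipode_hom: "antipode G \<in> alg_hom R G G"
    and coassoc:
      "let T = tensor R (tensor R G G) G;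
           p1 = (\<lambda>a. pure_tensor R (tensor R G G) G (pure_tensor R G G a \<one>\<^bsub>G\<^esub>) \<one>\<^bsub>G\<^esub>);
           p2 = (\<lambda>a. pure_tensor R (tensor R G G) G (pure_tensor R G G \<one>\<^bsub>G\<^esub> a) \<one>\<^bsub>G\<^esub>);
           p3 = (\<lambda>a. pure_tensor R (tensor R G G) G (pure_tensor R G G \<one>\<^bsub>G\<^esub> \<one>\<^bsub>G\<^esub>) a)
       in point_mult G T (point_mult G T p1 p2) p3 = point_mult G T p1 (point_mult G T p2 p3)"
    and counit_l: "a \<in> carrier G \<Longrightarrow> point_mult G G (point_one G G) (\<lambda>x. x) a = a"
    and counit_r: "a \<in> carrier G \<Longrightarrow> point_mult G G (\<lambda>x. x) (point_one G G) a = a"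
    and antipode_l: "point_mult G G (antipode G) (\<lambda>x. x) = point_one G G"
    and antipode_r: "point_mult G G (\<lambda>x. x) (antipode G) = point_one G G"

definition finite_type :: "('r, 'm) ring_scheme \<Rightarrow> ('r, 'a, 'n) module_scheme \<Rightarrow> bool" where
  "finite_type R A \<longleftrightarrow>
     (\<exists>S. finite S \<and> S \<subseteq> carrier A \<and>
        generate_ring A (S \<union> (\<lambda>r. r \<odot>\<^bsub>A\<^esub> \<one>\<^bsub>A\<^esub>) ` carrier R) = carrier A)"

text \<open>The group \<open>\<^bold>G(B)\<close> of \<open>B\<close>-valued points.  Homomorphisms are extensional, so that
  equal points are equal as functions.\<close>

definition points ::
    "('r, 'm) ring_scheme \<Rightarrow> ('r, 'a, 'n) hopf_algebra_scheme \<Rightarrow> ('r, 'b, 'p) module_scheme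
      \<Rightarrow> ('a \<Rightarrow> 'b) monoid" where
  "points R G B =
     \<lparr>carrier = alg_hom R G B \<inter> extensional (carrier G),
      mult = point_mult G B,
      one = point_one G B\<rparr>"

definition quotient_points ::
    "('r, 'm) ring_scheme \<Rightarrow> ('r, 'a, 'n) hopf_algebra_scheme \<Rightarrow> 'r set \<Rightarrow> ('a \<Rightarrow> 'r set) monoid" where
  "quotient_points R G I = points R G (algebra_of (R Quot I) (\<lambda>r. I +>\<^bsub>R\<^esub> r))"

section \<open>Unipotent group schemes\<close>

text \<open>The base change of \<open>G\<close> along \<open>\<phi> : R \<rightarrow> L\<close>; its coordinate ring is \<open>A \<otimes>\<^sub>R L\<close> with \<open>L\<close> acting on
  the second factor.\<close>

definition base_change_algebra ::
    "('r, 'm) ring_scheme \<Rightarrow> ('l, 'p) ring_scheme \<Rightarrow> ('r \<Rightarrow> 'l) \<Rightarrow> ('r, 'a, 'n) module_scheme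
      \<Rightarrow> ('l, (('a \<times> 'l) \<Rightarrow>\<^sub>0 int) set) module" where
  "base_change_algebra R L \<phi> A =
     algebra_of (tensor R A (algebra_of L \<phi>)) (pure_tensor R A (algebra_of L \<phi>) \<one>\<^bsub>A\<^esub>)"

definition base_change ::
    "('r, 'm) ring_scheme \<Rightarrow> ('l, 'p) ring_scheme \<Rightarrow> ('r \<Rightarrow> 'l) \<Rightarrow> ('r, 'a, 'n) hopf_algebra_scheme
      \<Rightarrow> ('l, (('a \<times> 'l) \<Rightarrow>\<^sub>0 int) set) hopf_algebra" where
  "base_change R L \<phi> G =
     (let A = base_change_algebra R L \<phi> G;
          T = tensor L A A;
          inc = (\<lambda>a. pure_tensor R G (algebra_of L \<phi>) a \<one>\<^bsub>L\<^esub>)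
      in \<lparr>carrier = carrier A, mult = mult A, one = one A, zero = zero A, add = add A, smult = smult A,
          comult = tensor_lift T
            (point_mult G T (\<lambda>a. pure_tensor L A A (inc a) \<one>\<^bsub>A\<^esub>) (\<lambda>a. pure_tensor L A A \<one>\<^bsub>A\<^esub> (inc a)))
            (\<lambda>c. c \<odot>\<^bsub>T\<^esub> \<one>\<^bsub>T\<^esub>),
          counit = tensor_lift L (\<lambda>a. \<phi> (counit G a)) (\<lambda>c. c),
          antipode = tensor_lift A (\<lambda>a. inc (antipode G a)) (\<lambda>c. c \<odot>\<^bsub>A\<^esub> \<one>\<^bsub>A\<^esub>)\<rparr>)"

text \<open>A linear representation of dimension \<open>d\<close> over a field \<open>L\<close> is a matrix \<open>(a\<^sub>i\<^sub>j)\<close> of regular functions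
  such that \<open>g \<mapsto> (a\<^sub>i\<^sub>j(g))\<close> is multiplicative and maps the identity to the identity.\<close>

definition linear_representation ::
    "('l, 'p) ring_scheme \<Rightarrow> ('l, 'a, 'n) hopf_algebra_scheme \<Rightarrow> nat \<Rightarrow> (nat \<Rightarrow> nat \<Rightarrow> 'a) \<Rightarrow> bool" where
  "linear_representation L G d a \<longleftrightarrow>
     (\<forall>i<d. \<forall>j<d. a i j \<in> carrier G
        \<and> comult G (a i j) = (\<Oplus>\<^bsub>tensor L G G\<^esub>l\<in>{..<d}. pure_tensor L G G (a i l) (a l j))
        \<and> counit G (a i j) = (if i = j then \<one>\<^bsub>L\<^esub> else \<zero>\<^bsub>L\<^esub>))"

definition fixed_vector ::
    "('l, 'p) ring_scheme \<Rightarrow> ('l, 'a, 'n) hopf_algebra_scheme \<Rightarrow> nat \<Rightarrow> (nat \<Rightarrow> nat \<Rightarrow> 'a) \<Rightarrow> (nat \<Rightarrow> 'l) \<Rightarrow> bool"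
  where
  "fixed_vector L G d a v \<longleftrightarrow>
     (\<forall>i<d. v i \<in> carrier L) \<and>
     (\<forall>i<d. (\<Oplus>\<^bsub>G\<^esub>j\<in>{..<d}. v j \<odot>\<^bsub>G\<^esub> a i j) = v i \<odot>\<^bsub>G\<^esub> \<one>\<^bsub>G\<^esub>)"

text \<open>An affine group scheme over a field is unipotent if each nonzero linear representation has a
  nonzero fixed vector.\<close>

definition unipotent_over_field ::
    "('l, 'p) ring_scheme \<Rightarrow> ('l, 'a, 'n) hopf_algebra_scheme \<Rightarrow> bool" where
  "unipotent_over_field L G \<longleftrightarrow>
     (\<forall>d a. d > 0 \<and> linear_representation L G d a \<longrightarrow>
        (\<exists>v. fixed_vector L G d a v \<and> (\<exists>i<d. v i \<noteq> \<zero>\<^bsub>L\<^esub>)))"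

text \<open>Over a ring of integers, a group scheme of finite type is unipotent if its fibres are: the
  generic fibre, over the number field, and the fibres at the maximal ideals.\<close>

definition unipotent_group_scheme :: "('k::field_char_0, 'a) hopf_algebra \<Rightarrow> bool" where
  "unipotent_group_scheme G \<longleftrightarrow>
     affine_group_scheme ring_of_integers G \<and>
     finite_type ring_of_integers G \<and>
     unipotent_over_field field_ring (base_change ring_of_integers field_ring (\<lambda>x. x) G) \<and>
     (\<forall>P. maximalideal P (ring_of_integers :: 'k ring) \<longrightarrow>
        unipotent_over_field (ring_of_integers Quot P)
          (base_change ring_of_integers (ring_of_integers Quot P) (\<lambda>x. P +>\<^bsub>ring_of_integers\<^esub> x) G))"

section \<open>Zeta functions of finite groups\<close>

definition complex_representation ::
    "('g, 'm) monoid_scheme \<Rightarrow> nat \<Rightarrow> ('g \<Rightarrow> complex mat) \<Rightarrow> bool" where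
  "complex_representation G n \<rho> \<longleftrightarrow>
     \<rho> \<in> carrier G \<rightarrow> carrier_mat n n \<and> \<rho> \<one>\<^bsub>G\<^esub> = 1\<^sub>m n \<and>
     (\<forall>g\<in>carrier G. \<forall>h\<in>carrier G. \<rho> (g \<otimes>\<^bsub>G\<^esub> h) = \<rho> g * \<rho> h)"

definition vec_subspace :: "nat \<Rightarrow> complex vec set \<Rightarrow> bool" where
  "vec_subspace n W \<longleftrightarrow>
     W \<subseteq> carrier_vec n \<and> 0\<^sub>v n \<in> W \<and> (\<forall>v\<in>W. \<forall>w\<in>W. v + w \<in> W) \<and> (\<forall>c. \<forall>v\<in>W. c \<cdot>\<^sub>v v \<in> W)"

definition irreducible_representations ::
    "('g, 'm) monoid_scheme \<Rightarrow> nat \<Rightarrow> ('g \<Rightarrow> complex mat) set" where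
  "irreducible_representations G n =
     {\<rho>. complex_representation G n \<rho> \<and> n > 0 \<and>
        (\<forall>W. vec_subspace n W \<and> (\<forall>g\<in>carrier G. \<forall>v\<in>W. \<rho> g *\<^sub>v v \<in> W)
           \<longrightarrow> W = {0\<^sub>v n} \<or> W = carrier_vec n)}"

definition isomorphic_irreducibles ::
    "('g, 'm) monoid_scheme \<Rightarrow> nat \<Rightarrow> ('g \<Rightarrow> complex mat) rel" where
  "isomorphic_irreducibles G n =
     {(\<rho>, \<sigma>). \<rho> \<in> irreducible_representations G n \<and> \<sigma> \<in> irreducible_representations G n \<and>
        (\<exists>T\<in>carrier_mat n n. invertible_mat T \<and> (\<forall>g\<in>carrier G. T * \<rho> g = \<sigma> g * T))}"

definition num_irreducibles :: "('g, 'm) monoid_scheme \<Rightarrow> nat \<Rightarrow> nat" where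
  "num_irreducibles G n = card (irreducible_representations G n // isomorphic_irreducibles G n)"

definition conjugacy_classes :: "('g, 'm) monoid_scheme \<Rightarrow> 'g set set" where
  "conjugacy_classes G =
     orbits G (carrier G) (\<lambda>g. \<lambda>h\<in>carrier G. g \<otimes>\<^bsub>G\<^esub> h \<otimes>\<^bsub>G\<^esub> inv\<^bsub>G\<^esub> g)"

definition class_number :: "('g, 'm) monoid_scheme \<Rightarrow> nat" where
  "class_number G = card (conjugacy_classes G)"

definition num_classes :: "('g, 'm) monoid_scheme \<Rightarrow> nat \<Rightarrow> nat" where
  "num_classes G n = card {C \<in> conjugacy_classes G. card C = n}"

definition zeta_irr :: "('g, 'm) monoid_scheme \<Rightarrow> complex \<Rightarrow> complex" where
  "zeta_irr G s = (\<Sum>\<^sub>\<infinity>n\<in>{1..}. of_nat (num_irreducibles G n) * of_nat n powr (- s))"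

definition zeta_cc :: "('g, 'm) monoid_scheme \<Rightarrow> complex \<Rightarrow> complex" where
  "zeta_cc G s = (\<Sum>\<^sub>\<infinity>n\<in>{1..}. of_nat (num_classes G n) * of_nat n powr (- s))"

section \<open>Dirichlet series over ideals\<close>

text \<open>For weights \<open>w I\<close>, \<open>ideal_series R w\<close> is the formal Dirichlet series \<open>\<Sum>\<^sub>I w I |R : I|\<^sup>-\<^sup>s\<close>, given by its
  coefficient sequence (in a ring of integers, only finitely many ideals have a given index), and
  \<open>ideal_sum R w s\<close> is the value of the sum at a complex number \<open>s\<close>.\<close>

definition ideal_series :: "('r, 'm) ring_scheme \<Rightarrow> ('r set \<Rightarrow> complex) \<Rightarrow> nat \<Rightarrow> complex" where
  "ideal_series R w m = (\<Sum>I | I \<in> nonzero_ideals R \<and> ideal_index R I = m. w I)"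

definition ideal_sum :: "('r, 'm) ring_scheme \<Rightarrow> ('r set \<Rightarrow> complex) \<Rightarrow> complex \<Rightarrow> complex" where
  "ideal_sum R w s = (\<Sum>\<^sub>\<infinity>I\<in>nonzero_ideals R. w I * of_nat (ideal_index R I) powr (- s))"

definition Z_irr_series ::
    "('r, 'm) ring_scheme \<Rightarrow> ('r, 'a, 'n) hopf_algebra_scheme \<Rightarrow> complex \<Rightarrow> nat \<Rightarrow> complex" where
  "Z_irr_series R G s1 = ideal_series R (\<lambda>I. zeta_irr (quotient_points R G I) s1)"

definition Z_cc_series ::
    "('r, 'm) ring_scheme \<Rightarrow> ('r, 'a, 'n) hopf_algebra_scheme \<Rightarrow> complex \<Rightarrow> nat \<Rightarrow> complex" where
  "Z_cc_series R G s1 = ideal_series R (\<lambda>I. zeta_cc (quotient_points R G I) s1)"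

definition zeta_k_series ::
    "('r, 'm) ring_scheme \<Rightarrow> ('r, 'a, 'n) hopf_algebra_scheme \<Rightarrow> nat \<Rightarrow> complex" where
  "zeta_k_series R G = ideal_series R (\<lambda>I. of_nat (class_number (quotient_points R G I)))"

definition Z_irr ::
    "('r, 'm) ring_scheme \<Rightarrow> ('r, 'a, 'n) hopf_algebra_scheme \<Rightarrow> complex \<Rightarrow> complex \<Rightarrow> complex" where
  "Z_irr R G s1 s2 = ideal_sum R (\<lambda>I. zeta_irr (quotient_points R G I) s1) s2"

definition Z_cc ::
    "('r, 'm) ring_scheme \<Rightarrow> ('r, 'a, 'n) hopf_algebra_scheme \<Rightarrow> complex \<Rightarrow> complex \<Rightarrow> complex" where
  "Z_cc R G s1 s2 = ideal_sum R (\<lambda>I. zeta_cc (quotient_points R G I) s1) s2"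

definition zeta_k ::
    "('r, 'm) ring_scheme \<Rightarrow> ('r, 'a, 'n) hopf_algebra_scheme \<Rightarrow> complex \<Rightarrow> complex" where
  "zeta_k R G s = ideal_sum R (\<lambda>I. of_nat (class_number (quotient_points R G I))) s"

end

theory Submission
  imports Defs "HOL-Number_Theory.Cong" "Jordan_Normal_Form.Spectral_Radius"
begin

text \<open>At \<open>s\<^sub>1 = 0\<close> each local zeta function loses the weights \<open>n\<^sup>-\<^sup>s\<close> and merely counts: the
  representation zeta function of \<open>\<^bold>G(O/I)\<close> becomes the number of irreducible representations, the
  conjugacy class zeta function becomes the number of conjugacy classes.  For a finite group these
  numbers agree, so the three Dirichlet series coincide term by term, both as formal series and as
  functions of \<open>s\<close>.

  What has to be established is that \<open>\<^bold>G(O/I)\<close> is a finite group, and that a finite group has as many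
  irreducible complex representations as conjugacy classes.

  The set of points with values in a commutative algebra is a group because the Hopf algebra axioms
  are the group laws for universal points, and homomorphisms carry these laws to all other points
  (\<open>group_points\<close>).  This rests on the universal property of the tensor product
  (\<open>tensor_lift_alg_hom\<close>) and on the naturality of the product of points.  The group is finite since the
  coordinate ring is of finite type and \<open>O/I\<close> is finite (\<open>finite_points\<close>).  For the
  latter, a nonzero ideal contains a nonzero integer \<open>m\<close>, and \<open>O/mO\<close> is built from the rings \<open>O/pO\<close>
  with \<open>p\<close> prime, whose dimension over \<open>F\<^sub>p\<close> is bounded by the degree of the number field
  (\<open>finite_quotient_ring_of_integers\<close>).

  The count of irreducible representations is the classical one (\<open>card_irreducible_classes\<close>).  Schur's
  lemma gives the orthogonality of irreducible characters, which bounds their number by the class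
  number.  In the other direction, a class function orthogonal to all irreducible characters acts as
  zero on every irreducible representation; on the regular representation it acts as a normal
  operator, whose range cannot contain a vector of its kernel, so it acts as zero there and vanishes
  (\<open>class_function_eq_zero\<close>).\<close>

section \<open>Finiteness of residue rings of rings of integers\<close>

text \<open>Division by \<open>p\<close> shrinks the sum of the absolute values, so that a nonzero family cannot be divided
  by \<open>p\<close> forever.  This takes the place of passing to a primitive integer relation.\<close>

lemma descent_dvd_zero:
  fixes a :: "'b \<Rightarrow> int"
  assumes p: "p > (1::int)" and fin: "finite S"
    and step: "\<And>a. P a \<Longrightarrow> (\<forall>s\<in>S. p dvd a s) \<and> P (\<lambda>s. a s div p)"
    and P: "P a"
  shows "\<forall>s\<in>S. a s = 0"
  using P
proof (induction "nat (\<Sum>s\<in>S. \<bar>a s\<bar>)" arbitrary: a rule: less_induct)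
  case less
  show ?case
  proof (rule ccontr)
    assume "\<not> ?thesis"
    then obtain s0 where s0: "s0 \<in> S" "a s0 \<noteq> 0" by blast
    have dv: "\<And>s. s \<in> S \<Longrightarrow> p dvd a s" and P': "P (\<lambda>s. a s div p)"
      using step[OF less.prems] by auto
    have le: "\<bar>a s div p\<bar> \<le> \<bar>a s\<bar>" if "s \<in> S" for s
      using dv[OF that] p by (auto simp: dvd_def abs_mult mult_le_cancel_right1)
    have lt: "\<bar>a s0 div p\<bar> < \<bar>a s0\<bar>"
      using dv[OF s0(1)] p s0(2) by (auto simp: dvd_def abs_mult)
    have "(\<Sum>s\<in>S. \<bar>a s div p\<bar>) < (\<Sum>s\<in>S. \<bar>a s\<bar>)"
      using sum_strict_mono_ex1[OF fin, of "\<lambda>s. \<bar>a s div p\<bar>" "\<lambda>s. \<bar>a s\<bar>"] le lt s0 by auto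
    moreover have "0 \<le> (\<Sum>s\<in>S. \<bar>a s div p\<bar>)" by (simp add: sum_nonneg)
    ultimately have "nat (\<Sum>s\<in>S. \<bar>a s div p\<bar>) < nat (\<Sum>s\<in>S. \<bar>a s\<bar>)" by linarith
    from less.hyps[OF this P'] have "a s0 div p = 0" using s0(1) by blast
    with dv[OF s0(1)] s0(2) show False by (auto simp: dvd_def)
  qed
qed

text \<open>For \<open>S\<close> in the ring of integers \<open>O\<close> and a prime \<open>p\<close>, this is linear independence over \<open>F\<^sub>p\<close> of the
  classes of the elements of \<open>S\<close> in \<open>O/pO\<close>.\<close>

definition indep_mod :: "int \<Rightarrow> 'k::field_char_0 set \<Rightarrow> bool" where
  "indep_mod p S \<longleftrightarrow>
     (\<forall>a. (\<exists>z. algebraic_int z \<and> (\<Sum>s\<in>S. of_int (a s) * s) = of_int p * z) \<longrightarrow> (\<forall>s\<in>S. p dvd a s))"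

text \<open>A rational relation becomes an integer relation by clearing denominators, and independence
  modulo \<open>p\<close> allows its coefficients to be divided by \<open>p\<close> again and again.  Hence the
  \<open>F\<^sub>p\<close>-dimension of \<open>O/pO\<close> is at most the degree of the number field.\<close>

lemma indep_mod_imp_independent:
  fixes S :: "'k::field_char_0 set"
  assumes V: "vector_space (\<lambda>(q::rat) (x::'k). of_rat q * x)"
    and p: "p > (1::int)" and fin: "finite S" and ind: "indep_mod p S"
  shows "\<not> module.dependent (\<lambda>(q::rat) (x::'k). of_rat q * x) S"
proof
  interpret V: vector_space "\<lambda>(q::rat) (x::'k). of_rat q * x" by (rule V)
  assume "V.dependent S"
  then obtain u where u: "\<exists>v\<in>S. u v \<noteq> 0" "(\<Sum>v\<in>S. of_rat (u v) * v) = (0::'k)"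
    unfolding V.dependent_finite[OF fin] by blast
  define D where "D = (\<Prod>v\<in>S. snd (quotient_of (u v)))"
  have Dpos: "D > 0" unfolding D_def by (intro prod_pos) (simp add: quotient_of_denom_pos')
  have "\<exists>a. of_int a = of_int D * u v" if "v \<in> S" for v
  proof -
    obtain n d where nd: "quotient_of (u v) = (n, d)" by force
    have "d dvd D" unfolding D_def using dvd_prodI[OF fin that, of "\<lambda>v. snd (quotient_of (u v))"] nd by simp
    then obtain e where e: "D = d * e" by auto
    have "d > 0" using quotient_of_denom_pos[OF nd] .
    have "of_int (n * e) = of_int D * u v"
      using quotient_of_div[OF nd] e \<open>d > 0\<close> by (simp add: field_simps)
    then show ?thesis by blast
  qed
  then obtain a where a: "\<And>v. v \<in> S \<Longrightarrow> of_int (a v) = of_int D * u v" by metis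
  have "(\<Sum>s\<in>S. of_int (a s) * s) = (\<Sum>s\<in>S. of_int D * (of_rat (u s) * s))"
  proof (rule sum.cong)
    fix s assume "s \<in> S"
    have "(of_int (a s) :: 'k) = of_rat (of_int (a s))" by simp
    also have "\<dots> = of_rat (of_int D * u s)" using a[OF \<open>s \<in> S\<close>] by simp
    also have "\<dots> = of_int D * of_rat (u s)" by (simp add: of_rat_mult)
    finally show "of_int (a s) * s = of_int D * (of_rat (u s) * s)" by (simp add: mult.assoc)
  qed simp
  also have "\<dots> = 0" using u(2) by (simp add: sum_distrib_left[symmetric])
  finally have rel: "(\<Sum>s\<in>S. of_int (a s) * s) = 0" .
  have "\<forall>s\<in>S. a s = 0"
  proof (rule descent_dvd_zero[OF p fin, where P = "\<lambda>a. (\<Sum>s\<in>S. of_int (a s) * s) = 0"])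
    fix a :: "'k \<Rightarrow> int" assume r: "(\<Sum>s\<in>S. of_int (a s) * s) = 0"
    have dv: "\<forall>s\<in>S. p dvd a s"
      using ind r unfolding indep_mod_def by (metis algebraic_int_0 mult_zero_right)
    have "(of_int (a s) :: 'k) = of_int p * of_int (a s div p)" if "s \<in> S" for s
      unfolding of_int_mult[symmetric] using dv that by simp
    then have "0 = (\<Sum>s\<in>S. of_int p * (of_int (a s div p) * s))"
      unfolding r[symmetric] by (intro sum.cong) auto
    then have "(\<Sum>s\<in>S. of_int (a s div p) * s) = 0"
      using p by (simp add: sum_distrib_left[symmetric])
    with dv show "(\<forall>s\<in>S. p dvd a s) \<and> (\<Sum>s\<in>S. of_int (a s div p) * s) = 0" by blast
  qed (rule rel)
  obtain v where v: "v \<in> S" "u v \<noteq> 0" using u(1) by blast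
  with a[of v] \<open>\<forall>s\<in>S. a s = 0\<close> have "of_int D * u v = 0" by simp
  with v(2) Dpos show False by simp
qed

text \<open>Closure of the algebraic integers under sums and products is kept as a hypothesis in this part: it
  will be read off from the ring axioms for the base ring of a group scheme.\<close>

locale algebraic_integers_closed =
  fixes ty :: "'k::field_char_0 itself"
  assumes add_int: "algebraic_int (x::'k) \<Longrightarrow> algebraic_int y \<Longrightarrow> algebraic_int (x + y)"
    and mult_int: "algebraic_int (x::'k) \<Longrightarrow> algebraic_int y \<Longrightarrow> algebraic_int (x * y)"
begin

lemma diff_int: "algebraic_int (x::'k) \<Longrightarrow> algebraic_int y \<Longrightarrow> algebraic_int (x - y)"
  using add_int[of x "- y"] by simp

lemma sum_int: "(\<And>s. s \<in> S \<Longrightarrow> algebraic_int (f s :: 'k)) \<Longrightarrow> algebraic_int (sum f S)"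
  by (induction S rule: infinite_finite_induct) (auto simp: add_int)

definition finitely_many_residues :: "int \<Rightarrow> bool" where
  "finitely_many_residues m \<longleftrightarrow>
     (\<exists>F. finite F \<and> (\<forall>y\<in>F. algebraic_int (y::'k)) \<and>
        (\<forall>x. algebraic_int x \<longrightarrow> (\<exists>y\<in>F. \<exists>z. algebraic_int z \<and> x = y + of_int m * z)))"

text \<open>If \<open>y\<close> runs through residues modulo \<open>m\<close> and \<open>y'\<close> through residues modulo \<open>n\<close>, then \<open>y + m y'\<close>
  runs through residues modulo \<open>m n\<close>.\<close>

lemma finitely_many_residues_mult:
  assumes "finitely_many_residues m" "finitely_many_residues n"
  shows "finitely_many_residues (m * n)"
proof -
  obtain F where F: "finite F" "\<forall>y\<in>F. algebraic_int (y::'k)"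
    "\<And>x. algebraic_int x \<Longrightarrow> \<exists>y\<in>F. \<exists>z. algebraic_int z \<and> x = y + of_int m * z"
    using assms(1) unfolding finitely_many_residues_def by blast
  obtain E where E: "finite E" "\<forall>y\<in>E. algebraic_int (y::'k)"
    "\<And>x. algebraic_int x \<Longrightarrow> \<exists>y\<in>E. \<exists>z. algebraic_int z \<and> x = y + of_int n * z"
    using assms(2) unfolding finitely_many_residues_def by blast
  let ?D = "(\<lambda>(y, y'). y + of_int m * y') ` (F \<times> E)"
  have "\<exists>y\<in>?D. \<exists>z. algebraic_int z \<and> x = y + of_int (m * n) * z" if x: "algebraic_int x" for x
  proof -
    obtain y z where yz: "y \<in> F" "algebraic_int z" "x = y + of_int m * z" using F(3)[OF x] by blast
    obtain y' w where w: "y' \<in> E" "algebraic_int w" "z = y' + of_int n * w" using E(3)[OF yz(2)] by blast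
    have "x = (y + of_int m * y') + of_int (m * n) * w" using yz w by (simp add: algebra_simps)
    moreover have "y + of_int m * y' \<in> ?D" using yz w by auto
    ultimately show ?thesis using w by blast
  qed
  moreover have "finite ?D" using F E by auto
  moreover have "\<forall>y\<in>?D. algebraic_int y" using F E by (auto intro!: add_int mult_int)
  ultimately show ?thesis unfolding finitely_many_residues_def by blast
qed

text \<open>A set that is independent modulo \<open>p\<close> and has the largest possible size spans \<open>O/pO\<close>, because the
  coefficient of a further element in a relation modulo \<open>p\<close> is invertible.  So the integer
  combinations with coefficients in \<open>{0..<p}\<close> represent all residues.\<close>

lemma finitely_many_residues_prime:
  assumes K: "number_field TYPE('k)" and p: "prime (p::int)"
  shows "finitely_many_residues p"
proof -
  have p1: "p > 1" using p by (rule prime_gt_1_int)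
  obtain B where "finite_dimensional_vector_space (\<lambda>(q::rat) (x::'k). of_rat q * x) B"
    using K unfolding number_field_def by blast
  then interpret V: finite_dimensional_vector_space "\<lambda>(q::rat) (x::'k). of_rat q * x" B .
  define X where "X S \<longleftrightarrow> finite S \<and> (\<forall>s\<in>S. algebraic_int s) \<and> indep_mod p S" for S :: "'k set"
  have bound: "card S \<le> card B" if "X S" for S
    using V.independent_card_le_dim[of S UNIV] that V.dim_UNIV
      indep_mod_imp_independent[OF V.vector_space_axioms p1] unfolding X_def by force
  have "X {}" unfolding X_def indep_mod_def by simp
  then obtain S where S: "X S" and mx: "\<And>S'. X S' \<Longrightarrow> card S' \<le> card S"
    using ex_has_greatest_nat[of X "{}" card "Suc (card B)"] bound le_imp_less_Suc by metis
  have fin: "finite S" and Sint: "\<And>s. s \<in> S \<Longrightarrow> algebraic_int s" and ind: "indep_mod p S"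
    using S unfolding X_def by auto
  define F where "F = (\<lambda>a. \<Sum>s\<in>S. of_int (a s) * s) ` (S \<rightarrow>\<^sub>E {0..<p})"
  have "finite F" unfolding F_def using fin by (intro finite_imageI finite_PiE) auto
  moreover have "\<forall>y\<in>F. algebraic_int y"
    unfolding F_def by (auto intro!: sum_int mult_int intro: Sint)
  moreover have "\<exists>y\<in>F. \<exists>z. algebraic_int z \<and> x = y + of_int p * z" if x: "algebraic_int x" for x
  proof -
    \<comment> \<open>Coefficients may be reduced modulo \<open>p\<close>, the quotients being absorbed into the multiple of \<open>p\<close>.\<close>
    have red: "\<exists>y\<in>F. \<exists>z. algebraic_int z \<and> x = y + of_int p * z"
      if ax: "algebraic_int w" "x = (\<Sum>s\<in>S. of_int (b s) * s) + of_int p * w" for b w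
    proof -
      let ?a = "restrict (\<lambda>s. b s mod p) S"
      have "(\<Sum>s\<in>S. of_int (b s) * s) = (\<Sum>s\<in>S. of_int (?a s) * s + of_int p * (of_int (b s div p) * s))"
      proof (rule sum.cong)
        fix s assume "s \<in> S"
        have "(of_int (b s) :: 'k) = of_int (b s mod p + p * (b s div p))"
          by (simp only: mod_mult_div_eq)
        also have "\<dots> = of_int (b s mod p) + of_int p * of_int (b s div p)"
          by (simp only: of_int_add of_int_mult)
        finally have "of_int (b s) * s = (of_int (b s mod p) + of_int p * of_int (b s div p)) * s"
          by (rule arg_cong)
        then show "of_int (b s) * s = of_int (?a s) * s + of_int p * (of_int (b s div p) * s)"
          using \<open>s \<in> S\<close> by (simp only: restrict_apply' distrib_right mult.assoc)
      qed simp
      then have "x = (\<Sum>s\<in>S. of_int (?a s) * s) + of_int p * ((\<Sum>s\<in>S. of_int (b s div p) * s) + w)"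
        using ax by (simp add: sum.distrib sum_distrib_left algebra_simps)
      moreover have "?a \<in> S \<rightarrow>\<^sub>E {0..<p}" using p1 by auto
      moreover have "algebraic_int ((\<Sum>s\<in>S. of_int (b s div p) * s) + w)"
        using ax by (intro add_int sum_int mult_int) (auto intro: Sint)
      ultimately show ?thesis unfolding F_def by blast
    qed
    show ?thesis
    proof (cases "x \<in> S")
      case True
      have "x = (\<Sum>s\<in>S. of_int (if s = x then 1 else 0) * s) + of_int p * 0"
        using True fin by (simp add: if_distrib[of of_int] if_distrib[of "\<lambda>t. t * _"] cong: if_cong)
      then show ?thesis using red[of 0 "\<lambda>s. if s = x then 1 else 0"] by simp
    next
      case False
      have "\<not> X (insert x S)" using mx[of "insert x S"] fin False by auto
      then have "\<not> indep_mod p (insert x S)" using fin Sint x unfolding X_def by auto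
      then obtain a z where az: "algebraic_int z" "(\<Sum>s\<in>insert x S. of_int (a s) * s) = of_int p * z"
        and nd: "\<exists>s\<in>insert x S. \<not> p dvd a s"
        unfolding indep_mod_def by blast
      have rel: "of_int (a x) * x + (\<Sum>s\<in>S. of_int (a s) * s) = of_int p * z"
        using az False fin by simp
      have "\<not> p dvd a x"
      proof
        assume "p dvd a x"
        then obtain c where c: "a x = p * c" by auto
        have "(\<Sum>s\<in>S. of_int (a s) * s) = of_int p * (z - of_int c * x)"
          using rel c by (simp add: algebra_simps eq_diff_eq)
        moreover have "algebraic_int (z - of_int c * x)" using az x by (auto intro!: diff_int mult_int)
        ultimately have "\<forall>s\<in>S. p dvd a s" using ind unfolding indep_mod_def by blast
        with nd \<open>p dvd a x\<close> show False by auto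
      qed
      then have "coprime (a x) p" using p by (metis coprime_commute prime_imp_coprime)
      then obtain u where "[a x * u = 1] (mod p)" using cong_solve_coprime_int by blast
      then have "p dvd a x * u - 1" by (simp add: cong_iff_dvd_diff)
      then obtain v where v: "a x * u = 1 + p * v" by (metis diff_add_cancel add.commute dvdE)
      have v': "(of_int (a x) * of_int u :: 'k) = 1 + of_int p * of_int v"
        using arg_cong[OF v, of "of_int :: int \<Rightarrow> 'k"] by simp
      have "of_int u * (of_int (a x) * x) = of_int u * (of_int p * z - (\<Sum>s\<in>S. of_int (a s) * s))"
        using rel by (simp add: eq_diff_eq)
      then have "(1 + of_int p * of_int v) * x =
          of_int u * (of_int p * z) - of_int u * (\<Sum>s\<in>S. of_int (a s) * s)"
        unfolding v'[symmetric] by (simp add: algebra_simps)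
      then have "x = - (of_int u * (\<Sum>s\<in>S. of_int (a s) * s)) + of_int p * (of_int u * z - of_int v * x)"
        by (simp add: algebra_simps)
      also have "- (of_int u * (\<Sum>s\<in>S. of_int (a s) * s)) = (\<Sum>s\<in>S. of_int (- u * a s) * s)"
        by (simp add: sum_distrib_left sum_negf mult.assoc)
      finally show ?thesis
        using red[of "of_int u * z - of_int v * x" "\<lambda>s. - u * a s"] az x
        by (auto intro!: diff_int mult_int)
    qed
  qed
  ultimately show ?thesis unfolding finitely_many_residues_def by blast
qed

lemma finitely_many_residues:
  assumes K: "number_field TYPE('k)" and m: "m \<noteq> 0"
  shows "finitely_many_residues m"
  using m
proof (induction m rule: prime_divisors_induct)
  case (unit x)
  then have xx: "x * x = 1" by (metis abs_mult_self_eq zdvd1_eq mult_1)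
  have xx': "(of_int x * of_int x :: 'k) = 1"
    unfolding of_int_mult[symmetric] xx by simp
  have "\<exists>y\<in>{0}. \<exists>z. algebraic_int z \<and> w = y + of_int x * z" if "algebraic_int (w::'k)" for w
    by (rule bexI[of _ 0], rule exI[of _ "of_int x * w"])
       (use that xx' in \<open>auto intro!: mult_int simp: mult.assoc[symmetric]\<close>)
  then show ?case unfolding finitely_many_residues_def by (intro exI[of _ "{0}"]) auto
next
  case (factor p x)
  then show ?case
    using finitely_many_residues_mult[OF finitely_many_residues_prime[OF K]] by auto
qed simp

text \<open>In an integral equation of least degree for \<open>x \<noteq> 0\<close> the constant term is nonzero, and it is a
  multiple of \<open>x\<close>.\<close>

lemma ideal_contains_integer:
  assumes I: "ideal I (ring_of_integers :: 'k ring)" and x: "x \<in> I" "x \<noteq> 0"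
  shows "\<exists>m. m \<noteq> 0 \<and> of_int m \<in> I"
proof -
  interpret ideal I "ring_of_integers :: 'k ring" by (rule I)
  have sub: "I \<subseteq> {x. algebraic_int x}" using a_subset by (simp add: ring_of_integers_def)
  have "algebraic_int x" using sub x by auto
  then obtain p0 where p0: "lead_coeff p0 = 1" "\<forall>i. poly.coeff p0 i \<in> \<int>" "poly p0 x = 0"
    by (auto elim: algebraic_int.cases)
  define P where "P p \<longleftrightarrow> lead_coeff p = 1 \<and> (\<forall>i. poly.coeff p i \<in> \<int>) \<and> poly p x = 0" for p
  have "P p0" using p0 unfolding P_def by blast
  then obtain p where p: "P p" and mn: "\<And>q. P q \<Longrightarrow> degree p \<le> degree q"
    using ex_has_least_nat[of P p0 degree] by blast
  obtain c q where cq: "p = pCons c q" by (cases p) auto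
  have co: "poly.coeff q i \<in> \<int>" for i using p cq unfolding P_def by (metis coeff_pCons_Suc)
  have eq: "c + x * poly q x = 0" using p cq unfolding P_def by simp
  have q0: "q \<noteq> 0" using p cq x eq unfolding P_def by (auto split: if_splits)
  have "c \<noteq> 0"
  proof
    assume "c = 0"
    then have "poly q x = 0" using eq x by simp
    moreover have "lead_coeff q = 1" using p q0 cq unfolding P_def by simp
    ultimately have "P q" using co unfolding P_def by blast
    from mn[OF this] show False using cq q0 by simp
  qed
  have "c \<in> \<int>" using p cq unfolding P_def by (metis coeff_pCons_0)
  then obtain m where m: "c = of_int m" by (auto elim: Ints_cases)
  have pw: "algebraic_int (x ^ i)" for i
    by (induction i) (use \<open>algebraic_int x\<close> in \<open>auto intro: mult_int\<close>)
  have "algebraic_int (- poly q x)"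
    unfolding poly_altdef algebraic_int_minus_iff
    by (intro sum_int mult_int pw int_imp_algebraic_int co)
  then have "(- poly q x) \<otimes>\<^bsub>ring_of_integers\<^esub> x \<in> I"
    using x by (intro I_l_closed) (simp_all add: ring_of_integers_def)
  moreover have "(- poly q x) \<otimes>\<^bsub>ring_of_integers\<^esub> x = c"
    using eq by (simp add: ring_of_integers_def mult.commute[of "poly q x"] neg_eq_iff_add_eq_0 add.commute)
  ultimately show ?thesis using m \<open>c \<noteq> 0\<close> by (metis of_int_0)
qed

end

lemma finite_quotient_ring_of_integers:
  assumes K: "number_field TYPE('k::field_char_0)" and R: "cring (ring_of_integers :: 'k ring)"
    and I: "I \<in> nonzero_ideals (ring_of_integers :: 'k ring)"
  shows "finite (carrier ((ring_of_integers :: 'k ring) Quot I))"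
proof -
  let ?R = "ring_of_integers :: 'k ring"
  interpret R: cring ?R by (rule R)
  interpret algebraic_integers_closed "TYPE('k)"
    by unfold_locales (use R.a_closed R.m_closed in \<open>auto simp: ring_of_integers_def\<close>)
  have idl: "ideal I ?R" and ne: "I \<noteq> {0}"
    using I by (auto simp: nonzero_ideals_def ring_of_integers_def)
  interpret ideal I ?R by (rule idl)
  have "0 \<in> I" using additive_subgroup.zero_closed[OF additive_subgroup_axioms]
    by (simp add: ring_of_integers_def)
  then obtain x where "x \<in> I" "x \<noteq> 0" using ne by blast
  then obtain m where m: "m \<noteq> 0" "of_int m \<in> I" using ideal_contains_integer[OF idl] by blast
  obtain F where F: "finite F" "\<forall>y\<in>F. algebraic_int (y::'k)"
    "\<And>x. algebraic_int x \<Longrightarrow> \<exists>y\<in>F. \<exists>z. algebraic_int z \<and> x = y + of_int m * z"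
    using finitely_many_residues[OF K m(1)] unfolding finitely_many_residues_def by blast
  have "carrier (?R Quot I) \<subseteq> (\<lambda>y. I +>\<^bsub>?R\<^esub> y) ` F"
  proof
    fix Y assume "Y \<in> carrier (?R Quot I)"
    then obtain x where x: "x \<in> carrier ?R" "Y = I +>\<^bsub>?R\<^esub> x"
      by (auto simp: FactRing_def A_RCOSETS_def')
    then obtain y z where yz: "y \<in> F" "algebraic_int z" "x = y + of_int m * z"
      using F(3)[of x] by (auto simp: ring_of_integers_def)
    have "z \<otimes>\<^bsub>?R\<^esub> of_int m \<in> I" using m yz by (intro I_l_closed) (simp_all add: ring_of_integers_def)
    then have mz: "of_int m * z \<in> I" by (simp add: ring_of_integers_def mult.commute)
    have "x \<in> I +>\<^bsub>?R\<^esub> y"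
      unfolding a_r_coset_def' using mz yz by (auto simp: ring_of_integers_def add.commute)
    then have "I +>\<^bsub>?R\<^esub> x = I +>\<^bsub>?R\<^esub> y"
      using R.a_repr_independence[of x I y] F(2) yz a_subgroup
      by (simp add: ring_of_integers_def)
    then show "Y \<in> (\<lambda>y. I +>\<^bsub>?R\<^esub> y) ` F" using x yz by auto
  qed
  then show ?thesis using F(1) finite_surj by blast
qed

section \<open>Tensor products of commutative algebras\<close>

lemma single_mult_eq_frag_cmul: "Poly_Mapping.single x (c * d) = frag_cmul c (frag_cmul d (frag_of x))"
  by (rule poly_mapping_eqI) (simp add: lookup_single when_def)

lemma frag_extend_fun_diff: "frag_extend (\<lambda>p. f p - g p) P = frag_extend f P - frag_extend g P"
proof -
  have "frag_cmul c (x - y) = frag_cmul c x - frag_cmul c y" for c and x y :: "'a \<Rightarrow>\<^sub>0 int"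
    by (rule poly_mapping_eqI) (simp add: lookup_minus right_diff_distrib)
  then show ?thesis by (simp add: frag_extend_def sum_subtractf)
qed

text \<open>The product of the monoid ring \<open>\<int>[S]\<close> of a monoid with operation \<open>m\<close>.  In the
  lemmas below, \<open>S\<close> is a set that carries the laws of \<open>m\<close> and contains the supports of the factors.\<close>

definition frag_conv :: "('a \<Rightarrow> 'a \<Rightarrow> 'a) \<Rightarrow> ('a \<Rightarrow>\<^sub>0 int) \<Rightarrow> ('a \<Rightarrow>\<^sub>0 int) \<Rightarrow> ('a \<Rightarrow>\<^sub>0 int)" where
  "frag_conv m P Q = frag_extend (\<lambda>p. frag_extend (\<lambda>q. frag_of (m p q)) Q) P"

lemma frag_conv_simps [simp]:
  "frag_conv m 0 Q = 0" "frag_conv m P 0 = 0"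
  "frag_conv m (P - P') Q = frag_conv m P Q - frag_conv m P' Q"
  "frag_conv m P (Q - Q') = frag_conv m P Q - frag_conv m P Q'"
  "frag_conv m (frag_of p) (frag_of q) = frag_of (m p q)"
  by (simp_all add: frag_conv_def frag_extend_diff frag_extend_fun_diff frag_extend_eq_0)

lemma frag_conv_add [simp]:
  "frag_conv m (P + P') Q = frag_conv m P Q + frag_conv m P' Q"
  "frag_conv m P (Q + Q') = frag_conv m P Q + frag_conv m P Q'"
  using frag_conv_simps(3)[of m "P + P'" P' Q] frag_conv_simps(4)[of m P "Q + Q'" Q']
  by (simp_all add: algebra_simps)

lemma frag_conv_keys:
  assumes "\<And>p q. p \<in> S \<Longrightarrow> q \<in> S \<Longrightarrow> m p q \<in> S"
    and "Poly_Mapping.keys P \<subseteq> S" "Poly_Mapping.keys Q \<subseteq> S"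
  shows "Poly_Mapping.keys (frag_conv m P Q) \<subseteq> S"
proof -
  have "Poly_Mapping.keys (frag_extend (\<lambda>q. frag_of (m p q)) Q) \<subseteq> S" if "p \<in> S" for p
    using keys_frag_extend[of "\<lambda>q. frag_of (m p q)" Q] assms that by fastforce
  then show ?thesis
    unfolding frag_conv_def
    using keys_frag_extend[of "\<lambda>p. frag_extend (\<lambda>q. frag_of (m p q)) Q" P] assms(2) by blast
qed

lemma frag_conv_assoc:
  assumes m: "\<And>p q r. p \<in> S \<Longrightarrow> q \<in> S \<Longrightarrow> r \<in> S \<Longrightarrow> m (m p q) r = m p (m q r)"
    and P: "Poly_Mapping.keys P \<subseteq> S" and Q: "Poly_Mapping.keys Q \<subseteq> S" and R: "Poly_Mapping.keys R \<subseteq> S"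
  shows "frag_conv m (frag_conv m P Q) R = frag_conv m P (frag_conv m Q R)"
  using P
proof (induction P rule: frag_induction)
  case (one p)
  show ?case using Q
  proof (induction Q rule: frag_induction)
    case (one q)
    show ?case using R by (induction R rule: frag_induction) (use \<open>p \<in> S\<close> one in \<open>simp_all add: m\<close>)
  qed simp_all
qed simp_all

lemma frag_conv_commute:
  assumes m: "\<And>p q. p \<in> S \<Longrightarrow> q \<in> S \<Longrightarrow> m p q = m q p"
    and P: "Poly_Mapping.keys P \<subseteq> S" and Q: "Poly_Mapping.keys Q \<subseteq> S"
  shows "frag_conv m P Q = frag_conv m Q P"
  using P
proof (induction P rule: frag_induction)
  case (one p)
  show ?case using Q by (induction Q rule: frag_induction) (use one in \<open>simp_all add: m\<close>)
qed simp_all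

lemma frag_conv_one:
  assumes m: "\<And>p. p \<in> S \<Longrightarrow> m e p = p" and P: "Poly_Mapping.keys P \<subseteq> S"
  shows "frag_conv m (frag_of e) P = P"
  using P by (induction P rule: frag_induction) (simp_all add: m)

abbreviation pair_mult where
  "pair_mult A B \<equiv> (\<lambda>p q. (fst p \<otimes>\<^bsub>A\<^esub> fst q, snd p \<otimes>\<^bsub>B\<^esub> snd q))"

lemma pair_ring_simps [simp]:
  "carrier (pair_ring A B) = {P. Poly_Mapping.keys P \<subseteq> carrier A \<times> carrier B}"
  "P \<otimes>\<^bsub>pair_ring A B\<^esub> Q = frag_conv (pair_mult A B) P Q"
  "\<one>\<^bsub>pair_ring A B\<^esub> = frag_of (\<one>\<^bsub>A\<^esub>, \<one>\<^bsub>B\<^esub>)"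
  "\<zero>\<^bsub>pair_ring A B\<^esub> = 0"
  "P \<oplus>\<^bsub>pair_ring A B\<^esub> Q = P + Q"
proof -
  show "P \<otimes>\<^bsub>pair_ring A B\<^esub> Q = frag_conv (pair_mult A B) P Q"
    by (simp add: pair_ring_def frag_conv_def frag_extend_def frag_cmul_sum single_mult_eq_frag_cmul del: frag_cmul_cmul)
qed (simp_all add: pair_ring_def)

lemma cring_pair_ring:
  assumes "cring A" "cring B"
  shows "cring (pair_ring A B)"
proof -
  interpret A: cring A by fact
  interpret B: cring B by fact
  let ?S = "carrier A \<times> carrier B"
  note cl = frag_conv_keys[where S = ?S and m = "pair_mult A B"]
  show ?thesis
  proof (rule cringI)
    show "abelian_group (pair_ring A B)"
    proof (rule abelian_groupI)
      fix P assume "P \<in> carrier (pair_ring A B)"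
      then show "\<exists>y\<in>carrier (pair_ring A B). y \<oplus>\<^bsub>pair_ring A B\<^esub> P = \<zero>\<^bsub>pair_ring A B\<^esub>"
        by (intro bexI[of _ "- P"]) (auto simp: keys_minus)
    qed (auto simp: add.assoc add.commute dest!: subsetD[OF keys_add])
    show "Group.comm_monoid (pair_ring A B)"
    proof (rule comm_monoidI)
      fix P Q R assume "P \<in> carrier (pair_ring A B)" "Q \<in> carrier (pair_ring A B)" "R \<in> carrier (pair_ring A B)"
      then show "P \<otimes>\<^bsub>pair_ring A B\<^esub> Q \<otimes>\<^bsub>pair_ring A B\<^esub> R = P \<otimes>\<^bsub>pair_ring A B\<^esub> (Q \<otimes>\<^bsub>pair_ring A B\<^esub> R)"
        using frag_conv_assoc[of ?S "pair_mult A B" P Q R] by (auto simp: A.m_assoc B.m_assoc)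
    next
      fix P Q assume PQ: "P \<in> carrier (pair_ring A B)" "Q \<in> carrier (pair_ring A B)"
      then show "P \<otimes>\<^bsub>pair_ring A B\<^esub> Q \<in> carrier (pair_ring A B)"
        using cl[of P Q] by (simp add: mem_Times_iff)
      show "P \<otimes>\<^bsub>pair_ring A B\<^esub> Q = Q \<otimes>\<^bsub>pair_ring A B\<^esub> P"
        using PQ frag_conv_commute[of ?S "pair_mult A B" P Q] by (auto simp: A.m_comm B.m_comm)
    next
      fix P assume "P \<in> carrier (pair_ring A B)"
      then show "\<one>\<^bsub>pair_ring A B\<^esub> \<otimes>\<^bsub>pair_ring A B\<^esub> P = P"
        using frag_conv_one[of ?S "pair_mult A B" "(\<one>\<^bsub>A\<^esub>, \<one>\<^bsub>B\<^esub>)" P] by auto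
    qed (auto simp: keys_frag_of)
  qed simp
qed

text \<open>The additive map from the free abelian group on \<open>'p\<close> that extends \<open>h\<close>; this is the map evaluated by
  \<^const>\<open>tensor_lift\<close> on a representative.\<close>

definition linear_extension :: "('c, 'm) ring_scheme \<Rightarrow> ('p \<Rightarrow> 'c) \<Rightarrow> ('p \<Rightarrow>\<^sub>0 int) \<Rightarrow> 'c" where
  "linear_extension C h P = (\<Oplus>\<^bsub>C\<^esub>p\<in>Poly_Mapping.keys P. [Poly_Mapping.lookup P p] \<cdot>\<^bsub>C\<^esub> h p)"

context cring
begin

lemma add_pow_zero_int [simp]: "[(0::int)] \<cdot> x = \<zero>"
  by (simp add: add_pow_def)

lemma add_pow_int_closed: "x \<in> carrier R \<Longrightarrow> [(k::int)] \<cdot> x \<in> carrier R"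
  by (rule add.int_pow_closed)

lemma linear_extension_superset:
  assumes "finite T" "Poly_Mapping.keys P \<subseteq> T" "h \<in> T \<rightarrow> carrier R"
  shows "linear_extension R h P = (\<Oplus>p\<in>T. [Poly_Mapping.lookup P p] \<cdot> h p)"
  unfolding linear_extension_def
  using assms by (intro add.finprod_mono_neutral_cong_left) (auto simp: in_keys_iff Pi_iff intro: add_pow_int_closed)

lemma linear_extension_closed:
  assumes "Poly_Mapping.keys P \<subseteq> S" "h \<in> S \<rightarrow> carrier R"
  shows "linear_extension R h P \<in> carrier R"
  unfolding linear_extension_def using assms by (intro finsum_closed) (auto simp: Pi_iff intro!: add_pow_int_closed)

lemma linear_extension_zero [simp]: "linear_extension R h 0 = \<zero>"
  by (simp add: linear_extension_def)

lemma linear_extension_of [simp]: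
  assumes "h p \<in> carrier R"
  shows "linear_extension R h (frag_of p) = h p"
  using assms add.int_pow_1[of "h p"] by (simp add: linear_extension_def keys_frag_of)

lemma linear_extension_add:
  assumes "Poly_Mapping.keys P \<subseteq> S" "Poly_Mapping.keys Q \<subseteq> S" and h: "h \<in> S \<rightarrow> carrier R"
  shows "linear_extension R h (P + Q) = linear_extension R h P \<oplus> linear_extension R h Q"
proof -
  let ?T = "Poly_Mapping.keys P \<union> Poly_Mapping.keys Q"
  have hT: "h \<in> ?T \<rightarrow> carrier R" using assms by auto
  have ks: "Poly_Mapping.keys (P + Q) \<subseteq> ?T" by (rule keys_add)
  have fT: "finite ?T" by simp
  have cl: "(\<lambda>p. [Poly_Mapping.lookup X p] \<cdot> h p) \<in> ?T \<rightarrow> carrier R" for X :: "'c \<Rightarrow>\<^sub>0 int"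
    using hT by (auto simp: Pi_iff intro!: add_pow_int_closed)
  have "linear_extension R h (P + Q) = (\<Oplus>p\<in>?T. [Poly_Mapping.lookup (P + Q) p] \<cdot> h p)"
    by (rule linear_extension_superset[OF fT ks hT])
  also have "\<dots> = (\<Oplus>p\<in>?T. [Poly_Mapping.lookup P p] \<cdot> h p \<oplus> [Poly_Mapping.lookup Q p] \<cdot> h p)"
  proof (rule finsum_cong'[OF refl])
    fix p assume "p \<in> ?T"
    then have "h p \<in> carrier R" using hT by blast
    then show "[Poly_Mapping.lookup (P + Q) p] \<cdot> h p
        = [Poly_Mapping.lookup P p] \<cdot> h p \<oplus> [Poly_Mapping.lookup Q p] \<cdot> h p"
      unfolding lookup_add by (rule add.int_pow_mult)
  qed (use cl in \<open>auto simp: Pi_iff\<close>)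
  also have "\<dots> = (\<Oplus>p\<in>?T. [Poly_Mapping.lookup P p] \<cdot> h p) \<oplus> (\<Oplus>p\<in>?T. [Poly_Mapping.lookup Q p] \<cdot> h p)"
    by (rule finsum_addf[OF cl cl])
  also have "\<dots> = linear_extension R h P \<oplus> linear_extension R h Q"
    using linear_extension_superset[OF fT _ hT, of P] linear_extension_superset[OF fT _ hT, of Q] by simp
  finally show ?thesis .
qed

lemma linear_extension_diff:
  assumes P: "Poly_Mapping.keys P \<subseteq> S" and Q: "Poly_Mapping.keys Q \<subseteq> S" and h: "h \<in> S \<rightarrow> carrier R"
  shows "linear_extension R h (P - Q) = linear_extension R h P \<ominus> linear_extension R h Q"
proof -
  have k: "Poly_Mapping.keys (P - Q) \<subseteq> S" using P Q keys_diff[of P Q] by auto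
  have "linear_extension R h P = linear_extension R h (P - Q) \<oplus> linear_extension R h Q"
    using linear_extension_add[OF k Q h] by simp
  then show ?thesis
    using linear_extension_closed[OF k h] linear_extension_closed[OF Q h]
    by (simp add: a_minus_def a_assoc r_neg)
qed

lemma linear_extension_cong:
  assumes "\<And>p. p \<in> Poly_Mapping.keys P \<Longrightarrow> h p = h' p" "h' \<in> Poly_Mapping.keys P \<rightarrow> carrier R"
  shows "linear_extension R h P = linear_extension R h' P"
  unfolding linear_extension_def using assms
  by (intro finsum_cong') (auto simp: Pi_iff intro!: add_pow_int_closed)

lemma linear_extension_conv:
  assumes h: "h \<in> S \<rightarrow> carrier R"
    and m: "\<And>p q. p \<in> S \<Longrightarrow> q \<in> S \<Longrightarrow> m p q \<in> S"
    and hm: "\<And>p q. p \<in> S \<Longrightarrow> q \<in> S \<Longrightarrow> h (m p q) = h p \<otimes> h q"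
    and P: "Poly_Mapping.keys P \<subseteq> S" and Q: "Poly_Mapping.keys Q \<subseteq> S"
  shows "linear_extension R h (frag_conv m P Q) = linear_extension R h P \<otimes> linear_extension R h Q"
proof -
  define X where "X P Q \<longleftrightarrow> Poly_Mapping.keys P \<subseteq> S \<and> Poly_Mapping.keys Q \<subseteq> S \<and>
    linear_extension R h (frag_conv m P Q) = linear_extension R h P \<otimes> linear_extension R h Q" for P Q
  note cl = linear_extension_closed[OF _ h] and ck = frag_conv_keys[where S = S and m = m, OF m]
  have dk: "Poly_Mapping.keys (a - b) \<subseteq> S" if "Poly_Mapping.keys a \<subseteq> S" "Poly_Mapping.keys b \<subseteq> S" for a b
    using that keys_diff[of a b] by auto
  have "X P Q"
    using P
  proof (induction P rule: frag_induction)
    case (one p)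
    show ?case using Q
    proof (induction Q rule: frag_induction)
      case (one q)
      then show ?case using \<open>p \<in> S\<close> h m hm by (auto simp: X_def keys_frag_of Pi_iff)
    next
      case (diff a b)
      then show ?case unfolding X_def
        using dk[of a b] ck[of "frag_of p" a] ck[of "frag_of p" b] cl[of a] cl[of b] cl[of "frag_of p"]
        by (auto simp: linear_extension_diff[OF _ _ h] minus_eq r_distr r_minus)
    qed (use one h in \<open>auto simp: X_def keys_frag_of Pi_iff\<close>)
  next
    case (diff a b)
    then show ?case unfolding X_def
      using dk[of a b] ck[of a Q] ck[of b Q] cl[of a] cl[of b] cl[of Q]
      by (auto simp: linear_extension_diff[OF _ _ h] minus_eq l_distr l_minus)
  qed (use Q cl in \<open>auto simp: X_def\<close>)
  then show ?thesis by (simp add: X_def)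
qed

end

lemma ring_hom_linear_extension:
  assumes "cring D" "cring C" and \<phi>: "\<phi> \<in> ring_hom D C" and h: "h \<in> Poly_Mapping.keys P \<rightarrow> carrier D"
  shows "\<phi> (linear_extension D h P) = linear_extension C (\<phi> \<circ> h) P"
proof -
  interpret D: cring D by fact
  interpret C: cring C by fact
  interpret ring_hom_cring D C \<phi> using \<phi> by unfold_locales auto
  have pw: "\<phi> ([k] \<cdot>\<^bsub>D\<^esub> x) = [k] \<cdot>\<^bsub>C\<^esub> \<phi> x" if "x \<in> carrier D" for k :: int and x
    using hom_int_pow[of \<phi> "add_monoid D" "add_monoid C" x k] that D.add.is_group C.add.is_group
    by (auto simp: hom_def add_pow_def)
  show ?thesis
    unfolding linear_extension_def
    using h by (subst hom_finsum) (auto intro!: C.finsum_cong' simp: pw Pi_iff)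
qed

subsection \<open>Algebra homomorphisms and the tensor product\<close>

lemma alg_homI:
  assumes "f \<in> ring_hom A B" "\<And>r a. r \<in> carrier R \<Longrightarrow> a \<in> carrier A \<Longrightarrow> f (r \<odot>\<^bsub>A\<^esub> a) = r \<odot>\<^bsub>B\<^esub> f a"
  shows "f \<in> alg_hom R A B"
  using assms by (simp add: alg_hom_def)

lemma alg_homD:
  assumes "f \<in> alg_hom R A B"
  shows "f \<in> ring_hom A B" "\<And>r a. r \<in> carrier R \<Longrightarrow> a \<in> carrier A \<Longrightarrow> f (r \<odot>\<^bsub>A\<^esub> a) = r \<odot>\<^bsub>B\<^esub> f a"
    "\<And>a. a \<in> carrier A \<Longrightarrow> f a \<in> carrier B"
  using assms by (auto simp: alg_hom_def ring_hom_closed)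

lemma alg_hom_compose:
  assumes "f \<in> alg_hom R A B" "g \<in> alg_hom R B C"
  shows "(\<lambda>a. g (f a)) \<in> alg_hom R A C"
  using ring_hom_trans[of f A B g C] alg_homD[OF assms(1)] alg_homD[OF assms(2)]
  by (intro alg_homI) (simp_all add: comp_def)

lemma alg_hom_cong:
  assumes "f \<in> alg_hom R A B" "\<And>a. a \<in> carrier A \<Longrightarrow> g a = f a" and "algebra R A"
  shows "g \<in> alg_hom R A B"
proof -
  interpret A: Module.algebra R A by fact
  show ?thesis using assms(1,2) by (auto simp: alg_hom_def ring_hom_def Pi_iff)
qed

lemma algebra_of_simps [simp]:
  "carrier (algebra_of B \<phi>) = carrier B" "monoid.mult (algebra_of B \<phi>) = monoid.mult B" "one (algebra_of B \<phi>) = one B"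
  "zero (algebra_of B \<phi>) = zero B" "add (algebra_of B \<phi>) = add B"
  "r \<odot>\<^bsub>algebra_of B \<phi>\<^esub> b = \<phi> r \<otimes>\<^bsub>B\<^esub> b"
  by (simp_all add: algebra_of_def)

lemma cring_algebra_of: "cring B \<Longrightarrow> cring (algebra_of B \<phi>)"
proof -
  assume "cring B"
  then interpret cring B .
  show ?thesis
  proof (rule cringI)
    show "abelian_group (algebra_of B \<phi>)"
      by (rule abelian_groupI) (auto simp: a_ac intro: add.l_inv_ex)
    show "Group.comm_monoid (algebra_of B \<phi>)" by (rule comm_monoidI) (auto simp: m_ac)
  qed (simp add: l_distr)
qed

lemma algebra_algebra_of:
  assumes "cring R" "cring B" "\<phi> \<in> ring_hom R B"
  shows "algebra R (algebra_of B \<phi>)"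
proof -
  interpret R: cring R by fact
  interpret B: cring B by fact
  interpret ring_hom_cring R B \<phi> using assms by unfold_locales auto
  show ?thesis
    by (rule algebraI) (auto simp: assms cring_algebra_of B.l_distr B.r_distr B.m_assoc)
qed

text \<open>The two factors of a tensor product are commutative algebras; the first one may itself be a
  tensor product, which is how threefold products arise.\<close>

locale tensor_product = A: Module.algebra R A + B: Module.algebra R B
  for R :: "('r, 'm) ring_scheme" and A :: "('r, 'a, 'n) module_scheme" and B :: "('r, 'b, 'p) module_scheme"
begin

abbreviation "PR \<equiv> pair_ring A B"
abbreviation "J \<equiv> tensor_ideal R A B"
abbreviation "T \<equiv> tensor R A B"
abbreviation "pt \<equiv> pure_tensor R A B"

definition relations :: "(('a \<times> 'b) \<Rightarrow>\<^sub>0 int) set" where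
  "relations =
     {frag_of (a \<oplus>\<^bsub>A\<^esub> a', b) - frag_of (a, b) - frag_of (a', b) | a a' b.
          a \<in> carrier A \<and> a' \<in> carrier A \<and> b \<in> carrier B}
      \<union> {frag_of (a, b \<oplus>\<^bsub>B\<^esub> b') - frag_of (a, b) - frag_of (a, b') | a b b'.
          a \<in> carrier A \<and> b \<in> carrier B \<and> b' \<in> carrier B}
      \<union> {frag_of (r \<odot>\<^bsub>A\<^esub> a, b) - frag_of (a, r \<odot>\<^bsub>B\<^esub> b) | r a b.
          r \<in> carrier R \<and> a \<in> carrier A \<and> b \<in> carrier B}"

lemma J_eq: "J = Idl\<^bsub>PR\<^esub> relations"
  by (simp add: tensor_ideal_def relations_def)

sublocale PR: cring PR
  by (rule cring_pair_ring) (rule A.M_cring B.M_cring)+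

lemma keys_diff_subset: "Poly_Mapping.keys P \<subseteq> S \<Longrightarrow> Poly_Mapping.keys Q \<subseteq> S \<Longrightarrow> Poly_Mapping.keys (P - Q) \<subseteq> S"
  using keys_diff[of P Q] by auto

lemma relations_carrier: "relations \<subseteq> carrier PR"
proof -
  have "frag_of x - frag_of y - frag_of z \<in> carrier PR" "frag_of x - frag_of y \<in> carrier PR"
    if "x \<in> carrier A \<times> carrier B" "y \<in> carrier A \<times> carrier B" "z \<in> carrier A \<times> carrier B" for x y z
    using that unfolding pair_ring_simps mem_Collect_eq
    by (intro keys_diff_subset; simp add: keys_frag_of mem_Times_iff)+
  then show ?thesis unfolding relations_def
    by (intro Un_least subsetI; elim CollectE exE conjE; simp only:)
       (metis A.a_closed B.a_closed A.smult_closed B.smult_closed mem_Sigma_iff)+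
qed

sublocale J: ideal J PR
  unfolding J_eq by (rule PR.genideal_ideal[OF relations_carrier])

lemma relations_J: "relations \<subseteq> J"
  unfolding J_eq by (rule PR.genideal_self[OF relations_carrier])

lemma PR_minus: "P \<in> carrier PR \<Longrightarrow> Q \<in> carrier PR \<Longrightarrow> P \<ominus>\<^bsub>PR\<^esub> Q = P - Q"
proof -
  assume P: "P \<in> carrier PR" and Q: "Q \<in> carrier PR"
  have "\<ominus>\<^bsub>PR\<^esub> Q = - Q"
    using Q by (intro PR.minus_equality) (auto simp: keys_minus)
  then show ?thesis by (simp add: a_minus_def)
qed

sublocale Q: cring "PR Quot J"
  by (rule J.quotient_is_cring[OF PR.is_cring])

lemma coset_eqI:
  assumes "P \<in> carrier PR" "Q \<in> carrier PR" "P - Q \<in> J"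
  shows "J +>\<^bsub>PR\<^esub> P = J +>\<^bsub>PR\<^esub> Q"
  using assms PR.quotient_eq_iff_same_a_r_cos[OF J.ideal_axioms, of P Q] PR_minus by auto

lemma pair_carrier: "a \<in> carrier A \<Longrightarrow> b \<in> carrier B \<Longrightarrow> frag_of (a, b) \<in> carrier PR"
  by (simp add: keys_frag_of)

lemma pt_closed: "a \<in> carrier A \<Longrightarrow> b \<in> carrier B \<Longrightarrow> pt a b \<in> carrier (PR Quot J)"
  unfolding pure_tensor_def using ring_hom_closed[OF J.rcos_ring_hom pair_carrier] by blast

lemma pt_mult:
  assumes "a \<in> carrier A" "b \<in> carrier B" "a' \<in> carrier A" "b' \<in> carrier B"
  shows "pt a b \<otimes>\<^bsub>PR Quot J\<^esub> pt a' b' = pt (a \<otimes>\<^bsub>A\<^esub> a') (b \<otimes>\<^bsub>B\<^esub> b')"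
  unfolding pure_tensor_def
  using ring_hom_mult[OF J.rcos_ring_hom pair_carrier[OF assms(1,2)] pair_carrier[OF assms(3,4)]] by simp

lemma pt_add_left:
  assumes "a \<in> carrier A" "a' \<in> carrier A" "b \<in> carrier B"
  shows "pt (a \<oplus>\<^bsub>A\<^esub> a') b = pt a b \<oplus>\<^bsub>PR Quot J\<^esub> pt a' b"
proof -
  have "frag_of (a \<oplus>\<^bsub>A\<^esub> a', b) - frag_of (a, b) - frag_of (a', b) \<in> relations"
    unfolding relations_def by (rule UnI1, rule UnI1) (rule CollectI, (rule exI)+, rule conjI, rule refl, simp add: assms)
  then have "frag_of (a \<oplus>\<^bsub>A\<^esub> a', b) - frag_of (a, b) - frag_of (a', b) \<in> J"
    by (rule subsetD[OF relations_J])
  then have "pt (a \<oplus>\<^bsub>A\<^esub> a') b = J +>\<^bsub>PR\<^esub> (frag_of (a, b) \<oplus>\<^bsub>PR\<^esub> frag_of (a', b))"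
    unfolding pure_tensor_def
    using assms by (intro coset_eqI PR.a_closed pair_carrier) (simp_all add: diff_diff_eq)
  then show ?thesis
    unfolding pure_tensor_def
    using ring_hom_add[OF J.rcos_ring_hom pair_carrier[OF assms(1,3)] pair_carrier[OF assms(2,3)]] by simp
qed

lemma pt_add_right:
  assumes "a \<in> carrier A" "b \<in> carrier B" "b' \<in> carrier B"
  shows "pt a (b \<oplus>\<^bsub>B\<^esub> b') = pt a b \<oplus>\<^bsub>PR Quot J\<^esub> pt a b'"
proof -
  have "frag_of (a, b \<oplus>\<^bsub>B\<^esub> b') - frag_of (a, b) - frag_of (a, b') \<in> relations"
    unfolding relations_def by (rule UnI1, rule UnI2) (rule CollectI, (rule exI)+, rule conjI, rule refl, simp add: assms)
  then have "frag_of (a, b \<oplus>\<^bsub>B\<^esub> b') - frag_of (a, b) - frag_of (a, b') \<in> J"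
    by (rule subsetD[OF relations_J])
  then have "pt a (b \<oplus>\<^bsub>B\<^esub> b') = J +>\<^bsub>PR\<^esub> (frag_of (a, b) \<oplus>\<^bsub>PR\<^esub> frag_of (a, b'))"
    unfolding pure_tensor_def
    using assms by (intro coset_eqI PR.a_closed pair_carrier) (simp_all add: diff_diff_eq)
  then show ?thesis
    unfolding pure_tensor_def
    using ring_hom_add[OF J.rcos_ring_hom pair_carrier[OF assms(1,2)] pair_carrier[OF assms(1,3)]] by simp
qed

lemma pt_balanced:
  assumes "r \<in> carrier R" "a \<in> carrier A" "b \<in> carrier B"
  shows "pt (r \<odot>\<^bsub>A\<^esub> a) b = pt a (r \<odot>\<^bsub>B\<^esub> b)"
proof -
  have "frag_of (r \<odot>\<^bsub>A\<^esub> a, b) - frag_of (a, r \<odot>\<^bsub>B\<^esub> b) \<in> relations"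
    unfolding relations_def by (rule UnI2) (rule CollectI, (rule exI)+, rule conjI, rule refl, simp add: assms)
  then have "frag_of (r \<odot>\<^bsub>A\<^esub> a, b) - frag_of (a, r \<odot>\<^bsub>B\<^esub> b) \<in> J"
    by (rule subsetD[OF relations_J])
  then show ?thesis
    unfolding pure_tensor_def using assms by (intro coset_eqI pair_carrier) simp_all
qed

lemma pt_one: "pt \<one>\<^bsub>A\<^esub> \<one>\<^bsub>B\<^esub> = \<one>\<^bsub>PR Quot J\<^esub>"
  unfolding pure_tensor_def using ring_hom_one[OF J.rcos_ring_hom] by simp

lemma inl_ring_hom: "(\<lambda>a. pt a \<one>\<^bsub>B\<^esub>) \<in> ring_hom A (PR Quot J)"
  by (rule ring_hom_memI) (simp_all add: pt_closed pt_mult pt_add_left pt_one)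

lemma inr_ring_hom: "(\<lambda>b. pt \<one>\<^bsub>A\<^esub> b) \<in> ring_hom B (PR Quot J)"
  by (rule ring_hom_memI) (simp_all add: pt_closed pt_mult pt_add_right pt_one)

lemma structure_ring_hom: "(\<lambda>r. r \<odot>\<^bsub>A\<^esub> \<one>\<^bsub>A\<^esub>) \<in> ring_hom R A"
proof (rule ring_hom_memI)
  fix x y assume xy: "x \<in> carrier R" "y \<in> carrier R"
  have "x \<odot>\<^bsub>A\<^esub> \<one>\<^bsub>A\<^esub> \<otimes>\<^bsub>A\<^esub> (y \<odot>\<^bsub>A\<^esub> \<one>\<^bsub>A\<^esub>) = x \<odot>\<^bsub>A\<^esub> (y \<odot>\<^bsub>A\<^esub> \<one>\<^bsub>A\<^esub>)"
    using xy by (subst A.smult_assoc2) auto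
  then show "(x \<otimes>\<^bsub>R\<^esub> y) \<odot>\<^bsub>A\<^esub> \<one>\<^bsub>A\<^esub> = x \<odot>\<^bsub>A\<^esub> \<one>\<^bsub>A\<^esub> \<otimes>\<^bsub>A\<^esub> (y \<odot>\<^bsub>A\<^esub> \<one>\<^bsub>A\<^esub>)"
    using xy by (simp add: A.smult_assoc1)
qed (auto simp: A.smult_l_distr)

lemma algebra_tensor: "algebra R T"
  unfolding tensor_def
  using ring_hom_trans[OF structure_ring_hom inl_ring_hom]
  by (intro algebra_algebra_of A.R_cring Q.is_cring) (simp add: comp_def)

lemma tensor_simps [simp]:
  "carrier T = carrier (PR Quot J)" "monoid.mult T = monoid.mult (PR Quot J)" "one T = one (PR Quot J)"
  "zero T = zero (PR Quot J)" "add T = add (PR Quot J)"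
  "r \<odot>\<^bsub>T\<^esub> Y = pt (r \<odot>\<^bsub>A\<^esub> \<one>\<^bsub>A\<^esub>) \<one>\<^bsub>B\<^esub> \<otimes>\<^bsub>PR Quot J\<^esub> Y"
  by (simp_all add: tensor_def)

lemma ring_hom_tensor_iff: "f \<in> ring_hom D T \<longleftrightarrow> f \<in> ring_hom D (PR Quot J)"
  "g \<in> ring_hom T C \<longleftrightarrow> g \<in> ring_hom (PR Quot J) C"
  by (simp_all add: ring_hom_def)

lemma inl_alg_hom: "(\<lambda>a. pt a \<one>\<^bsub>B\<^esub>) \<in> alg_hom R A T"
proof (rule alg_homI)
  fix r a assume ra: "r \<in> carrier R" "a \<in> carrier A"
  have "r \<odot>\<^bsub>A\<^esub> \<one>\<^bsub>A\<^esub> \<otimes>\<^bsub>A\<^esub> a = r \<odot>\<^bsub>A\<^esub> a" using ra by (subst A.smult_assoc2) auto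
  then show "pt (r \<odot>\<^bsub>A\<^esub> a) \<one>\<^bsub>B\<^esub> = r \<odot>\<^bsub>T\<^esub> pt a \<one>\<^bsub>B\<^esub>" using ra by (simp add: pt_mult)
qed (simp add: ring_hom_tensor_iff inl_ring_hom)

lemma inr_alg_hom: "(\<lambda>b. pt \<one>\<^bsub>A\<^esub> b) \<in> alg_hom R B T"
proof (rule alg_homI)
  fix r b assume rb: "r \<in> carrier R" "b \<in> carrier B"
  then show "pt \<one>\<^bsub>A\<^esub> (r \<odot>\<^bsub>B\<^esub> b) = r \<odot>\<^bsub>T\<^esub> pt \<one>\<^bsub>A\<^esub> b"
    by (simp add: pt_mult pt_balanced[symmetric])
qed (simp add: ring_hom_tensor_iff inr_ring_hom)

lemma tensor_rep:
  assumes "Y \<in> carrier T"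
  shows "(SOME P. P \<in> Y) \<in> Y" "Y \<subseteq> carrier PR" "\<exists>P\<in>carrier PR. Y = J +>\<^bsub>PR\<^esub> P"
proof -
  obtain P where P: "P \<in> carrier PR" "Y = J +>\<^bsub>PR\<^esub> P"
    using assms by (auto simp: FactRing_def A_RCOSETS_def' simp del: pair_ring_simps)
  have "P \<in> Y" using P J.a_rcos_self by simp
  then show "(SOME P. P \<in> Y) \<in> Y" by (rule someI)
  show "Y \<subseteq> carrier PR" using P PR.a_r_coset_subset_G[OF J.a_subset] by blast
  show "\<exists>P\<in>carrier PR. Y = J +>\<^bsub>PR\<^esub> P" using P by blast
qed

text \<open>The universal property: a pair of algebra homomorphisms \<open>f : A \<rightarrow> C\<close> and \<open>g : B \<rightarrow> C\<close> induces a
  homomorphism on the tensor product.\<close>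

context
  fixes C :: "('r, 'c, 'q) module_scheme" and f g
  assumes C: "algebra R C" and f: "f \<in> alg_hom R A C" and g: "g \<in> alg_hom R B C"
begin

interpretation C: Module.algebra R C by (rule C)

abbreviation "fg \<equiv> (\<lambda>p. f (fst p) \<otimes>\<^bsub>C\<^esub> g (snd p))"

lemma fg_closed: "fg \<in> carrier A \<times> carrier B \<rightarrow> carrier C"
  using alg_homD(3)[OF f] alg_homD(3)[OF g] by auto

lemma linear_extension_ring_hom: "linear_extension C fg \<in> ring_hom PR C"
proof (rule ring_hom_memI)
  fix P Q assume PQ: "P \<in> carrier PR" "Q \<in> carrier PR"
  note fr = alg_homD[OF f] and gr = alg_homD[OF g]
  show "linear_extension C fg (P \<otimes>\<^bsub>PR\<^esub> Q) = linear_extension C fg P \<otimes>\<^bsub>C\<^esub> linear_extension C fg Q"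
    unfolding pair_ring_simps
    by (rule C.linear_extension_conv[OF fg_closed])
       (use PQ in \<open>auto simp: ring_hom_mult[OF fr(1)] ring_hom_mult[OF gr(1)] fr(3) gr(3) C.m_ac\<close>)
  show "linear_extension C fg (P \<oplus>\<^bsub>PR\<^esub> Q) = linear_extension C fg P \<oplus>\<^bsub>C\<^esub> linear_extension C fg Q"
    using PQ C.linear_extension_add[OF _ _ fg_closed] by simp
next
  fix P assume "P \<in> carrier PR"
  then show "linear_extension C fg P \<in> carrier C" using C.linear_extension_closed[OF _ fg_closed] by simp
next
  show "linear_extension C fg \<one>\<^bsub>PR\<^esub> = \<one>\<^bsub>C\<^esub>"
    using ring_hom_one[OF alg_homD(1)[OF f]] ring_hom_one[OF alg_homD(1)[OF g]] by simp
qed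

interpretation L: ring_hom_cring PR C "linear_extension C fg"
  using linear_extension_ring_hom by unfold_locales auto

text \<open>The kernel of the map on the monoid ring is an ideal, so it is enough to look at the three
  families of relations.\<close>

lemma linear_extension_J: "P \<in> J \<Longrightarrow> linear_extension C fg P = \<zero>\<^bsub>C\<^esub>"
proof -
  note fr = alg_homD[OF f] and gr = alg_homD[OF g]
  have rh: "ring_hom_ring PR C (linear_extension C fg)"
    by (rule ring_hom_ringI2) (simp_all add: linear_extension_ring_hom PR.ring_axioms C.ring_axioms del: pair_ring_simps)
  let ?K = "a_kernel PR C (linear_extension C fg)"
  have id: "ideal ?K PR" by (rule ring_hom_ring.kernel_is_ideal[OF rh])
  have cl: "Poly_Mapping.keys (frag_of (a, b)) \<subseteq> carrier A \<times> carrier B"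
    if "a \<in> carrier A" "b \<in> carrier B" for a b using that by (simp add: keys_frag_of)
  have of: "linear_extension C fg (frag_of (a, b)) = f a \<otimes>\<^bsub>C\<^esub> g b" if "a \<in> carrier A" "b \<in> carrier B" for a b
    using that fr gr by simp
  have "linear_extension C fg P = \<zero>\<^bsub>C\<^esub>" if "P \<in> relations" for P
    using that unfolding relations_def
  proof (elim UnE CollectE exE conjE)
    fix a a' b assume P: "P = frag_of (a \<oplus>\<^bsub>A\<^esub> a', b) - frag_of (a, b) - frag_of (a', b)"
      and ab: "a \<in> carrier A" "a' \<in> carrier A" "b \<in> carrier B"
    then show ?thesis
      using fr(3) gr(3)
      by (simp add: C.linear_extension_diff[OF keys_diff_subset[OF cl cl] cl fg_closed]
          C.linear_extension_diff[OF cl cl fg_closed] of ring_hom_add[OF fr(1)] C.l_distr C.minus_eq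
          C.a_ac C.r_neg C.r_neg1 C.r_neg2)
  next
    fix a b b' assume P: "P = frag_of (a, b \<oplus>\<^bsub>B\<^esub> b') - frag_of (a, b) - frag_of (a, b')"
      and ab: "a \<in> carrier A" "b \<in> carrier B" "b' \<in> carrier B"
    then show ?thesis
      using fr(3) gr(3)
      by (simp add: C.linear_extension_diff[OF keys_diff_subset[OF cl cl] cl fg_closed]
          C.linear_extension_diff[OF cl cl fg_closed] of ring_hom_add[OF gr(1)] C.r_distr C.minus_eq
          C.a_ac C.r_neg C.r_neg1 C.r_neg2)
  next
    fix r a b assume P: "P = frag_of (r \<odot>\<^bsub>A\<^esub> a, b) - frag_of (a, r \<odot>\<^bsub>B\<^esub> b)"
      and ab: "r \<in> carrier R" "a \<in> carrier A" "b \<in> carrier B"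
    have "f (r \<odot>\<^bsub>A\<^esub> a) \<otimes>\<^bsub>C\<^esub> g b = f a \<otimes>\<^bsub>C\<^esub> g (r \<odot>\<^bsub>B\<^esub> b)"
      using ab fr gr C.smult_assoc2[of r "f a" "g b"] C.smult_assoc2[of r "g b" "f a"]
      by (simp add: C.m_comm[of "f a"])
    then show ?thesis
      using P ab fr(3) gr(3)
      by (simp add: C.linear_extension_diff[OF cl cl fg_closed] of C.minus_eq C.r_neg)
  qed
  then have "relations \<subseteq> ?K"
    unfolding a_kernel_def' using relations_carrier by blast
  then have "J \<subseteq> ?K" unfolding J_eq by (rule PR.genideal_minimal[OF id])
  then show "P \<in> J \<Longrightarrow> linear_extension C fg P = \<zero>\<^bsub>C\<^esub>" unfolding a_kernel_def' by blast
qed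

text \<open>The value is independent of the representative chosen in the definition of \<^const>\<open>tensor_lift\<close>,
  as two representatives differ by an element of the ideal of relations.\<close>

lemma tensor_lift_coset:
  assumes P: "P \<in> carrier PR"
  shows "tensor_lift C f g (J +>\<^bsub>PR\<^esub> P) = linear_extension C fg P"
proof -
  let ?Y = "J +>\<^bsub>PR\<^esub> P"
  have "?Y \<in> carrier T" using ring_hom_closed[OF J.rcos_ring_hom P] by simp
  then have "(SOME P. P \<in> ?Y) \<in> ?Y" by (rule tensor_rep)
  then obtain j where j: "j \<in> J" "(SOME P. P \<in> ?Y) = j \<oplus>\<^bsub>PR\<^esub> P"
    by (auto simp: a_r_coset_def' simp del: pair_ring_simps)
  have jc: "j \<in> carrier PR" using j J.a_subset by blast
  have "tensor_lift C f g ?Y = linear_extension C fg (SOME P. P \<in> ?Y)"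
    by (simp add: tensor_lift_def Let_def linear_extension_def)
  also have "\<dots> = linear_extension C fg j \<oplus>\<^bsub>C\<^esub> linear_extension C fg P"
    unfolding j by (rule L.hom_add[OF jc P])
  also have "\<dots> = linear_extension C fg P"
    using linear_extension_J[OF j(1)] L.hom_closed[OF P] by simp
  finally show ?thesis .
qed

lemma tensor_lift_pt:
  assumes "a \<in> carrier A" "b \<in> carrier B"
  shows "tensor_lift C f g (pt a b) = f a \<otimes>\<^bsub>C\<^esub> g b"
  unfolding pure_tensor_def
  using tensor_lift_coset[OF pair_carrier[OF assms]] assms
  by (simp add: C.linear_extension_of alg_homD(3)[OF f] alg_homD(3)[OF g])

lemma tensor_lift_alg_hom: "tensor_lift C f g \<in> alg_hom R T C"
proof -
  have rh: "tensor_lift C f g \<in> ring_hom (PR Quot J) C"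
  proof (rule ring_hom_memI)
    fix Y Z assume YZ: "Y \<in> carrier (PR Quot J)" "Z \<in> carrier (PR Quot J)"
    obtain P Q where P: "P \<in> carrier PR" "Y = J +>\<^bsub>PR\<^esub> P" and Q: "Q \<in> carrier PR" "Z = J +>\<^bsub>PR\<^esub> Q"
      using tensor_rep(3)[of Y] tensor_rep(3)[of Z] YZ by (auto simp del: pair_ring_simps)
    show "tensor_lift C f g (Y \<otimes>\<^bsub>PR Quot J\<^esub> Z) = tensor_lift C f g Y \<otimes>\<^bsub>C\<^esub> tensor_lift C f g Z"
      unfolding P Q ring_hom_mult[OF J.rcos_ring_hom P(1) Q(1), symmetric]
        tensor_lift_coset[OF P(1)] tensor_lift_coset[OF Q(1)] tensor_lift_coset[OF PR.m_closed[OF P(1) Q(1)]]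
      by (rule L.hom_mult[OF P(1) Q(1)])
    show "tensor_lift C f g (Y \<oplus>\<^bsub>PR Quot J\<^esub> Z) = tensor_lift C f g Y \<oplus>\<^bsub>C\<^esub> tensor_lift C f g Z"
      unfolding P Q ring_hom_add[OF J.rcos_ring_hom P(1) Q(1), symmetric]
        tensor_lift_coset[OF P(1)] tensor_lift_coset[OF Q(1)] tensor_lift_coset[OF PR.a_closed[OF P(1) Q(1)]]
      by (rule L.hom_add[OF P(1) Q(1)])
  next
    fix Y assume Y: "Y \<in> carrier (PR Quot J)"
    obtain P where P: "P \<in> carrier PR" "Y = J +>\<^bsub>PR\<^esub> P"
      using tensor_rep(3)[of Y] Y by (auto simp del: pair_ring_simps)
    show "tensor_lift C f g Y \<in> carrier C"
      unfolding P tensor_lift_coset[OF P(1)] by (rule L.hom_closed[OF P(1)])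
  next
    show "tensor_lift C f g \<one>\<^bsub>PR Quot J\<^esub> = \<one>\<^bsub>C\<^esub>"
      using tensor_lift_coset[OF PR.one_closed] L.hom_one by (simp add: FactRing_def del: pair_ring_simps)
  qed
  show ?thesis
  proof (rule alg_homI)
    fix r Y assume rY: "r \<in> carrier R" "Y \<in> carrier T"
    have "tensor_lift C f g Y \<in> carrier C" using ring_hom_closed[OF rh] rY by simp
    then show "tensor_lift C f g (r \<odot>\<^bsub>T\<^esub> Y) = r \<odot>\<^bsub>C\<^esub> tensor_lift C f g Y"
      using rY alg_homD(2)[OF f, of r "\<one>\<^bsub>A\<^esub>"] ring_hom_one[OF alg_homD(1)[OF f]]
        ring_hom_one[OF alg_homD(1)[OF g]]
      by (simp add: ring_hom_mult[OF rh] pt_closed tensor_lift_pt C.smult_assoc2)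
  qed (simp add: ring_hom_tensor_iff rh)
qed

end

lemma tensor_lift_cong:
  assumes C: "cring C" and f: "f \<in> carrier A \<rightarrow> carrier C" and g: "g \<in> carrier B \<rightarrow> carrier C"
    and eq: "\<And>a. a \<in> carrier A \<Longrightarrow> f' a = f a" "\<And>b. b \<in> carrier B \<Longrightarrow> g' b = g b"
    and Y: "Y \<in> carrier T"
  shows "tensor_lift C f' g' Y = tensor_lift C f g Y"
proof -
  interpret C: cring C by (rule C)
  have "Poly_Mapping.keys (SOME P. P \<in> Y) \<subseteq> carrier A \<times> carrier B"
    using tensor_rep[OF Y] by auto
  then show ?thesis
    unfolding tensor_lift_def Let_def linear_extension_def[symmetric]
    using f g by (intro C.linear_extension_cong) (auto simp: eq Pi_iff subset_iff)
qed

text \<open>Both sides evaluate at the same chosen representative, where the claim is that \<open>\<phi>\<close> preserves sums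
  and products.\<close>

lemma tensor_lift_natural:
  assumes DC: "cring D" "cring C" and \<phi>: "\<phi> \<in> ring_hom D C"
    and f: "f \<in> carrier A \<rightarrow> carrier D" and g: "g \<in> carrier B \<rightarrow> carrier D" and Y: "Y \<in> carrier T"
  shows "\<phi> (tensor_lift D f g Y) = tensor_lift C (\<lambda>a. \<phi> (f a)) (\<lambda>b. \<phi> (g b)) Y"
proof -
  interpret C: cring C by fact
  let ?P = "SOME P. P \<in> Y"
  have k: "Poly_Mapping.keys ?P \<subseteq> carrier A \<times> carrier B"
    using tensor_rep[OF Y] by auto
  have "\<phi> (linear_extension D (\<lambda>p. f (fst p) \<otimes>\<^bsub>D\<^esub> g (snd p)) ?P)
      = linear_extension C (\<phi> \<circ> (\<lambda>p. f (fst p) \<otimes>\<^bsub>D\<^esub> g (snd p))) ?P"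
    using k f g cring.cring_simprules(5)[OF DC(1)]
    by (intro ring_hom_linear_extension[OF DC \<phi>]) (auto simp: Pi_iff subset_iff)
  also have "\<dots> = linear_extension C (\<lambda>p. \<phi> (f (fst p)) \<otimes>\<^bsub>C\<^esub> \<phi> (g (snd p))) ?P"
    using k f g ring_hom_closed[OF \<phi>]
    by (intro C.linear_extension_cong) (auto simp: ring_hom_mult[OF \<phi>] Pi_iff subset_iff)
  finally show ?thesis by (simp add: tensor_lift_def linear_extension_def Let_def)
qed

end

section \<open>Groups of points\<close>

context affine_group_scheme
begin

sublocale GG: tensor_product R G G
  by (rule tensor_product.intro) (rule algebra_axioms)+

sublocale GGG: tensor_product R "tensor R G G" G
  by (rule tensor_product.intro) (rule GG.algebra_tensor algebra_axioms)+

lemma comult_closed: "a \<in> carrier G \<Longrightarrow> comult G a \<in> carrier (tensor R G G)"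
  by (rule alg_homD(3)[OF comult_hom])

lemma point_mult_cong:
  assumes C: "algebra R C" and f: "f \<in> alg_hom R G C" and g: "g \<in> alg_hom R G C"
    and "\<And>a. a \<in> carrier G \<Longrightarrow> f' a = f a" "\<And>a. a \<in> carrier G \<Longrightarrow> g' a = g a"
  shows "point_mult G C f' g' = point_mult G C f g"
  unfolding point_mult_def
  by (intro restrict_ext GG.tensor_lift_cong algebra.M_cring[OF C] comult_closed assms)
     (auto intro: alg_homD(3)[OF f] alg_homD(3)[OF g])

lemma point_mult_natural:
  assumes D: "algebra R D" and C: "algebra R C" and \<phi>: "\<phi> \<in> alg_hom R D C"
    and f: "f \<in> alg_hom R G D" and g: "g \<in> alg_hom R G D" and a: "a \<in> carrier G"
  shows "\<phi> (point_mult G D f g a) = point_mult G C (\<lambda>a. \<phi> (f a)) (\<lambda>a. \<phi> (g a)) a"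
  unfolding point_mult_def
  using a alg_homD(3)[OF f] alg_homD(3)[OF g]
    GG.tensor_lift_natural[OF algebra.M_cring[OF D] algebra.M_cring[OF C] alg_homD(1)[OF \<phi>] _ _ comult_closed]
  by (simp add: Pi_iff)

lemma point_mult_alg_hom:
  assumes C: "algebra R C" and f: "f \<in> alg_hom R G C" and g: "g \<in> alg_hom R G C"
  shows "point_mult G C f g \<in> alg_hom R G C"
  by (rule alg_hom_cong[OF alg_hom_compose[OF comult_hom GG.tensor_lift_alg_hom[OF C f g]] _ algebra_axioms])
     (simp add: point_mult_def)

text \<open>Yoneda: \<open>f\<close>, \<open>g\<close> and \<open>h\<close> are the images of the three universal points \<open>p1\<close>, \<open>p2\<close> and \<open>p3\<close> under
  the homomorphism \<open>\<phi>\<close> from the threefold tensor product with \<open>a \<otimes> b \<otimes> c \<mapsto> f a \<cdot> g b \<cdot> h c\<close>.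
  Coassociativity is associativity for the universal points, and \<open>\<phi>\<close> transports it to \<open>C\<close>.\<close>

lemma point_mult_assoc:
  assumes C: "algebra R C" and f: "f \<in> alg_hom R G C" and g: "g \<in> alg_hom R G C" and h: "h \<in> alg_hom R G C"
  shows "point_mult G C (point_mult G C f g) h = point_mult G C f (point_mult G C g h)"
proof
  fix a
  interpret C: Module.algebra R C by (rule C)
  let ?T2 = "tensor R G G" let ?T = "tensor R ?T2 G"
  let ?pt = "pure_tensor R ?T2 G" and ?pt2 = "pure_tensor R G G"
  define p1 where "p1 = (\<lambda>a. ?pt (?pt2 a \<one>\<^bsub>G\<^esub>) \<one>\<^bsub>G\<^esub>)"
  define p2 where "p2 = (\<lambda>a. ?pt (?pt2 \<one>\<^bsub>G\<^esub> a) \<one>\<^bsub>G\<^esub>)"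
  define p3 where "p3 = (\<lambda>a. ?pt (?pt2 \<one>\<^bsub>G\<^esub> \<one>\<^bsub>G\<^esub>) a)"
  have T: "algebra R ?T" by (rule GGG.algebra_tensor)
  have p1: "p1 \<in> alg_hom R G ?T" unfolding p1_def
    by (rule alg_hom_compose[OF GG.inl_alg_hom GGG.inl_alg_hom])
  have p2: "p2 \<in> alg_hom R G ?T" unfolding p2_def
    by (rule alg_hom_compose[OF GG.inr_alg_hom GGG.inl_alg_hom])
  have p3: "p3 \<in> alg_hom R G ?T"
    using GGG.inr_alg_hom unfolding p3_def GG.pt_one GG.tensor_simps(3) .
  have ca: "point_mult G ?T (point_mult G ?T p1 p2) p3 = point_mult G ?T p1 (point_mult G ?T p2 p3)"
    using coassoc unfolding Let_def p1_def p2_def p3_def .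
  define \<psi> where "\<psi> = tensor_lift C f g"
  define \<phi> where "\<phi> = tensor_lift C \<psi> h"
  have \<psi>: "\<psi> \<in> alg_hom R ?T2 C" unfolding \<psi>_def by (rule GG.tensor_lift_alg_hom[OF C f g])
  have \<phi>: "\<phi> \<in> alg_hom R ?T C" unfolding \<phi>_def by (rule GGG.tensor_lift_alg_hom[OF C \<psi> h])
  have one: "f \<one>\<^bsub>G\<^esub> = \<one>\<^bsub>C\<^esub>" "g \<one>\<^bsub>G\<^esub> = \<one>\<^bsub>C\<^esub>" "h \<one>\<^bsub>G\<^esub> = \<one>\<^bsub>C\<^esub>"
    using ring_hom_one[OF alg_homD(1)] f g h by blast+
  have cl: "f x \<in> carrier C" "g x \<in> carrier C" "h x \<in> carrier C" if "x \<in> carrier G" for x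
    using that alg_homD(3) f g h by metis+
  have \<psi>pt: "\<psi> (?pt2 x y) = f x \<otimes>\<^bsub>C\<^esub> g y" if "x \<in> carrier G" "y \<in> carrier G" for x y
    unfolding \<psi>_def by (rule GG.tensor_lift_pt[OF C f g that])
  have \<phi>pt: "\<phi> (?pt x y) = \<psi> x \<otimes>\<^bsub>C\<^esub> h y" if "x \<in> carrier ?T2" "y \<in> carrier G" for x y
    unfolding \<phi>_def by (rule GGG.tensor_lift_pt[OF C \<psi> h that])
  have e1: "\<phi> (p1 x) = f x" and e2: "\<phi> (p2 x) = g x" and e3: "\<phi> (p3 x) = h x" if "x \<in> carrier G" for x
    using that by (simp_all add: p1_def p2_def p3_def \<phi>pt \<psi>pt GG.pt_closed one cl)
  have m12: "\<phi> (point_mult G ?T p1 p2 x) = point_mult G C f g x" if "x \<in> carrier G" for x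
    using point_mult_natural[OF T C \<phi> p1 p2 that] point_mult_cong[OF C f g e1 e2] by simp
  have m23: "\<phi> (point_mult G ?T p2 p3 x) = point_mult G C g h x" if "x \<in> carrier G" for x
    using point_mult_natural[OF T C \<phi> p2 p3 that] point_mult_cong[OF C g h e2 e3] by simp
  show "point_mult G C (point_mult G C f g) h a = point_mult G C f (point_mult G C g h) a"
  proof (cases "a \<in> carrier G")
    case True
    have "point_mult G C (point_mult G C f g) h a = \<phi> (point_mult G ?T (point_mult G ?T p1 p2) p3 a)"
      using point_mult_natural[OF T C \<phi> point_mult_alg_hom[OF T p1 p2] p3 True]
        point_mult_cong[OF C point_mult_alg_hom[OF C f g] h m12 e3] by simp
    also have "\<dots> = point_mult G C f (point_mult G C g h) a"
      unfolding ca
      using point_mult_natural[OF T C \<phi> p1 point_mult_alg_hom[OF T p2 p3] True]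
        point_mult_cong[OF C f point_mult_alg_hom[OF C g h] e1 m23] by simp
    finally show ?thesis .
  qed (simp add: point_mult_def)
qed

lemma point_one_alg_hom:
  assumes C: "algebra R C"
  shows "point_one G C \<in> alg_hom R G C"
proof -
  interpret C: Module.algebra R C by (rule C)
  interpret CC: tensor_product R C C by (rule tensor_product.intro) (rule C)+
  have "(\<lambda>r. r \<odot>\<^bsub>C\<^esub> \<one>\<^bsub>C\<^esub>) \<in> alg_hom R (algebra_of R (\<lambda>r. r)) C"
  proof (rule alg_homI)
    show "(\<lambda>r. r \<odot>\<^bsub>C\<^esub> \<one>\<^bsub>C\<^esub>) \<in> ring_hom (algebra_of R (\<lambda>r. r)) C"
      using CC.structure_ring_hom by (simp add: ring_hom_def)
  qed (simp add: C.smult_assoc1)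
  from alg_hom_compose[OF counit_hom this] show ?thesis
    by (rule alg_hom_cong[OF _ _ algebra_axioms]) (simp add: point_one_def)
qed

lemma alg_hom_point_one:
  assumes C: "algebra R C" and f: "f \<in> alg_hom R G C" and a: "a \<in> carrier G"
  shows "f (point_one G G a) = point_one G C a"
  using a alg_homD(2)[OF f _ one_closed] ring_hom_one[OF alg_homD(1)[OF f]] alg_homD(3)[OF counit_hom]
  by (simp add: point_one_def)

lemma id_alg_hom: "(\<lambda>x. x) \<in> alg_hom R G G"
  by (simp add: alg_hom_def ring_hom_def)

text \<open>As for associativity, but the universal point is now the identity of the coordinate ring, and \<open>f\<close>
  itself transports the counit axiom to \<open>C\<close>.\<close>

lemma point_mult_one:
  assumes C: "algebra R C" and f: "f \<in> alg_hom R G C" and ext: "f \<in> extensional (carrier G)"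
  shows "point_mult G C (point_one G C) f = f"
proof (rule extensionalityI[OF _ ext])
  fix a assume a: "a \<in> carrier G"
  have "f (point_mult G G (point_one G G) (\<lambda>x. x) a) = point_mult G C (\<lambda>a. f (point_one G G a)) f a"
    by (rule point_mult_natural[OF algebra_axioms C f point_one_alg_hom[OF algebra_axioms] id_alg_hom a])
  also have "\<dots> = point_mult G C (point_one G C) f a"
    using point_mult_cong[OF C point_one_alg_hom[OF C] f alg_hom_point_one[OF C f]] by simp
  finally show "point_mult G C (point_one G C) f a = f a" using counit_l[OF a] by simp
qed (simp add: point_mult_def)

lemma point_mult_antipode:
  assumes C: "algebra R C" and f: "f \<in> alg_hom R G C"
  shows "point_mult G C (\<lambda>a. f (antipode G a)) f = point_one G C"
proof (rule extensionalityI)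
  fix a assume a: "a \<in> carrier G"
  have "f (point_mult G G (antipode G) (\<lambda>x. x) a) = point_mult G C (\<lambda>a. f (antipode G a)) f a"
    by (rule point_mult_natural[OF algebra_axioms C f antipode_hom id_alg_hom a])
  then show "point_mult G C (\<lambda>a. f (antipode G a)) f a = point_one G C a"
    using alg_hom_point_one[OF C f a] by (simp add: antipode_l)
qed (simp_all add: point_mult_def point_one_def)

lemma group_points:
  assumes C: "algebra R C"
  shows "group (points R G C)"
proof (rule groupI)
  fix f assume "f \<in> carrier (points R G C)"
  then have f: "f \<in> alg_hom R G C" by (simp add: points_def)
  let ?g = "restrict (\<lambda>a. f (antipode G a)) (carrier G)"
  have af: "(\<lambda>a. f (antipode G a)) \<in> alg_hom R G C" by (rule alg_hom_compose[OF antipode_hom f])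
  have "?g \<in> alg_hom R G C" by (rule alg_hom_cong[OF af _ algebra_axioms]) simp
  moreover have "point_mult G C ?g f = point_one G C"
    using point_mult_cong[OF C af f, of ?g f] point_mult_antipode[OF C f] by simp
  ultimately show "\<exists>y\<in>carrier (points R G C). y \<otimes>\<^bsub>points R G C\<^esub> f = \<one>\<^bsub>points R G C\<^esub>"
    by (intro bexI[of _ ?g]) (simp_all add: points_def)
qed (use point_mult_alg_hom[OF C] point_one_alg_hom[OF C] point_mult_one[OF C] point_mult_assoc[OF C] in
      \<open>auto simp: points_def point_mult_def point_one_def\<close>)

text \<open>A point is determined by its values on finitely many algebra generators.\<close>

lemma finite_points:
  assumes C: "algebra R C" and fin: "finite (carrier C)" and ft: "finite_type R G"
  shows "finite (carrier (points R G C))"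
proof -
  interpret C: Module.algebra R C by (rule C)
  obtain S where S: "finite S" "S \<subseteq> carrier G"
    "generate_ring G (S \<union> (\<lambda>r. r \<odot>\<^bsub>G\<^esub> \<one>\<^bsub>G\<^esub>) ` carrier R) = carrier G"
    using ft unfolding finite_type_def by blast
  have "inj_on (\<lambda>f. restrict f S) (alg_hom R G C \<inter> extensional (carrier G))"
  proof (rule inj_onI)
    fix f g assume f: "f \<in> alg_hom R G C \<inter> extensional (carrier G)"
      and g: "g \<in> alg_hom R G C \<inter> extensional (carrier G)" and eq: "restrict f S = restrict g S"
    interpret f: ring_hom_cring G C f using alg_homD(1) f by unfold_locales blast
    interpret g: ring_hom_cring G C g using alg_homD(1) g by unfold_locales blast
    have "x \<in> carrier G \<and> f x = g x" if "x \<in> generate_ring G (S \<union> (\<lambda>r. r \<odot>\<^bsub>G\<^esub> \<one>\<^bsub>G\<^esub>) ` carrier R)" for x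
      using that
    proof (induction rule: generate_ring.induct)
      case (incl h)
      then show ?case
      proof
        assume "h \<in> S"
        then show ?thesis using S(2) fun_cong[OF eq, of h] by auto
      next
        assume "h \<in> (\<lambda>r. r \<odot>\<^bsub>G\<^esub> \<one>\<^bsub>G\<^esub>) ` carrier R"
        then show ?thesis
          using alg_homD(2)[of f R G C] alg_homD(2)[of g R G C] f g by auto
      qed
    qed auto
    then show "f = g" using f g unfolding S(3) by (auto intro!: extensionalityI[of f "carrier G"])
  qed
  moreover have "(\<lambda>f. restrict f S) ` (alg_hom R G C \<inter> extensional (carrier G)) \<subseteq> S \<rightarrow>\<^sub>E carrier C"
  proof (rule image_subsetI)
    fix f assume "f \<in> alg_hom R G C \<inter> extensional (carrier G)"
    then have "f \<in> alg_hom R G C" by blast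
    then show "restrict f S \<in> S \<rightarrow>\<^sub>E carrier C"
      using alg_homD(3)[of f R G C] S(2) by (simp add: PiE_iff subset_iff)
  qed
  moreover have "finite (S \<rightarrow>\<^sub>E carrier C)" by (intro finite_PiE S(1) fin)
  ultimately have "finite (alg_hom R G C \<inter> extensional (carrier G))" by (rule inj_on_finite)
  then show ?thesis by (simp add: points_def)
qed

lemma algebra_quotient:
  assumes "ideal I R"
  shows "algebra R (algebra_of (R Quot I) (\<lambda>r. I +>\<^bsub>R\<^esub> r))"
  by (intro algebra_algebra_of R_cring ideal.quotient_is_cring[OF assms] ideal.rcos_ring_hom[OF assms])

lemma group_quotient_points: "ideal I R \<Longrightarrow> group (quotient_points R G I)"
  unfolding quotient_points_def by (intro group_points algebra_quotient)

lemma finite_quotient_points: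
  assumes "ideal I R" "finite (carrier (R Quot I))" "finite_type R G"
  shows "finite (carrier (quotient_points R G I))"
  unfolding quotient_points_def
  by (rule finite_points[OF algebra_quotient[OF assms(1)] _ assms(3)]) (simp add: assms(2))

end

section \<open>Linear algebra\<close>

text \<open>Gaussian elimination: an equation with a nonzero coefficient at \<open>b0\<close> eliminates one equation and one
  unknown.\<close>

lemma underdetermined_system:
  fixes M :: "'a \<Rightarrow> 'b \<Rightarrow> 'f::field"
  assumes "finite A" "finite B" "card A < card B"
  shows "\<exists>x. (\<exists>b\<in>B. x b \<noteq> 0) \<and> (\<forall>a\<in>A. (\<Sum>b\<in>B. M a b * x b) = 0)"
  using assms
proof (induction A arbitrary: B M rule: finite_induct)
  case empty
  then obtain b where "b \<in> B" by fastforce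
  then show ?case by (intro exI[of _ "\<lambda>_. 1"]) auto
next
  case (insert a A)
  show ?case
  proof (cases "\<forall>b\<in>B. M a b = 0")
    case True
    have "card A < card B" using insert by simp
    from insert.IH[OF insert.prems(1) this, of M] True show ?thesis by auto
  next
    case False
    then obtain b0 where b0: "b0 \<in> B" "M a b0 \<noteq> 0" by blast
    let ?B = "B - {b0}" and ?M = "\<lambda>a' b. M a' b - M a' b0 * M a b / M a b0"
    have "card A < card ?B" using insert b0 by simp
    from insert.IH[OF _ this, of ?M] insert.prems obtain x where
      x: "\<exists>b\<in>?B. x b \<noteq> 0" "\<And>a'. a' \<in> A \<Longrightarrow> (\<Sum>b\<in>?B. ?M a' b * x b) = 0" by auto
    define s where "s = (\<Sum>b\<in>?B. M a b * x b)"
    define y where "y = x(b0 := - s / M a b0)"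
    have split: "(\<Sum>b\<in>B. M a' b * y b) = M a' b0 * (- s / M a b0) + (\<Sum>b\<in>?B. M a' b * x b)" for a'
      using b0 insert.prems(1) by (subst sum.remove[of _ b0]) (auto simp: y_def intro!: sum.cong)
    have "(\<Sum>b\<in>B. M a' b * y b) = 0" if "a' \<in> A" for a'
    proof -
      have "0 = (\<Sum>b\<in>?B. M a' b * x b - M a' b0 / M a b0 * (M a b * x b))"
        using x(2)[OF that] by (simp add: algebra_simps)
      also have "\<dots> = (\<Sum>b\<in>?B. M a' b * x b) - M a' b0 / M a b0 * s"
        by (simp add: sum_subtractf sum_distrib_left s_def)
      finally show ?thesis unfolding split by simp
    qed
    moreover have "(\<Sum>b\<in>B. M a b * y b) = 0" unfolding split using b0 by (simp add: s_def)
    moreover have "\<exists>b\<in>B. y b \<noteq> 0" using x(1) by (auto simp: y_def)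
    ultimately show ?thesis by auto
  qed
qed

lemma mult_mat_vec_index:
  assumes "A \<in> carrier_mat n m" "v \<in> carrier_vec m" "i < n"
  shows "vec_index (A *\<^sub>v v) i = (\<Sum>j<m. A $$ (i, j) * vec_index v j)"
  using assms by (auto simp: scalar_prod_def atLeast0LessThan)

lemma mult_mat_index:
  assumes "A \<in> carrier_mat n m" "B \<in> carrier_mat m l" "i < n" "j < l"
  shows "(A * B) $$ (i, j) = (\<Sum>k<m. A $$ (i, k) * B $$ (k, j))"
  using assms by (auto simp: scalar_prod_def atLeast0LessThan)

text \<open>Equivalently, the columns of \<open>C\<close> are linearly independent.\<close>

definition inj_mat :: "nat \<Rightarrow> nat \<Rightarrow> complex mat \<Rightarrow> bool" where
  "inj_mat n d C \<longleftrightarrow> C \<in> carrier_mat n d \<and> (\<forall>v\<in>carrier_vec d. C *\<^sub>v v = 0\<^sub>v n \<longrightarrow> v = 0\<^sub>v d)"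

lemma inj_mat_le:
  assumes C: "inj_mat n d C"
  shows "d \<le> n"
proof (rule ccontr)
  assume "\<not> d \<le> n"
  then have "card {..<n} < card {..<d}" by simp
  from underdetermined_system[OF _ _ this, of "\<lambda>i j. C $$ (i, j)"] obtain x where
    x: "\<exists>j<d. x j \<noteq> 0" "\<And>i. i < n \<Longrightarrow> (\<Sum>j<d. C $$ (i, j) * x j) = 0" by auto
  have Cc: "C \<in> carrier_mat n d" using C by (simp add: inj_mat_def)
  have "C *\<^sub>v vec d x = 0\<^sub>v n"
  proof (rule eq_vecI)
    fix i assume "i < dim_vec (0\<^sub>v n :: complex vec)"
    then show "vec_index (C *\<^sub>v vec d x) i = vec_index (0\<^sub>v n) i"
      using mult_mat_vec_index[OF Cc, of "vec d x" i] x(2) by simp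
  qed (use Cc in auto)
  then have "vec d x = 0\<^sub>v d" using C by (simp add: inj_mat_def)
  with x(1) show False by (metis index_vec index_zero_vec(1))
qed

lemma inj_mat_mult:
  assumes C: "inj_mat n d C" and D: "inj_mat d e D"
  shows "inj_mat n e (C * D)"
proof -
  have c: "C \<in> carrier_mat n d" "D \<in> carrier_mat d e" using C D by (auto simp: inj_mat_def)
  have "v = 0\<^sub>v e" if v: "v \<in> carrier_vec e" "(C * D) *\<^sub>v v = 0\<^sub>v n" for v
  proof -
    have "C *\<^sub>v (D *\<^sub>v v) = 0\<^sub>v n" using v c by simp
    then have "D *\<^sub>v v = 0\<^sub>v d" using C v c unfolding inj_mat_def by (meson mult_mat_vec_carrier)
    then show ?thesis using D v unfolding inj_mat_def by blast
  qed
  then show ?thesis using c by (auto simp: inj_mat_def)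
qed

lemma inj_mat_cancel:
  assumes C: "inj_mat n d C" and XY: "X \<in> carrier_mat d e" "Y \<in> carrier_mat d e" and eq: "C * X = C * Y"
  shows "X = Y"
proof (rule mat_col_eqI)
  fix j assume "j < dim_col Y"
  then have j: "j < e" using XY by simp
  have c: "C \<in> carrier_mat n d" using C by (simp add: inj_mat_def)
  have cols: "col X j \<in> carrier_vec d" "col Y j \<in> carrier_vec d" using XY j by auto
  have "C *\<^sub>v col X j = C *\<^sub>v col Y j"
    using eq col_mult2[OF c XY(1) j] col_mult2[OF c XY(2) j] by simp
  then have "C *\<^sub>v (col X j - col Y j) = 0\<^sub>v n"
    using c cols by (simp add: mult_minus_distrib_mat_vec)
  then have z: "col X j - col Y j = 0\<^sub>v d" using C cols by (simp add: inj_mat_def)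
  show "col X j = col Y j"
  proof (rule eq_vecI)
    fix i assume i: "i < dim_vec (col Y j)"
    then have "i < d" using XY by simp
    then have "vec_index (col X j - col Y j) i = 0" using z by simp
    then show "vec_index (col X j) i = vec_index (col Y j) i" using i by simp
  qed (use XY in simp)
qed (use XY in auto)

lemma inj_mat_square_inverse:
  assumes C: "inj_mat n n C"
  obtains B where "B \<in> carrier_mat n n" "C * B = 1\<^sub>m n" "B * C = 1\<^sub>m n"
proof -
  have c: "C \<in> carrier_mat n n" using C by (simp add: inj_mat_def)
  have "det C \<noteq> 0"
    unfolding det_0_iff_vec_prod_zero_field[OF c] using C by (auto simp: inj_mat_def)
  from det_non_zero_imp_unit[OF c this, of undefined] that show ?thesis
    by (auto simp: Units_def ring_mat_def)
qed

lemma invertible_mat_iff: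
  assumes "A \<in> carrier_mat n n"
  shows "invertible_mat A \<longleftrightarrow> (\<exists>B\<in>carrier_mat n n. A * B = 1\<^sub>m n \<and> B * A = 1\<^sub>m n)"
proof
  assume "invertible_mat A"
  then obtain B where B: "A * B = 1\<^sub>m n" "B * A = 1\<^sub>m (dim_row B)"
    using assms unfolding invertible_mat_def inverts_mat_def by auto
  have "dim_col B = n" using arg_cong[OF B(1), of dim_col] by simp
  moreover have "dim_row B = n" using arg_cong[OF B(2), of dim_col] assms by simp
  ultimately show "\<exists>B\<in>carrier_mat n n. A * B = 1\<^sub>m n \<and> B * A = 1\<^sub>m n"
    using B by (intro bexI[of _ B]) auto
next
  assume "\<exists>B\<in>carrier_mat n n. A * B = 1\<^sub>m n \<and> B * A = 1\<^sub>m n"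
  then show "invertible_mat A"
    using assms unfolding invertible_mat_def inverts_mat_def square_mat.simps by auto
qed

lemma vec_subspaceD:
  assumes "vec_subspace n W"
  shows "W \<subseteq> carrier_vec n" "0\<^sub>v n \<in> W" "\<And>v w. v \<in> W \<Longrightarrow> w \<in> W \<Longrightarrow> v + w \<in> W"
    "\<And>c v. v \<in> W \<Longrightarrow> c \<cdot>\<^sub>v v \<in> W"
  using assms by (auto simp: vec_subspace_def)

lemma vec_subspace_image:
  assumes C: "C \<in> carrier_mat n d"
  shows "vec_subspace n ((*\<^sub>v) C ` carrier_vec d)"
  unfolding vec_subspace_def
proof (intro conjI ballI allI)
  show "0\<^sub>v n \<in> (*\<^sub>v) C ` carrier_vec d"
  proof
    show "0\<^sub>v n = C *\<^sub>v 0\<^sub>v d"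
      using C by (intro eq_vecI) (auto simp: mult_mat_vec_index[OF C] simp del: index_mult_mat_vec)
  qed simp
next
  fix v w assume "v \<in> (*\<^sub>v) C ` carrier_vec d" "w \<in> (*\<^sub>v) C ` carrier_vec d"
  then obtain a b where "a \<in> carrier_vec d" "v = C *\<^sub>v a" "b \<in> carrier_vec d" "w = C *\<^sub>v b" by auto
  then show "v + w \<in> (*\<^sub>v) C ` carrier_vec d"
    using mult_add_distrib_mat_vec[OF C, of a b] by (intro image_eqI[of _ _ "a + b"]) auto
next
  fix c v assume "v \<in> (*\<^sub>v) C ` carrier_vec d"
  then obtain a where "a \<in> carrier_vec d" "v = C *\<^sub>v a" by auto
  then show "c \<cdot>\<^sub>v v \<in> (*\<^sub>v) C ` carrier_vec d"
    using mult_mat_vec[OF C, of a c] by (intro image_eqI[of _ _ "c \<cdot>\<^sub>v a"]) auto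
qed (use C in auto)

definition append_col :: "nat \<Rightarrow> nat \<Rightarrow> complex mat \<Rightarrow> complex vec \<Rightarrow> complex mat" where
  "append_col n d C u = mat n (Suc d) (\<lambda>(i, j). if j < d then C $$ (i, j) else vec_index u i)"

lemma append_col_mult:
  assumes C: "C \<in> carrier_mat n d" and u: "u \<in> carrier_vec n" and v: "v \<in> carrier_vec (Suc d)"
  shows "append_col n d C u *\<^sub>v v = C *\<^sub>v vec d (vec_index v) + vec_index v d \<cdot>\<^sub>v u"
proof (rule eq_vecI)
  have A: "append_col n d C u \<in> carrier_mat n (Suc d)" by (simp add: append_col_def)
  fix i assume "i < dim_vec (C *\<^sub>v vec d (vec_index v) + vec_index v d \<cdot>\<^sub>v u)"
  then have i: "i < n" using u by simp
  have w: "vec d (vec_index v) \<in> carrier_vec d" by simp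
  have "vec_index (append_col n d C u *\<^sub>v v) i
      = (\<Sum>j<d. C $$ (i, j) * vec_index v j) + vec_index u i * vec_index v d"
    unfolding mult_mat_vec_index[OF A v i] using i by (simp add: append_col_def)
  also have "(\<Sum>j<d. C $$ (i, j) * vec_index v j) = vec_index (C *\<^sub>v vec d (vec_index v)) i"
    unfolding mult_mat_vec_index[OF C w i] by simp
  finally show "vec_index (append_col n d C u *\<^sub>v v) i
      = vec_index (C *\<^sub>v vec d (vec_index v) + vec_index v d \<cdot>\<^sub>v u) i"
    using i u C by (simp del: index_mult_mat_vec)
qed (use C u in \<open>simp add: append_col_def\<close>)

text \<open>The columns of \<open>C\<close> are a basis of \<open>W\<close>.  They form a linearly independent family of vectors in \<open>W\<close> of
  largest possible size; a vector of \<open>W\<close> outside their span could be appended as a further column.\<close>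

lemma subspace_basis:
  assumes W: "vec_subspace n W"
  obtains d C where "inj_mat n d C" "(*\<^sub>v) C ` carrier_vec d = W"
proof -
  define X where "X d \<longleftrightarrow> (\<exists>C. inj_mat n d C \<and> (*\<^sub>v) C ` carrier_vec d \<subseteq> W)" for d
  have "0\<^sub>m n 0 *\<^sub>v v = 0\<^sub>v n" if "v \<in> carrier_vec 0" for v :: "complex vec"
    using that by (intro eq_vecI) (auto simp: scalar_prod_def)
  then have "inj_mat n 0 (0\<^sub>m n 0) \<and> (*\<^sub>v) (0\<^sub>m n 0) ` carrier_vec 0 \<subseteq> W"
    using vec_subspaceD(2)[OF W] by (auto simp: inj_mat_def)
  then have "X 0" unfolding X_def by blast
  moreover have "d \<le> n" if "X d" for d using that inj_mat_le by (auto simp: X_def)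
  ultimately obtain d where "X d" and mx: "\<And>e. X e \<Longrightarrow> e \<le> d"
    using ex_has_greatest_nat[of X 0 "\<lambda>d. d" "Suc n"] le_imp_less_Suc by metis
  then obtain C where C: "inj_mat n d C" and CW: "(*\<^sub>v) C ` carrier_vec d \<subseteq> W"
    unfolding X_def by blast
  have c: "C \<in> carrier_mat n d" using C by (simp add: inj_mat_def)
  have "u \<in> (*\<^sub>v) C ` carrier_vec d" if u: "u \<in> W" for u
  proof (rule ccontr)
    assume nu: "u \<notin> (*\<^sub>v) C ` carrier_vec d"
    have uc: "u \<in> carrier_vec n" using u vec_subspaceD(1)[OF W] by blast
    let ?C = "append_col n d C u"
    have "v = 0\<^sub>v (Suc d)" if v: "v \<in> carrier_vec (Suc d)" "?C *\<^sub>v v = 0\<^sub>v n" for v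
    proof -
      let ?w = "vec d (vec_index v)" and ?t = "vec_index v d"
      have w: "?w \<in> carrier_vec d" by simp
      have eq: "C *\<^sub>v ?w + ?t \<cdot>\<^sub>v u = 0\<^sub>v n" using v(2) append_col_mult[OF c uc v(1)] by simp
      have "?t = 0"
      proof (rule ccontr)
        assume t: "?t \<noteq> 0"
        have "u = C *\<^sub>v ((- 1 / ?t) \<cdot>\<^sub>v ?w)"
        proof (rule eq_vecI)
          fix i assume "i < dim_vec (C *\<^sub>v ((- 1 / ?t) \<cdot>\<^sub>v ?w))"
          then have i: "i < n" using c by simp
          have "vec_index (C *\<^sub>v ?w) i + ?t * vec_index u i = 0"
            using arg_cong[OF eq, of "\<lambda>x. vec_index x i"] i c uc by (simp del: index_mult_mat_vec)
          then show "vec_index u i = vec_index (C *\<^sub>v ((- 1 / ?t) \<cdot>\<^sub>v ?w)) i"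
            using t i c unfolding mult_mat_vec[OF c w]
            by (simp del: index_mult_mat_vec add: field_simps eq_neg_iff_add_eq_0)
        qed (use c uc in simp)
        with nu show False by auto
      qed
      then have "C *\<^sub>v ?w = 0\<^sub>v n"
      proof -
        have "0 \<cdot>\<^sub>v u = 0\<^sub>v n" using uc by (intro eq_vecI) auto
        then show ?thesis using eq c \<open>?t = 0\<close> by (simp del: index_mult_mat_vec)
      qed
      then have z: "?w = 0\<^sub>v d" using C by (simp add: inj_mat_def)
      show ?thesis
      proof (rule eq_vecI)
        fix i assume "i < dim_vec (0\<^sub>v (Suc d) :: complex vec)"
        then consider "i < d" | "i = d" by fastforce
        then show "vec_index v i = vec_index (0\<^sub>v (Suc d)) i"
          using arg_cong[OF z, of "\<lambda>x. vec_index x i"] \<open>?t = 0\<close> by cases auto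
      qed (use v in auto)
    qed
    then have "inj_mat n (Suc d) ?C" by (auto simp: inj_mat_def append_col_def)
    moreover have "?C *\<^sub>v v \<in> W" if "v \<in> carrier_vec (Suc d)" for v
      unfolding append_col_mult[OF c uc that]
      using CW u vec_subspaceD(3,4)[OF W] by (meson image_subset_iff vec_carrier)
    ultimately have "X (Suc d)" unfolding X_def by blast
    then show False using mx by fastforce
  qed
  with C CW that show ?thesis by blast
qed

text \<open>The matrix \<open>S\<close> expresses the restriction of \<open>A\<close> to an invariant subspace in the basis given by the
  columns of \<open>C\<close>.\<close>

lemma restricted_matrix:
  assumes C: "inj_mat n d C" and A: "A \<in> carrier_mat n n"
    and inv: "\<And>w. w \<in> (*\<^sub>v) C ` carrier_vec d \<Longrightarrow> A *\<^sub>v w \<in> (*\<^sub>v) C ` carrier_vec d"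
  shows "\<exists>S\<in>carrier_mat d d. A * C = C * S"
proof -
  have c: "C \<in> carrier_mat n d" using C by (simp add: inj_mat_def)
  have "\<exists>s\<in>carrier_vec d. A *\<^sub>v col C j = C *\<^sub>v s" if "j < d" for j
  proof -
    have "C * 1\<^sub>m d = C" using c by simp
    then have "col C j = C *\<^sub>v unit_vec d j"
      using col_mult2[OF c one_carrier_mat that] that by simp
    then have "col C j \<in> (*\<^sub>v) C ` carrier_vec d" by auto
    from inv[OF this] show ?thesis by auto
  qed
  then obtain s where s: "\<And>j. j < d \<Longrightarrow> s j \<in> carrier_vec d" "\<And>j. j < d \<Longrightarrow> A *\<^sub>v col C j = C *\<^sub>v s j"
    by metis
  let ?S = "mat d d (\<lambda>(i, j). vec_index (s j) i)"
  have S: "?S \<in> carrier_mat d d" by simp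
  have "A * C = C * ?S"
  proof (rule mat_col_eqI)
    fix j assume "j < dim_col (C * ?S)"
    then have j: "j < d" by simp
    have "col ?S j = s j" using j s(1)[OF j] by (intro eq_vecI) auto
    then show "col (A * C) j = col (C * ?S) j"
      using col_mult2[OF A c j] col_mult2[OF c S j] s(2)[OF j] by simp
  qed (use A c in auto)
  then show ?thesis using S by blast
qed

subsection \<open>Sums of matrices\<close>

definition entrywise_sum :: "nat \<Rightarrow> nat \<Rightarrow> ('a \<Rightarrow> complex mat) \<Rightarrow> 'a set \<Rightarrow> complex mat" where
  "entrywise_sum n m F A = mat n m (\<lambda>(i, j). \<Sum>a\<in>A. F a $$ (i, j))"

lemma entrywise_sum_carrier [simp]: "entrywise_sum n m F A \<in> carrier_mat n m"
  by (simp add: entrywise_sum_def)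

lemma entrywise_sum_index: "i < n \<Longrightarrow> j < m \<Longrightarrow> entrywise_sum n m F A $$ (i, j) = (\<Sum>a\<in>A. F a $$ (i, j))"
  by (simp add: entrywise_sum_def)

lemma entrywise_sum_cong: "(\<And>a. a \<in> A \<Longrightarrow> F a = F' a) \<Longrightarrow> entrywise_sum n m F A = entrywise_sum n m F' A"
  by (simp add: entrywise_sum_def)

lemma mult_entrywise_sum:
  assumes B: "B \<in> carrier_mat k n" and F: "\<And>a. a \<in> A \<Longrightarrow> F a \<in> carrier_mat n m"
  shows "B * entrywise_sum n m F A = entrywise_sum k m (\<lambda>a. B * F a) A"
proof (rule eq_matI)
  fix i j assume "i < dim_row (entrywise_sum k m (\<lambda>a. B * F a) A)" "j < dim_col (entrywise_sum k m (\<lambda>a. B * F a) A)"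
  then have ij: "i < k" "j < m" by (simp_all add: entrywise_sum_def)
  have "(B * entrywise_sum n m F A) $$ (i, j) = (\<Sum>l<n. \<Sum>a\<in>A. B $$ (i, l) * F a $$ (l, j))"
    using mult_mat_index[OF B entrywise_sum_carrier ij] ij by (simp add: entrywise_sum_index sum_distrib_left)
  also have "\<dots> = (\<Sum>a\<in>A. \<Sum>l<n. B $$ (i, l) * F a $$ (l, j))" by (rule sum.swap)
  also have "\<dots> = (\<Sum>a\<in>A. (B * F a) $$ (i, j))"
    by (intro sum.cong refl mult_mat_index[OF B F ij, symmetric])
  finally show "(B * entrywise_sum n m F A) $$ (i, j) = entrywise_sum k m (\<lambda>a. B * F a) A $$ (i, j)"
    using ij by (simp add: entrywise_sum_index)
qed (use B in \<open>auto simp: entrywise_sum_def\<close>)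

lemma entrywise_sum_mult:
  assumes B: "B \<in> carrier_mat m k" and F: "\<And>a. a \<in> A \<Longrightarrow> F a \<in> carrier_mat n m"
  shows "entrywise_sum n m F A * B = entrywise_sum n k (\<lambda>a. F a * B) A"
proof (rule eq_matI)
  fix i j assume "i < dim_row (entrywise_sum n k (\<lambda>a. F a * B) A)" "j < dim_col (entrywise_sum n k (\<lambda>a. F a * B) A)"
  then have ij: "i < n" "j < k" by (simp_all add: entrywise_sum_def)
  have "(entrywise_sum n m F A * B) $$ (i, j) = (\<Sum>l<m. \<Sum>a\<in>A. F a $$ (i, l) * B $$ (l, j))"
    using mult_mat_index[OF entrywise_sum_carrier B ij] ij by (simp add: entrywise_sum_index sum_distrib_right)
  also have "\<dots> = (\<Sum>a\<in>A. \<Sum>l<m. F a $$ (i, l) * B $$ (l, j))" by (rule sum.swap)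
  also have "\<dots> = (\<Sum>a\<in>A. (F a * B) $$ (i, j))"
    by (intro sum.cong refl mult_mat_index[OF F B ij, symmetric])
  finally show "(entrywise_sum n m F A * B) $$ (i, j) = entrywise_sum n k (\<lambda>a. F a * B) A $$ (i, j)"
    using ij by (simp add: entrywise_sum_index)
qed (use B in \<open>auto simp: entrywise_sum_def\<close>)

lemma entrywise_sum_reindex:
  assumes "bij_betw h A B"
  shows "entrywise_sum n m (\<lambda>a. F (h a)) A = entrywise_sum n m F B"
  unfolding entrywise_sum_def
  by (rule cong_mat) (auto intro: sum.reindex_bij_betw[OF assms, of "\<lambda>b. F b $$ _"])

section \<open>Irreducible complex representations of a finite group\<close>

lemma complex_representationD:
  assumes "complex_representation G n \<rho>"
  shows "g \<in> carrier G \<Longrightarrow> \<rho> g \<in> carrier_mat n n" "\<rho> \<one>\<^bsub>G\<^esub> = 1\<^sub>m n"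
    "g \<in> carrier G \<Longrightarrow> h \<in> carrier G \<Longrightarrow> \<rho> (g \<otimes>\<^bsub>G\<^esub> h) = \<rho> g * \<rho> h"
  using assms by (auto simp: complex_representation_def)

lemma irreducibleD:
  assumes "\<rho> \<in> irreducible_representations G n"
  shows "complex_representation G n \<rho>" "n > 0"
    "\<And>W. vec_subspace n W \<Longrightarrow> (\<And>g v. g \<in> carrier G \<Longrightarrow> v \<in> W \<Longrightarrow> \<rho> g *\<^sub>v v \<in> W)
      \<Longrightarrow> W = {0\<^sub>v n} \<or> W = carrier_vec n"
  using assms by (auto simp: irreducible_representations_def)

locale finite_group = group +
  assumes fin: "finite (carrier G)"
begin

text \<open>The restriction of \<open>\<rho>\<close> in the basis given by the columns of \<open>C\<close>; it is multiplicative because \<open>C\<close>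
  can be cancelled on the left.\<close>

lemma subrepresentation:
  assumes \<rho>: "complex_representation G n \<rho>" and W: "vec_subspace n W"
    and inv: "\<And>g v. g \<in> carrier G \<Longrightarrow> v \<in> W \<Longrightarrow> \<rho> g *\<^sub>v v \<in> W"
  obtains d C \<sigma> where "inj_mat n d C" "(*\<^sub>v) C ` carrier_vec d = W"
    "complex_representation G d \<sigma>" "\<And>g. g \<in> carrier G \<Longrightarrow> \<rho> g * C = C * \<sigma> g"
proof -
  note rd = complex_representationD[OF \<rho>]
  obtain d C where C: "inj_mat n d C" "(*\<^sub>v) C ` carrier_vec d = W" using subspace_basis[OF W] .
  have c: "C \<in> carrier_mat n d" using C by (simp add: inj_mat_def)
  have "\<forall>g\<in>carrier G. \<exists>S. S \<in> carrier_mat d d \<and> \<rho> g * C = C * S"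
    using restricted_matrix[OF C(1) rd(1)] inv C(2) unfolding Bex_def by auto
  then obtain \<sigma> where \<sigma>: "\<And>g. g \<in> carrier G \<Longrightarrow> \<sigma> g \<in> carrier_mat d d"
    "\<And>g. g \<in> carrier G \<Longrightarrow> \<rho> g * C = C * \<sigma> g" by metis
  have "complex_representation G d \<sigma>"
    unfolding complex_representation_def
  proof (intro conjI ballI)
    show "\<sigma> \<in> carrier G \<rightarrow> carrier_mat d d" using \<sigma> by auto
    have "C * \<sigma> \<one> = C * 1\<^sub>m d" using \<sigma>(2)[OF one_closed] rd(2) c by simp
    then show "\<sigma> \<one> = 1\<^sub>m d" by (rule inj_mat_cancel[OF C(1) \<sigma>(1)[OF one_closed] one_carrier_mat])
    fix g h assume g: "g \<in> carrier G" and h: "h \<in> carrier G"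
    have "C * \<sigma> (g \<otimes> h) = \<rho> g * \<rho> h * C" using \<sigma>(2)[OF m_closed[OF g h]] rd(3)[OF g h] by simp
    also have "\<dots> = \<rho> g * (\<rho> h * C)" using rd(1) g h c by (simp add: assoc_mult_mat[of _ n n _ n _ d])
    also have "\<dots> = \<rho> g * C * \<sigma> h"
      using rd(1)[OF g] \<sigma>(1)[OF h] c by (simp add: \<sigma>(2)[OF h] assoc_mult_mat[of _ n n _ d _ d])
    also have "\<dots> = C * (\<sigma> g * \<sigma> h)"
      using \<sigma>(1)[OF g] \<sigma>(1)[OF h] c by (simp add: \<sigma>(2)[OF g] assoc_mult_mat[of _ n d _ d _ d])
    finally show "\<sigma> (g \<otimes> h) = \<sigma> g * \<sigma> h"
      by (rule inj_mat_cancel[OF C(1) \<sigma>(1)[OF m_closed[OF g h]]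
            mult_carrier_mat[OF \<sigma>(1)[OF g] \<sigma>(1)[OF h]]])
  qed
  with C \<sigma> that show ?thesis by blast
qed

text \<open>An invariant subspace of least positive dimension is irreducible; the induction passes to a proper
  invariant subspace as long as there is one.\<close>

lemma irreducible_subrepresentation:
  assumes "complex_representation G n \<rho>" "n > 0"
  shows "\<exists>d C \<sigma>. inj_mat n d C \<and> \<sigma> \<in> irreducible_representations G d
    \<and> (\<forall>g\<in>carrier G. \<rho> g * C = C * \<sigma> g)"
  using assms
proof (induction n arbitrary: \<rho> rule: less_induct)
  case (less n)
  note rd = complex_representationD[OF less.prems(1)]
  show ?case
  proof (cases "\<rho> \<in> irreducible_representations G n")
    case True
    have "inj_mat n n (1\<^sub>m n)" by (auto simp: inj_mat_def)
    moreover have "\<rho> g * 1\<^sub>m n = 1\<^sub>m n * \<rho> g" if "g \<in> carrier G" for g using rd(1)[OF that] by simp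
    ultimately show ?thesis using True by blast
  next
    case False
    then obtain W where W: "vec_subspace n W" "\<And>g v. g \<in> carrier G \<Longrightarrow> v \<in> W \<Longrightarrow> \<rho> g *\<^sub>v v \<in> W"
      "W \<noteq> {0\<^sub>v n}" "W \<noteq> carrier_vec n"
      using less.prems unfolding irreducible_representations_def by blast
    obtain d C \<sigma> where C: "inj_mat n d C" "(*\<^sub>v) C ` carrier_vec d = W"
      and \<sigma>: "complex_representation G d \<sigma>" "\<And>g. g \<in> carrier G \<Longrightarrow> \<rho> g * C = C * \<sigma> g"
      using subrepresentation[OF less.prems(1) W(1,2)] by metis
    have c: "C \<in> carrier_mat n d" using C by (simp add: inj_mat_def)
    have "d > 0"
    proof (rule ccontr)
      assume "\<not> d > 0"
      then have "C *\<^sub>v v = 0\<^sub>v n" if "v \<in> carrier_vec d" for v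
        using c that by (intro eq_vecI) (auto simp: scalar_prod_def)
      then have "(*\<^sub>v) C ` carrier_vec d = (\<lambda>v :: complex vec. 0\<^sub>v n) ` carrier_vec d" by (intro image_cong) auto
      also have "\<dots> = {0\<^sub>v n}" by (rule image_constant[OF zero_carrier_vec])
      finally have "(*\<^sub>v) C ` carrier_vec d = {0\<^sub>v n}" .
      with C(2) W(3) show False by simp
    qed
    have "d \<noteq> n"
    proof
      assume "d = n"
      then obtain B where B: "B \<in> carrier_mat n n" "C * B = 1\<^sub>m n"
        using C inj_mat_square_inverse by metis
      have "v \<in> (*\<^sub>v) C ` carrier_vec d" if v: "v \<in> carrier_vec n" for v
      proof
        show "v = C *\<^sub>v (B *\<^sub>v v)"
          using assoc_mult_mat_vec[of C n n B n v] B c v \<open>d = n\<close> by simp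
      qed (use B v \<open>d = n\<close> in auto)
      then show False using C(2) W(1,4) vec_subspaceD(1) by blast
    qed
    then have "d < n" using inj_mat_le[OF C(1)] by simp
    from less.IH[OF this \<sigma>(1) \<open>d > 0\<close>] obtain e D \<tau> where
      D: "inj_mat d e D" and \<tau>: "\<tau> \<in> irreducible_representations G e"
      and eq: "\<And>g. g \<in> carrier G \<Longrightarrow> \<sigma> g * D = D * \<tau> g" by blast
    have dc: "D \<in> carrier_mat d e" using D by (simp add: inj_mat_def)
    have "\<rho> g * (C * D) = C * D * \<tau> g" if g: "g \<in> carrier G" for g
    proof -
      note carr = rd(1)[OF g] c dc complex_representationD(1)[OF \<sigma>(1) g]
        complex_representationD(1)[OF irreducibleD(1)[OF \<tau>] g]
      have "\<rho> g * (C * D) = \<rho> g * C * D" using carr by (simp add: assoc_mult_mat[of _ n n _ d _ e])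
      also have "\<dots> = C * (\<sigma> g * D)" using carr by (simp add: \<sigma>(2)[OF g] assoc_mult_mat[of _ n d _ d _ e])
      also have "\<dots> = C * D * \<tau> g" using carr by (simp add: eq[OF g] assoc_mult_mat[of _ n d _ e _ e])
      finally show ?thesis .
    qed
    then show ?thesis using inj_mat_mult[OF C(1) D] \<tau> by blast
  qed
qed

subsection \<open>Schur's lemma\<close>

text \<open>The kernel of an intertwiner is an invariant subspace.\<close>

lemma intertwiner_inj:
  assumes \<rho>: "\<rho> \<in> irreducible_representations G n" and \<sigma>: "complex_representation G m \<sigma>"
    and T: "T \<in> carrier_mat m n" "T \<noteq> 0\<^sub>m m n"
    and eq: "\<And>g. g \<in> carrier G \<Longrightarrow> T * \<rho> g = \<sigma> g * T"
  shows "inj_mat m n T"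
proof -
  define W where "W = {v \<in> carrier_vec n. T *\<^sub>v v = 0\<^sub>v m}"
  have T0: "A *\<^sub>v 0\<^sub>v k = 0\<^sub>v l" if "A \<in> carrier_mat l k" for A :: "complex mat" and k l
    using that by (intro eq_vecI) auto
  have "vec_subspace n W"
    unfolding vec_subspace_def W_def
    using T(1) T0[OF T(1)] by (auto simp: mult_add_distrib_mat_vec[OF T(1)] mult_mat_vec[OF T(1)])
  moreover have "\<rho> g *\<^sub>v v \<in> W" if g: "g \<in> carrier G" and v: "v \<in> W" for g v
  proof -
    note rg = complex_representationD(1)[OF irreducibleD(1)[OF \<rho>] g]
    note sg = complex_representationD(1)[OF \<sigma> g]
    have vc: "v \<in> carrier_vec n" "T *\<^sub>v v = 0\<^sub>v m" using v by (auto simp: W_def)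
    have "T *\<^sub>v (\<rho> g *\<^sub>v v) = (T * \<rho> g) *\<^sub>v v" using T(1) rg vc by simp
    also have "\<dots> = \<sigma> g *\<^sub>v (T *\<^sub>v v)" unfolding eq[OF g] using T(1) sg vc by simp
    also have "\<dots> = 0\<^sub>v m" using vc(2) T0[OF sg] by simp
    finally show ?thesis using rg vc by (simp add: W_def)
  qed
  ultimately consider "W = {0\<^sub>v n}" | "W = carrier_vec n" using irreducibleD(3)[OF \<rho>] by blast
  then show ?thesis
  proof cases
    case 1
    then show ?thesis using T(1) unfolding inj_mat_def W_def by blast
  next
    case 2
    have "T = 0\<^sub>m m n"
    proof (rule mat_col_eqI)
      fix j assume "j < dim_col (0\<^sub>m m n :: complex mat)"
      then have j: "j < n" by simp
      have "unit_vec n j \<in> W" using 2 by simp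
      then have "T *\<^sub>v unit_vec n j = 0\<^sub>v m" by (simp add: W_def)
      moreover have "col (T * 1\<^sub>m n) j = T *\<^sub>v unit_vec n j"
        using col_mult2[OF T(1) one_carrier_mat j] j by simp
      ultimately show "col T j = col (0\<^sub>m m n) j" using T(1) j by simp
    qed (use T in auto)
    with T(2) show ?thesis by simp
  qed
qed

text \<open>The image is an invariant subspace as well, so that a nonzero intertwiner is bijective.\<close>

lemma intertwiner_iso:
  assumes \<rho>: "\<rho> \<in> irreducible_representations G n" and \<sigma>: "\<sigma> \<in> irreducible_representations G m"
    and T: "T \<in> carrier_mat m n" "T \<noteq> 0\<^sub>m m n"
    and eq: "\<And>g. g \<in> carrier G \<Longrightarrow> T * \<rho> g = \<sigma> g * T"
  shows "n = m" "(\<rho>, \<sigma>) \<in> isomorphic_irreducibles G n"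
proof -
  note sd = irreducibleD[OF \<sigma>]
  have inj: "inj_mat m n T" by (rule intertwiner_inj[OF \<rho> sd(1) T eq])
  let ?W = "(*\<^sub>v) T ` carrier_vec n"
  have "\<sigma> g *\<^sub>v w \<in> ?W" if g: "g \<in> carrier G" and w: "w \<in> ?W" for g w
  proof -
    obtain v where v: "v \<in> carrier_vec n" "w = T *\<^sub>v v" using w by auto
    note rg = complex_representationD(1)[OF irreducibleD(1)[OF \<rho>] g]
    note sg = complex_representationD(1)[OF sd(1) g]
    have "\<sigma> g *\<^sub>v w = (\<sigma> g * T) *\<^sub>v v" using v sg T(1) by simp
    also have "\<dots> = T *\<^sub>v (\<rho> g *\<^sub>v v)" unfolding eq[OF g, symmetric] using v rg T(1) by simp
    finally show ?thesis using v rg by auto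
  qed
  then consider "?W = {0\<^sub>v m}" | "?W = carrier_vec m"
    using sd(3)[OF vec_subspace_image[OF T(1)]] by blast
  then have W: "?W = carrier_vec m"
  proof cases
    case 1
    have u: "unit_vec n 0 \<in> carrier_vec n" by simp
    then have "T *\<^sub>v unit_vec n 0 = 0\<^sub>v m" using 1 by blast
    then have "unit_vec n 0 = (0\<^sub>v n :: complex vec)" using inj u unfolding inj_mat_def by blast
    then have "vec_index (unit_vec n 0) 0 = vec_index (0\<^sub>v n :: complex vec) 0" by simp
    then show ?thesis using irreducibleD(2)[OF \<rho>] by simp
  qed
  \<comment> \<open>Preimages of the unit vectors form a right inverse of \<open>T\<close>, which forces \<open>m \<le> n\<close>.\<close>
  have "\<exists>s\<in>carrier_vec n. T *\<^sub>v s = unit_vec m j" for j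
  proof -
    have "unit_vec m j \<in> ?W" unfolding W by simp
    then show ?thesis by (metis imageE)
  qed
  then obtain s where s: "\<And>j. s j \<in> carrier_vec n" "\<And>j. T *\<^sub>v s j = unit_vec m j" by metis
  define S where "S = mat n m (\<lambda>(i, j). vec_index (s j) i)"
  have S: "S \<in> carrier_mat n m" by (simp add: S_def)
  have TS: "T * S = 1\<^sub>m m"
  proof (rule mat_col_eqI)
    fix j assume "j < dim_col (1\<^sub>m m :: complex mat)"
    then have j: "j < m" by simp
    have "col S j = s j" using j s(1)[of j] by (intro eq_vecI) (auto simp: S_def)
    then show "col (T * S) j = col (1\<^sub>m m) j" using col_mult2[OF T(1) S j] s(2) j by simp
  qed (use T S in auto)
  have "m \<le> n"
  proof (rule inj_mat_le, unfold inj_mat_def)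
    show "S \<in> carrier_mat n m \<and> (\<forall>v\<in>carrier_vec m. S *\<^sub>v v = 0\<^sub>v n \<longrightarrow> v = 0\<^sub>v m)"
  proof (intro conjI ballI impI S)
    fix v assume v: "v \<in> carrier_vec m" "S *\<^sub>v v = 0\<^sub>v n"
    have "v = T *\<^sub>v (S *\<^sub>v v)" using assoc_mult_mat_vec[OF T(1) S v(1)] TS v by simp
    also have "\<dots> = 0\<^sub>v m" unfolding v(2) using T(1) by (intro eq_vecI) auto
    finally show "v = 0\<^sub>v m" .
    qed
  qed
  then show nm: "n = m" using inj_mat_le[OF inj] by simp
  obtain B where B: "B \<in> carrier_mat n n" "T * B = 1\<^sub>m n" "B * T = 1\<^sub>m n"
    using inj_mat_square_inverse inj nm by metis
  have Tn: "T \<in> carrier_mat n n" using T(1) nm by simp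
  have "invertible_mat T" using B Tn by (auto simp: invertible_mat_iff[OF Tn])
  then show "(\<rho>, \<sigma>) \<in> isomorphic_irreducibles G n"
    using \<rho> \<sigma> nm Tn eq by (auto simp: isomorphic_irreducibles_def)
qed

text \<open>Subtracting an eigenvalue leaves an intertwiner that is not injective, hence zero.\<close>

lemma intertwiner_scalar:
  assumes \<rho>: "\<rho> \<in> irreducible_representations G n" and T: "T \<in> carrier_mat n n"
    and eq: "\<And>g. g \<in> carrier G \<Longrightarrow> T * \<rho> g = \<rho> g * T"
  obtains c where "T = c \<cdot>\<^sub>m 1\<^sub>m n"
proof -
  note rd = irreducibleD[OF \<rho>]
  obtain c where "eigenvalue T c" using spectrum_non_empty[OF T rd(2)] by (auto simp: spectrum_def)
  then obtain v where v: "v \<in> carrier_vec n" "v \<noteq> 0\<^sub>v n" "T *\<^sub>v v = c \<cdot>\<^sub>v v"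
    using T by (auto simp: eigenvalue_def eigenvector_def)
  let ?I = "c \<cdot>\<^sub>m 1\<^sub>m n :: complex mat"
  have I: "?I \<in> carrier_mat n n" by simp
  have TI: "T - ?I \<in> carrier_mat n n" by (rule minus_carrier_mat[OF I])
  have comm: "(T - ?I) * \<rho> g = \<rho> g * (T - ?I)" if g: "g \<in> carrier G" for g
  proof -
    have rg: "\<rho> g \<in> carrier_mat n n" by (rule complex_representationD(1)[OF rd(1) g])
    have "?I * \<rho> g = \<rho> g * ?I"
      using mult_smult_distrib[OF rg one_carrier_mat] mult_smult_assoc_mat[OF one_carrier_mat rg] rg by simp
    then show ?thesis
      using minus_mult_distrib_mat[OF T I rg] mult_minus_distrib_mat[OF rg T I] eq[OF g] by simp
  qed
  have "(T - ?I) *\<^sub>v v = 0\<^sub>v n"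
  proof -
    have "?I *\<^sub>v v = c \<cdot>\<^sub>v v"
    proof (rule eq_vecI)
      fix i assume "i < dim_vec (c \<cdot>\<^sub>v v)"
      then have i: "i < n" using v by simp
      have "vec_index (?I *\<^sub>v v) i = (\<Sum>j<n. if j = i then c * vec_index v j else 0)"
        unfolding mult_mat_vec_index[OF I v(1) i] using i by (intro sum.cong) auto
      also have "\<dots> = c * vec_index v i" using i by simp
      finally show "vec_index (?I *\<^sub>v v) i = vec_index (c \<cdot>\<^sub>v v) i" using i v by simp
    qed (use v in simp)
    then show ?thesis using minus_mult_distrib_mat_vec[OF T I v(1)] v by simp
  qed
  then have "\<not> inj_mat n n (T - ?I)" using v unfolding inj_mat_def by blast
  then have z: "T - ?I = 0\<^sub>m n n" using intertwiner_inj[OF \<rho> rd(1) TI _ comm] by blast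
  have "T = ?I"
  proof (rule eq_matI)
    fix i j assume ij: "i < dim_row ?I" "j < dim_col ?I"
    then have "(T - ?I) $$ (i, j) = 0" unfolding z by simp
    then show "T $$ (i, j) = ?I $$ (i, j)" using ij T by simp
  qed (use T in auto)
  then show ?thesis by (rule that)
qed

end

subsection \<open>Orthogonality of characters\<close>

definition elementary_mat :: "nat \<Rightarrow> nat \<Rightarrow> nat \<Rightarrow> nat \<Rightarrow> complex mat" where
  "elementary_mat m n p q = mat m n (\<lambda>(a, b). if a = p \<and> b = q then 1 else 0)"

lemma elementary_mat_carrier [simp]: "elementary_mat m n p q \<in> carrier_mat m n"
  by (simp add: elementary_mat_def)

lemma mult_elementary_mult_index:
  assumes A: "A \<in> carrier_mat m m" and B: "B \<in> carrier_mat n n"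
    and idx: "i < m" "p < m" "q < n" "j < n"
  shows "(A * elementary_mat m n p q * B) $$ (i, j) = A $$ (i, p) * B $$ (q, j)"
proof -
  have AE: "(A * elementary_mat m n p q) $$ (i, b) = (if b = q then A $$ (i, p) else 0)" if "b < n" for b
  proof -
    have "(A * elementary_mat m n p q) $$ (i, b) = (\<Sum>k<m. if k = p then (if b = q then A $$ (i, p) else 0) else 0)"
      unfolding mult_mat_index[OF A elementary_mat_carrier idx(1) that]
      using that by (intro sum.cong) (auto simp: elementary_mat_def)
    then show ?thesis using idx by simp
  qed
  have AEc: "A * elementary_mat m n p q \<in> carrier_mat m n" using A by simp
  have "(A * elementary_mat m n p q * B) $$ (i, j) = (\<Sum>k<n. if k = q then A $$ (i, p) * B $$ (q, j) else 0)"
    unfolding mult_mat_index[OF AEc B idx(1,4)] by (intro sum.cong) (auto simp: AE)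
  then show ?thesis using idx by simp
qed

definition character :: "nat \<Rightarrow> ('g \<Rightarrow> complex mat) \<Rightarrow> 'g \<Rightarrow> complex" where
  "character n \<rho> g = (\<Sum>i<n. \<rho> g $$ (i, i))"

lemma trace_mult_commute:
  fixes A B :: "complex mat"
  assumes "A \<in> carrier_mat n n" "B \<in> carrier_mat n n"
  shows "(\<Sum>i<n. (A * B) $$ (i, i)) = (\<Sum>i<n. (B * A) $$ (i, i))"
proof -
  have "(\<Sum>i<n. (A * B) $$ (i, i)) = (\<Sum>i<n. \<Sum>k<n. A $$ (i, k) * B $$ (k, i))"
    by (intro sum.cong refl mult_mat_index[OF assms]) auto
  also have "\<dots> = (\<Sum>k<n. \<Sum>i<n. B $$ (k, i) * A $$ (i, k))" by (subst sum.swap) (intro sum.cong refl mult.commute)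
  also have "\<dots> = (\<Sum>k<n. (B * A) $$ (k, k))"
    by (intro sum.cong refl mult_mat_index[OF assms(2,1), symmetric]) auto
  finally show ?thesis .
qed

definition class_function :: "('g, 'm) monoid_scheme \<Rightarrow> ('g \<Rightarrow> complex) \<Rightarrow> bool" where
  "class_function G f \<longleftrightarrow> (\<forall>g\<in>carrier G. \<forall>h\<in>carrier G. f (h \<otimes>\<^bsub>G\<^esub> g \<otimes>\<^bsub>G\<^esub> inv\<^bsub>G\<^esub> h) = f g)"

context finite_group
begin

lemma bij_left_mult: "h \<in> carrier G \<Longrightarrow> bij_betw (\<lambda>g. h \<otimes> g) (carrier G) (carrier G)"
  by (rule bij_betw_byWitness[where f' = "\<lambda>g. inv h \<otimes> g"]) (auto simp: m_assoc[symmetric])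

lemma bij_conjugation: "h \<in> carrier G \<Longrightarrow> bij_betw (\<lambda>g. h \<otimes> g \<otimes> inv h) (carrier G) (carrier G)"
  by (rule bij_betw_byWitness[where f' = "\<lambda>g. inv h \<otimes> g \<otimes> h"])
     (auto simp: m_assoc inv_solve_left, simp_all add: m_assoc[symmetric])

text \<open>Left translation by \<open>h\<close> permutes the summands.\<close>

lemma average_intertwines:
  assumes \<rho>: "complex_representation G n \<rho>" and \<sigma>: "complex_representation G m \<sigma>"
    and X: "X \<in> carrier_mat m n" and h: "h \<in> carrier G"
  defines "S \<equiv> entrywise_sum m n (\<lambda>g. \<sigma> g * X * \<rho> (inv g)) (carrier G)"
  shows "S * \<rho> h = \<sigma> h * S"
proof -
  note rd = complex_representationD[OF \<rho>] and sd = complex_representationD[OF \<sigma>]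
  have cl: "\<sigma> g * X * \<rho> (inv g) \<in> carrier_mat m n" if "g \<in> carrier G" for g
    using sd(1)[OF that] rd(1)[OF inv_closed[OF that]] X by simp
  have "\<sigma> h * S = entrywise_sum m n (\<lambda>g. \<sigma> h * (\<sigma> g * X * \<rho> (inv g))) (carrier G)"
    unfolding S_def by (rule mult_entrywise_sum[OF sd(1)[OF h] cl])
  also have "\<dots> = entrywise_sum m n (\<lambda>g. \<sigma> (h \<otimes> g) * X * \<rho> (inv (h \<otimes> g) \<otimes> h)) (carrier G)"
  proof (rule entrywise_sum_cong)
    fix g assume g: "g \<in> carrier G"
    have e: "inv (h \<otimes> g) \<otimes> h = inv g" using g h by (simp add: inv_mult_group m_assoc)
    have "\<sigma> (h \<otimes> g) * X = \<sigma> h * (\<sigma> g * X)"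
      unfolding sd(3)[OF h g] by (rule assoc_mult_mat[OF sd(1)[OF h] sd(1)[OF g] X])
    moreover have "\<sigma> h * (\<sigma> g * X * \<rho> (inv g)) = \<sigma> h * (\<sigma> g * X) * \<rho> (inv g)"
      by (rule assoc_mult_mat[OF sd(1)[OF h] mult_carrier_mat[OF sd(1)[OF g] X]
            rd(1)[OF inv_closed[OF g]], symmetric])
    ultimately show "\<sigma> h * (\<sigma> g * X * \<rho> (inv g)) = \<sigma> (h \<otimes> g) * X * \<rho> (inv (h \<otimes> g) \<otimes> h)"
      unfolding e by simp
  qed
  also have "\<dots> = entrywise_sum m n (\<lambda>g. \<sigma> g * X * \<rho> (inv g \<otimes> h)) (carrier G)"
    by (rule entrywise_sum_reindex[OF bij_left_mult[OF h]])
  also have "\<dots> = entrywise_sum m n (\<lambda>g. \<sigma> g * X * \<rho> (inv g) * \<rho> h) (carrier G)"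
  proof (rule entrywise_sum_cong)
    fix g assume g: "g \<in> carrier G"
    show "\<sigma> g * X * \<rho> (inv g \<otimes> h) = \<sigma> g * X * \<rho> (inv g) * \<rho> h"
      unfolding rd(3)[OF inv_closed[OF g] h]
      by (rule assoc_mult_mat[OF mult_carrier_mat[OF sd(1)[OF g] X] rd(1)[OF inv_closed[OF g]]
            rd(1)[OF h], symmetric])
  qed
  also have "\<dots> = S * \<rho> h"
    unfolding S_def by (rule entrywise_sum_mult[OF rd(1)[OF h] cl, symmetric])
  finally show ?thesis by simp
qed

lemma entry_average_elementary:
  assumes \<rho>: "complex_representation G n \<rho>" and \<sigma>: "complex_representation G m \<sigma>"
    and idx: "i < m" "p < m" "q < n" "j < n"
  shows "entrywise_sum m n (\<lambda>g. \<sigma> g * elementary_mat m n p q * \<rho> (inv g)) (carrier G) $$ (i, j)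
    = (\<Sum>g\<in>carrier G. \<sigma> g $$ (i, p) * \<rho> (inv g) $$ (q, j))"
  unfolding entrywise_sum_index[OF idx(1,4)]
  using idx complex_representationD(1)[OF \<rho>] complex_representationD(1)[OF \<sigma>]
  by (intro sum.cong refl mult_elementary_mult_index) auto

text \<open>Averaging an elementary matrix over \<open>G\<close> gives an intertwiner, which vanishes by Schur's lemma.
  Its entries are the sums of products of matrix coefficients.  The argument \<open>inv g\<close> stands in
  for complex conjugation, which makes the pairing bilinear.\<close>

lemma character_orthogonal:
  assumes \<rho>: "\<rho> \<in> irreducible_representations G n" and \<sigma>: "\<sigma> \<in> irreducible_representations G m"
    and niso: "\<not> (n = m \<and> (\<rho>, \<sigma>) \<in> isomorphic_irreducibles G n)"
  shows "(\<Sum>g\<in>carrier G. character m \<sigma> g * character n \<rho> (inv g)) = 0"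
proof -
  note rr = irreducibleD(1)[OF \<rho>] and sr = irreducibleD(1)[OF \<sigma>]
  have z: "(\<Sum>g\<in>carrier G. \<sigma> g $$ (i, p) * \<rho> (inv g) $$ (q, j)) = 0"
    if "i < m" "p < m" "q < n" "j < n" for i p q j
  proof -
    let ?S = "entrywise_sum m n (\<lambda>g. \<sigma> g * elementary_mat m n p q * \<rho> (inv g)) (carrier G)"
    have "?S = 0\<^sub>m m n"
      using intertwiner_iso[OF \<rho> \<sigma> _ _ average_intertwines[OF rr sr elementary_mat_carrier]] niso
      by (meson entrywise_sum_carrier)
    then show ?thesis using entry_average_elementary[OF rr sr that] that by simp
  qed
  have "(\<Sum>g\<in>carrier G. character m \<sigma> g * character n \<rho> (inv g))
      = (\<Sum>g\<in>carrier G. \<Sum>i<m. \<Sum>j<n. \<sigma> g $$ (i, i) * \<rho> (inv g) $$ (j, j))"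
    by (simp add: character_def sum_product)
  also have "\<dots> = (\<Sum>i<m. \<Sum>j<n. \<Sum>g\<in>carrier G. \<sigma> g $$ (i, i) * \<rho> (inv g) $$ (j, j))"
    by (subst sum.swap, rule sum.cong[OF refl], rule sum.swap)
  also have "\<dots> = 0" by (simp add: z)
  finally show ?thesis .
qed

text \<open>The averaged elementary matrix is now a scalar \<open>c\<close>, and its trace is \<open>n c\<close>; on the other hand,
  averaging preserves the trace up to the factor \<open>|G|\<close>.\<close>

lemma character_norm:
  assumes \<rho>: "\<rho> \<in> irreducible_representations G n"
  shows "(\<Sum>g\<in>carrier G. character n \<rho> g * character n \<rho> (inv g)) = of_nat (order G)"
proof -
  note rr = irreducibleD(1)[OF \<rho>] and rd = complex_representationD[OF irreducibleD(1)[OF \<rho>]]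
  let ?s = "\<lambda>i p q j. \<Sum>g\<in>carrier G. \<rho> g $$ (i, p) * \<rho> (inv g) $$ (q, j)"
  let ?\<delta> = "\<lambda>p q. if p = q then of_nat (order G) else 0 :: complex"
  have s: "of_nat n * ?s i p q j = (if i = j then ?\<delta> p q else 0)"
    if idx: "i < n" "p < n" "q < n" "j < n" for i p q j
  proof -
    let ?S = "entrywise_sum n n (\<lambda>g. \<rho> g * elementary_mat n n p q * \<rho> (inv g)) (carrier G)"
    obtain c where c: "?S = c \<cdot>\<^sub>m 1\<^sub>m n"
      using intertwiner_scalar[OF \<rho> entrywise_sum_carrier average_intertwines[OF rr rr elementary_mat_carrier]] .
    have sc: "?s i p q j = (if i = j then c else 0)" if "i < n" "j < n" for i j
      using entry_average_elementary[OF rr rr that(1) idx(2,3) that(2)] that unfolding c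
      by (cases "i = j") simp_all
    have "of_nat n * c = (\<Sum>i<n. ?s i p q i)" by (simp add: sc)
    also have "\<dots> = (\<Sum>g\<in>carrier G. \<Sum>i<n. \<rho> (inv g) $$ (q, i) * \<rho> g $$ (i, p))"
      by (subst sum.swap) (intro sum.cong refl mult.commute)
    also have "\<dots> = (\<Sum>g\<in>carrier G. (\<rho> (inv g) * \<rho> g) $$ (q, p))"
      using idx rd(1) by (intro sum.cong refl mult_mat_index[symmetric]) auto
    also have "\<dots> = (\<Sum>g\<in>carrier G. if p = q then 1 else 0)"
      using idx rd(2) by (intro sum.cong refl) (auto simp: rd(3)[symmetric])
    also have "\<dots> = ?\<delta> p q" by (simp add: order_def)
    finally show ?thesis using sc[OF idx(1,4)] by simp
  qed
  have "of_nat n * (\<Sum>g\<in>carrier G. character n \<rho> g * character n \<rho> (inv g))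
      = of_nat n * (\<Sum>g\<in>carrier G. \<Sum>i<n. \<Sum>j<n. \<rho> g $$ (i, i) * \<rho> (inv g) $$ (j, j))"
    by (simp add: character_def sum_product)
  also have "(\<Sum>g\<in>carrier G. \<Sum>i<n. \<Sum>j<n. \<rho> g $$ (i, i) * \<rho> (inv g) $$ (j, j)) = (\<Sum>i<n. \<Sum>j<n. ?s i i j j)"
    by (subst sum.swap, rule sum.cong[OF refl], rule sum.swap)
  also have "of_nat n * \<dots> = (\<Sum>i<n. \<Sum>j<n. of_nat n * ?s i i j j)" by (simp add: sum_distrib_left)
  also have "\<dots> = (\<Sum>i<n. \<Sum>j<n. if i = j then of_nat (order G) else 0)"
    by (intro sum.cong refl) (simp add: s)
  also have "\<dots> = of_nat n * of_nat (order G)" by simp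
  finally show ?thesis using irreducibleD(2)[OF \<rho>] by simp
qed

lemma class_function_character:
  assumes \<rho>: "complex_representation G n \<rho>"
  shows "class_function G (character n \<rho>)"
  unfolding class_function_def
proof (intro ballI)
  note rd = complex_representationD[OF \<rho>]
  fix g h assume g: "g \<in> carrier G" and h: "h \<in> carrier G"
  have "character n \<rho> (h \<otimes> g \<otimes> inv h) = (\<Sum>i<n. (\<rho> (h \<otimes> g) * \<rho> (inv h)) $$ (i, i))"
    using g h by (simp add: character_def rd(3))
  also have "\<dots> = (\<Sum>i<n. (\<rho> (inv h) * \<rho> (h \<otimes> g)) $$ (i, i))"
    using g h by (intro trace_mult_commute rd(1)) auto
  also have "\<dots> = character n \<rho> g"
    using g h by (simp add: character_def rd(3)[symmetric] m_assoc[symmetric])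
  finally show "character n \<rho> (h \<otimes> g \<otimes> inv h) = character n \<rho> g" .
qed

subsection \<open>Completeness of the irreducible characters\<close>

text \<open>The action of the element \<open>\<Sum> f(g) g\<close> of the group algebra in the representation \<open>\<rho>\<close>.\<close>

definition group_algebra_action :: "nat \<Rightarrow> ('a \<Rightarrow> complex) \<Rightarrow> ('a \<Rightarrow> complex mat) \<Rightarrow> complex mat" where
  "group_algebra_action n f \<rho> = entrywise_sum n n (\<lambda>g. f g \<cdot>\<^sub>m \<rho> g) (carrier G)"

lemma group_algebra_action_carrier [simp]: "group_algebra_action n f \<rho> \<in> carrier_mat n n"
  by (simp add: group_algebra_action_def)

text \<open>Conjugation by \<open>h\<close> permutes the summands and leaves the coefficients unchanged.\<close>

lemma class_function_action_commutes:
  assumes \<rho>: "complex_representation G n \<rho>" and f: "class_function G f" and h: "h \<in> carrier G"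
  shows "group_algebra_action n f \<rho> * \<rho> h = \<rho> h * group_algebra_action n f \<rho>"
proof -
  note rd = complex_representationD[OF \<rho>]
  have cl: "f g \<cdot>\<^sub>m \<rho> g \<in> carrier_mat n n" if "g \<in> carrier G" for g using rd(1)[OF that] by simp
  have "\<rho> h * group_algebra_action n f \<rho> = entrywise_sum n n (\<lambda>g. \<rho> h * (f g \<cdot>\<^sub>m \<rho> g)) (carrier G)"
    unfolding group_algebra_action_def by (rule mult_entrywise_sum[OF rd(1)[OF h] cl])
  also have "\<dots> = entrywise_sum n n (\<lambda>g. f (h \<otimes> g \<otimes> inv h) \<cdot>\<^sub>m \<rho> (h \<otimes> g \<otimes> inv h \<otimes> h)) (carrier G)"
  proof (rule entrywise_sum_cong)
    fix g assume g: "g \<in> carrier G"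
    have "f (h \<otimes> g \<otimes> inv h) = f g" using f g h by (simp add: class_function_def)
    moreover have "h \<otimes> g \<otimes> inv h \<otimes> h = h \<otimes> g" using g h by (simp add: m_assoc)
    ultimately show "\<rho> h * (f g \<cdot>\<^sub>m \<rho> g) = f (h \<otimes> g \<otimes> inv h) \<cdot>\<^sub>m \<rho> (h \<otimes> g \<otimes> inv h \<otimes> h)"
      using mult_smult_distrib[OF rd(1)[OF h] rd(1)[OF g]] by (simp add: rd(3)[OF h g])
  qed
  also have "\<dots> = entrywise_sum n n (\<lambda>g. f g \<cdot>\<^sub>m \<rho> (g \<otimes> h)) (carrier G)"
    by (rule entrywise_sum_reindex[OF bij_conjugation[OF h]])
  also have "\<dots> = entrywise_sum n n (\<lambda>g. (f g \<cdot>\<^sub>m \<rho> g) * \<rho> h) (carrier G)"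
  proof (rule entrywise_sum_cong)
    fix g assume g: "g \<in> carrier G"
    show "f g \<cdot>\<^sub>m \<rho> (g \<otimes> h) = (f g \<cdot>\<^sub>m \<rho> g) * \<rho> h"
      using mult_smult_assoc_mat[OF rd(1)[OF g] rd(1)[OF h]] by (simp add: rd(3)[OF g h])
  qed
  also have "\<dots> = group_algebra_action n f \<rho> * \<rho> h"
    unfolding group_algebra_action_def by (rule entrywise_sum_mult[OF rd(1)[OF h] cl, symmetric])
  finally show ?thesis by simp
qed

text \<open>The operator is a scalar by Schur's lemma, and its trace is the pairing of \<open>f\<close> with the character.\<close>

lemma class_function_action_zero:
  assumes \<rho>: "\<rho> \<in> irreducible_representations G n" and f: "class_function G f"
    and orth: "(\<Sum>g\<in>carrier G. f g * character n \<rho> g) = 0"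
  shows "group_algebra_action n f \<rho> = 0\<^sub>m n n"
proof -
  note rr = irreducibleD(1)[OF \<rho>] and rd = complex_representationD[OF irreducibleD(1)[OF \<rho>]]
  obtain c where c: "group_algebra_action n f \<rho> = c \<cdot>\<^sub>m 1\<^sub>m n"
    using intertwiner_scalar[OF \<rho> group_algebra_action_carrier class_function_action_commutes[OF rr f]] .
  have "of_nat n * c = (\<Sum>i<n. group_algebra_action n f \<rho> $$ (i, i))" by (simp add: c)
  also have "\<dots> = (\<Sum>i<n. \<Sum>g\<in>carrier G. f g * \<rho> g $$ (i, i))"
  proof (rule sum.cong[OF refl])
    fix i assume "i \<in> {..<n}"
    then have i: "i < n" by simp
    show "group_algebra_action n f \<rho> $$ (i, i) = (\<Sum>g\<in>carrier G. f g * \<rho> g $$ (i, i))"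
      unfolding group_algebra_action_def entrywise_sum_index[OF i i]
    proof (rule sum.cong[OF refl])
      fix g assume "g \<in> carrier G"
      then show "(f g \<cdot>\<^sub>m \<rho> g) $$ (i, i) = f g * \<rho> g $$ (i, i)" using rd(1)[of g] i by simp
    qed
  qed
  also have "\<dots> = (\<Sum>g\<in>carrier G. f g * character n \<rho> g)"
    by (subst sum.swap) (simp add: character_def sum_distrib_left)
  finally have "c = 0" using orth irreducibleD(2)[OF \<rho>] by simp
  then show ?thesis unfolding c by (intro eq_matI) auto
qed

end

definition cinner :: "nat \<Rightarrow> complex vec \<Rightarrow> complex vec \<Rightarrow> complex" where
  "cinner n v w = (\<Sum>i<n. cnj (vec_index v i) * vec_index w i)"

definition adjoint_mat :: "nat \<Rightarrow> complex mat \<Rightarrow> complex mat" where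
  "adjoint_mat n A = mat n n (\<lambda>(i, j). cnj (A $$ (j, i)))"

lemma adjoint_mat_carrier [simp]: "adjoint_mat n A \<in> carrier_mat n n"
  by (simp add: adjoint_mat_def)

lemma cinner_adjoint:
  assumes A: "A \<in> carrier_mat n n" and v: "v \<in> carrier_vec n" and w: "w \<in> carrier_vec n"
  shows "cinner n (A *\<^sub>v v) w = cinner n v (adjoint_mat n A *\<^sub>v w)"
    and "cinner n (adjoint_mat n A *\<^sub>v v) w = cinner n v (A *\<^sub>v w)"
proof -
  have *: "cinner n (B *\<^sub>v v) w = cinner n v (B' *\<^sub>v w)"
    if B: "B \<in> carrier_mat n n" "B' \<in> carrier_mat n n"
      and e: "\<And>i j. i < n \<Longrightarrow> j < n \<Longrightarrow> B' $$ (j, i) = cnj (B $$ (i, j))" for B B'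
  proof -
    have "cinner n (B *\<^sub>v v) w = (\<Sum>i<n. \<Sum>j<n. cnj (B $$ (i, j)) * cnj (vec_index v j) * vec_index w i)"
      unfolding cinner_def
      by (intro sum.cong refl) (simp add: mult_mat_vec_index[OF B(1) v] sum_distrib_right del: index_mult_mat_vec)
    also have "\<dots> = (\<Sum>j<n. \<Sum>i<n. cnj (B $$ (i, j)) * cnj (vec_index v j) * vec_index w i)" by (rule sum.swap)
    also have "\<dots> = cinner n v (B' *\<^sub>v w)"
      unfolding cinner_def
      by (intro sum.cong refl)
         (auto simp: mult_mat_vec_index[OF B(2) w] sum_distrib_left e mult_ac simp del: index_mult_mat_vec
           intro!: sum.cong)
    finally show ?thesis .
  qed
  show "cinner n (A *\<^sub>v v) w = cinner n v (adjoint_mat n A *\<^sub>v w)"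
    by (rule *[OF A]) (simp_all add: adjoint_mat_def)
  show "cinner n (adjoint_mat n A *\<^sub>v v) w = cinner n v (A *\<^sub>v w)"
    by (rule *[OF _ A]) (simp_all add: adjoint_mat_def)
qed

lemma cinner_definite:
  assumes v: "v \<in> carrier_vec n" and z: "cinner n v v = 0"
  shows "v = 0\<^sub>v n"
proof -
  have "cinner n v v = of_real (\<Sum>i<n. (cmod (vec_index v i))\<^sup>2)"
    unfolding cinner_def of_real_sum
    by (intro sum.cong refl) (simp only: complex_norm_square mult.commute)
  then have "(\<Sum>i<n. (cmod (vec_index v i))\<^sup>2) = 0" using z by (metis of_real_eq_0_iff)
  then have "\<forall>i<n. vec_index v i = 0" by (subst (asm) sum_nonneg_eq_0_iff) auto
  then show ?thesis using v by (intro eq_vecI) auto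
qed

text \<open>The kernel of a normal operator is the orthogonal complement of its range.\<close>

lemma normal_range_kernel:
  assumes A: "A \<in> carrier_mat n n" and normal: "A * adjoint_mat n A = adjoint_mat n A * A"
    and u: "u \<in> carrier_vec n" and z: "A *\<^sub>v (A *\<^sub>v u) = 0\<^sub>v n"
  shows "A *\<^sub>v u = 0\<^sub>v n"
proof -
  let ?B = "adjoint_mat n A" and ?w = "A *\<^sub>v u"
  have w: "?w \<in> carrier_vec n" using A u by simp
  have Bw: "?B *\<^sub>v ?w \<in> carrier_vec n" by (rule mult_mat_vec_carrier[OF adjoint_mat_carrier w])
  have c0: "cinner n x (0\<^sub>v n) = 0" for x by (simp add: cinner_def)
  have "A *\<^sub>v (?B *\<^sub>v ?w) = ?B *\<^sub>v (A *\<^sub>v ?w)"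
    unfolding assoc_mult_mat_vec[OF A adjoint_mat_carrier w, symmetric]
      assoc_mult_mat_vec[OF adjoint_mat_carrier A w, symmetric] normal ..
  also have "\<dots> = 0\<^sub>v n" unfolding z by (intro eq_vecI) (auto simp: adjoint_mat_def scalar_prod_def)
  finally have "cinner n (?B *\<^sub>v ?w) (?B *\<^sub>v ?w) = 0"
    using cinner_adjoint(2)[OF A w Bw] c0 by simp
  from cinner_definite[OF Bw this] have "cinner n ?w ?w = 0"
    using cinner_adjoint(1)[OF A u w] c0 by simp
  from cinner_definite[OF w this] show ?thesis .
qed

text \<open>At \<open>s = 0\<close> the factor \<open>n powr - s\<close> is \<open>1\<close> because \<open>n \<ge> 1\<close>; it would be \<open>0\<close> at \<open>n = 0\<close>.  So a zeta
  function of either kind counts the objects that it sorts by size.\<close>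

lemma infsum_card_fibres:
  fixes Q :: "nat \<Rightarrow> 'q set"
  assumes fin: "finite (SIGMA n:{1..}. Q n)"
  shows "(\<Sum>\<^sub>\<infinity>n\<in>{1..}. of_nat (card (Q n)) * of_nat n powr (- 0)) = (of_nat (card (SIGMA n:{1..}. Q n)) :: complex)"
proof -
  let ?F = "fst ` (SIGMA n:{1..}. Q n)"
  have F: "finite ?F" "?F \<subseteq> {1..}" using fin by auto
  have finQ: "finite (Q n)" if "n \<in> {1..}" for n
  proof -
    have "Pair n ` Q n \<subseteq> (SIGMA n:{1..}. Q n)" using that by auto
    then have "finite (Pair n ` Q n)" using fin finite_subset by blast
    then show ?thesis by (rule finite_imageD) (simp add: inj_on_def)
  qed
  have "(\<Sum>\<^sub>\<infinity>n\<in>{1..}. of_nat (card (Q n)) * of_nat n powr (- 0)) = (\<Sum>\<^sub>\<infinity>n\<in>?F. of_nat (card (Q n)) :: complex)"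
  proof (rule infsum_cong_neutral)
    fix n assume "n \<in> {1..} - ?F"
    then have "Q n = {}" by force
    then show "of_nat (card (Q n)) * of_nat n powr (- 0) = (0 :: complex)" by simp
  qed (use F in auto)
  also have "\<dots> = of_nat (\<Sum>n\<in>?F. card (Q n))" using F(1) by simp
  also have "(\<Sum>n\<in>?F. card (Q n)) = card (SIGMA n:?F. Q n)"
    using F finQ by (subst card_SigmaI) auto
  also have "(SIGMA n:?F. Q n) = (SIGMA n:{1..}. Q n)" by force
  finally show ?thesis .
qed

context finite_group
begin

text \<open>The left regular representation, written as permutation matrices with respect to an enumeration \<open>e\<close>
  of the group.\<close>

definition regular_rep :: "(nat \<Rightarrow> 'a) \<Rightarrow> 'a \<Rightarrow> complex mat" where
  "regular_rep e g = mat (order G) (order G) (\<lambda>(i, j). if e i = g \<otimes> e j then 1 else 0)"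

lemma regular_rep_carrier [simp]: "regular_rep e g \<in> carrier_mat (order G) (order G)"
  by (simp add: regular_rep_def)

lemma sum_enumeration:
  assumes e: "bij_betw e {..<order G} (carrier G)"
  shows "(\<Sum>k<order G. F (e k)) = (\<Sum>x\<in>carrier G. F x)"
  by (rule sum.reindex_bij_betw[OF e])

lemma regular_representation:
  assumes e: "bij_betw e {..<order G} (carrier G)"
  shows "complex_representation G (order G) (regular_rep e)"
  unfolding complex_representation_def
proof (intro conjI ballI)
  have ec: "e i \<in> carrier G" if "i < order G" for i using bij_betwE[OF e] that by simp
  have ei: "e i = e j \<longleftrightarrow> i = j" if "i < order G" "j < order G" for i j
    using bij_betw_imp_inj_on[OF e] that by (auto simp: inj_on_def)
  show "regular_rep e \<one> = 1\<^sub>m (order G)"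
    by (rule eq_matI) (auto simp: regular_rep_def ec ei)
  fix g h assume g: "g \<in> carrier G" and h: "h \<in> carrier G"
  show "regular_rep e (g \<otimes> h) = regular_rep e g * regular_rep e h"
  proof (rule eq_matI)
    fix i j assume "i < dim_row (regular_rep e g * regular_rep e h)" "j < dim_col (regular_rep e g * regular_rep e h)"
    then have ij: "i < order G" "j < order G" by (simp_all add: regular_rep_def)
    have "(regular_rep e g * regular_rep e h) $$ (i, j)
        = (\<Sum>k<order G. (if e i = g \<otimes> e k then 1 else 0) * (if e k = h \<otimes> e j then 1 else 0))"
      unfolding mult_mat_index[OF regular_rep_carrier regular_rep_carrier ij]
      using ij by (intro sum.cong refl) (simp add: regular_rep_def)
    also have "\<dots> = (\<Sum>x\<in>carrier G. (if e i = g \<otimes> x then 1 else 0) * (if x = h \<otimes> e j then 1 else 0))"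
      by (rule sum_enumeration[OF e])
    also have "\<dots> = (\<Sum>x\<in>carrier G. if x = h \<otimes> e j then if e i = g \<otimes> (h \<otimes> e j) then 1 else 0 else 0)"
      by (intro sum.cong refl) simp
    also have "\<dots> = (if e i = g \<otimes> (h \<otimes> e j) then 1 else 0)"
      using fin h ec[OF ij(2)] by simp
    finally show "regular_rep e (g \<otimes> h) $$ (i, j) = (regular_rep e g * regular_rep e h) $$ (i, j)"
      using ij g h ec[OF ij(2)] by (simp add: regular_rep_def m_assoc)
  qed (simp_all add: regular_rep_def)
qed auto

lemma regular_action_index:
  assumes e: "bij_betw e {..<order G} (carrier G)" and ij: "i < order G" "j < order G"
  shows "group_algebra_action (order G) f (regular_rep e) $$ (i, j) = f (e i \<otimes> inv (e j))"
proof -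
  have ec: "e i \<in> carrier G" if "i < order G" for i using bij_betwE[OF e] that by simp
  have "group_algebra_action (order G) f (regular_rep e) $$ (i, j)
      = (\<Sum>g\<in>carrier G. if g = e i \<otimes> inv (e j) then f (e i \<otimes> inv (e j)) else 0)"
    unfolding group_algebra_action_def entrywise_sum_index[OF ij]
  proof (rule sum.cong[OF refl])
    fix g assume g: "g \<in> carrier G"
    have "e i = g \<otimes> e j \<longleftrightarrow> g = e i \<otimes> inv (e j)"
      using g ec ij inv_solve_right by metis
    then show "(f g \<cdot>\<^sub>m regular_rep e g) $$ (i, j) = (if g = e i \<otimes> inv (e j) then f (e i \<otimes> inv (e j)) else 0)"
      using ij by (simp add: regular_rep_def)
  qed
  then show ?thesis using fin ec ij by simp
qed

lemma group_algebra_action_intertwined: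
  assumes P: "P \<in> carrier_mat n m" and \<rho>: "complex_representation G n \<rho>" and \<sigma>: "complex_representation G m \<sigma>"
    and eq: "\<And>g. g \<in> carrier G \<Longrightarrow> \<rho> g * P = P * \<sigma> g"
  shows "group_algebra_action n f \<rho> * P = P * group_algebra_action m f \<sigma>"
proof -
  note rd = complex_representationD[OF \<rho>] and sd = complex_representationD[OF \<sigma>]
  have "group_algebra_action n f \<rho> * P = entrywise_sum n m (\<lambda>g. (f g \<cdot>\<^sub>m \<rho> g) * P) (carrier G)"
    unfolding group_algebra_action_def by (rule entrywise_sum_mult[OF P]) (simp add: rd(1))
  also have "\<dots> = entrywise_sum n m (\<lambda>g. P * (f g \<cdot>\<^sub>m \<sigma> g)) (carrier G)"
  proof (rule entrywise_sum_cong)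
    fix g assume g: "g \<in> carrier G"
    show "(f g \<cdot>\<^sub>m \<rho> g) * P = P * (f g \<cdot>\<^sub>m \<sigma> g)"
      unfolding mult_smult_assoc_mat[OF rd(1)[OF g] P] mult_smult_distrib[OF P sd(1)[OF g]] eq[OF g] ..
  qed
  also have "\<dots> = P * group_algebra_action m f \<sigma>"
    unfolding group_algebra_action_def by (rule mult_entrywise_sum[OF P, symmetric]) (simp add: sd(1))
  finally show ?thesis .
qed

text \<open>The adjoint of the operator of \<open>f\<close> is the operator of \<open>g \<mapsto> cnj (f (inv g))\<close>, and the operator of a class
  function commutes with all operators from the group algebra.\<close>

lemma regular_action_normal:
  assumes e: "bij_betw e {..<order G} (carrier G)" and f: "class_function G f"
  defines "Z \<equiv> group_algebra_action (order G) f (regular_rep e)"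
  shows "Z * adjoint_mat (order G) Z = adjoint_mat (order G) Z * Z"
proof -
  have ec: "e i \<in> carrier G" if "i < order G" for i using bij_betwE[OF e] that by simp
  let ?f' = "\<lambda>g. cnj (f (inv g))"
  have adj: "adjoint_mat (order G) Z = group_algebra_action (order G) ?f' (regular_rep e)"
  proof (rule eq_matI)
    fix i j assume "i < dim_row (group_algebra_action (order G) ?f' (regular_rep e))"
      "j < dim_col (group_algebra_action (order G) ?f' (regular_rep e))"
    then have ij: "i < order G" "j < order G" by (simp_all add: group_algebra_action_def entrywise_sum_def)
    have "inv (e i \<otimes> inv (e j)) = e j \<otimes> inv (e i)" using ec ij by (simp add: inv_mult_group)
    then show "adjoint_mat (order G) Z $$ (i, j) = group_algebra_action (order G) ?f' (regular_rep e) $$ (i, j)"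
      unfolding regular_action_index[OF e ij] using regular_action_index[OF e ij(2,1)] ij
      by (simp add: adjoint_mat_def Z_def)
  qed (simp_all add: adjoint_mat_def group_algebra_action_def entrywise_sum_def)
  have Zc: "Z \<in> carrier_mat (order G) (order G)" by (simp add: Z_def)
  show ?thesis unfolding adj
  proof (rule group_algebra_action_intertwined[OF Zc regular_representation[OF e] regular_representation[OF e], symmetric])
    fix g assume "g \<in> carrier G"
    then show "regular_rep e g * Z = Z * regular_rep e g"
      unfolding Z_def by (rule class_function_action_commutes[OF regular_representation[OF e] f, symmetric])
  qed
qed

text \<open>Let \<open>Z\<close> be the operator of \<open>f\<close> on the regular representation.  If the range of \<open>Z\<close> were nonzero, it
  would contain an irreducible subrepresentation, on which \<open>Z\<close> acts as zero by
  \<open>class_function_action_zero\<close>.  But \<open>Z\<close> is normal, so its range meets its kernel only in zero.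
  Hence \<open>Z = 0\<close>, and the column of \<open>Z\<close> at the neutral element lists the values of \<open>f\<close>.\<close>

lemma class_function_eq_zero:
  assumes f: "class_function G f"
    and orth: "\<And>n \<rho>. \<rho> \<in> irreducible_representations G n \<Longrightarrow> (\<Sum>g\<in>carrier G. f g * character n \<rho> g) = 0"
    and g: "g \<in> carrier G"
  shows "f g = 0"
proof -
  obtain e where e: "bij_betw e {..<order G} (carrier G)"
    using ex_bij_betw_nat_finite[OF fin] unfolding order_def atLeast0LessThan by blast
  let ?N = "order G"
  let ?Z = "group_algebra_action ?N f (regular_rep e)"
  note reg = regular_representation[OF e]
  have Zc: "?Z \<in> carrier_mat ?N ?N" by simp
  let ?W = "(*\<^sub>v) ?Z ` carrier_vec ?N"
  have inv: "regular_rep e h *\<^sub>v w \<in> ?W" if h: "h \<in> carrier G" and w: "w \<in> ?W" for h w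
  proof -
    obtain u where u: "u \<in> carrier_vec ?N" "w = ?Z *\<^sub>v u" using w by auto
    have "regular_rep e h *\<^sub>v w = (regular_rep e h * ?Z) *\<^sub>v u"
      using assoc_mult_mat_vec[OF regular_rep_carrier Zc u(1)] u by simp
    also have "\<dots> = ?Z *\<^sub>v (regular_rep e h *\<^sub>v u)"
      unfolding class_function_action_commutes[OF reg f h, symmetric]
      by (rule assoc_mult_mat_vec[OF Zc regular_rep_carrier u(1)])
    finally show ?thesis using u mult_mat_vec_carrier[OF regular_rep_carrier] by blast
  qed
  obtain d C \<sigma> where C: "inj_mat ?N d C" "(*\<^sub>v) C ` carrier_vec d = ?W"
    and \<sigma>: "complex_representation G d \<sigma>" "\<And>h. h \<in> carrier G \<Longrightarrow> regular_rep e h * C = C * \<sigma> h"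
    using subrepresentation[OF reg vec_subspace_image[OF Zc] inv] by metis
  have c: "C \<in> carrier_mat ?N d" using C by (simp add: inj_mat_def)
  have "d = 0"
  proof (rule ccontr)
    assume "d \<noteq> 0"
    then obtain k D \<tau> where D: "inj_mat d k D" and \<tau>: "\<tau> \<in> irreducible_representations G k"
      and eq: "\<And>h. h \<in> carrier G \<Longrightarrow> \<sigma> h * D = D * \<tau> h"
      using irreducible_subrepresentation[OF \<sigma>(1)] by blast
    note \<tau>d = irreducibleD[OF \<tau>]
    have dc: "D \<in> carrier_mat d k" using D by (simp add: inj_mat_def)
    have ZC: "?Z * C = C * group_algebra_action d f \<sigma>"
      by (rule group_algebra_action_intertwined[OF c reg \<sigma>(1)]) (rule \<sigma>(2))
    have \<sigma>D: "group_algebra_action d f \<sigma> * D = D * group_algebra_action k f \<tau>"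
      by (rule group_algebra_action_intertwined[OF dc \<sigma>(1) \<tau>d(1)]) (rule eq)
    have "?Z * C * D = C * (D * group_algebra_action k f \<tau>)"
      unfolding ZC \<sigma>D[symmetric] by (rule assoc_mult_mat[OF c group_algebra_action_carrier dc])
    also have "group_algebra_action k f \<tau> = 0\<^sub>m k k"
      by (rule class_function_action_zero[OF \<tau> f orth[OF \<tau>]])
    finally have ZCD: "?Z * C * D = 0\<^sub>m ?N k" using c dc by simp
    let ?x = "unit_vec k 0 :: complex vec"
    have x: "?x \<in> carrier_vec k" by simp
    have Dx: "D *\<^sub>v ?x \<in> carrier_vec d" using dc x by simp
    let ?w = "C *\<^sub>v (D *\<^sub>v ?x)"
    have wc: "?w \<in> carrier_vec ?N" using c Dx by simp
    have "?w \<in> ?W" using C(2) Dx by blast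
    then obtain u where u: "u \<in> carrier_vec ?N" "?w = ?Z *\<^sub>v u" by auto
    have "?Z *\<^sub>v ?w = (?Z * C * D) *\<^sub>v ?x"
      using assoc_mult_mat_vec[OF mult_carrier_mat[OF Zc c] dc x] assoc_mult_mat_vec[OF Zc c Dx] by simp
    also have "\<dots> = 0\<^sub>v ?N" unfolding ZCD by (intro eq_vecI) auto
    finally have "?w = 0\<^sub>v ?N"
      unfolding u(2) by (rule normal_range_kernel[OF Zc regular_action_normal[OF e f] u(1)])
    then have "D *\<^sub>v ?x = 0\<^sub>v d" using C(1) Dx unfolding inj_mat_def by blast
    then have "?x = 0\<^sub>v k" using D x unfolding inj_mat_def by blast
    then have "vec_index ?x 0 = vec_index (0\<^sub>v k :: complex vec) 0" by simp
    then show False using \<tau>d(2) by simp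
  qed
  have W0: "w = 0\<^sub>v ?N" if w: "w \<in> ?W" for w
  proof -
    obtain v where "v \<in> carrier_vec d" "w = C *\<^sub>v v" using w C(2) by blast
    then show ?thesis using c \<open>d = 0\<close> by (intro eq_vecI) (auto simp: scalar_prod_def)
  qed
  obtain i where i: "i < ?N" "e i = g"
    using bij_betw_imp_surj_on[OF e] g by (metis imageE lessThan_iff)
  \<comment> \<open>The column indexed by the neutral element has the entries \<open>f (e i)\<close>.\<close>
  obtain j where j: "j < ?N" "e j = \<one>"
    using bij_betw_imp_surj_on[OF e] one_closed by (metis imageE lessThan_iff)
  have "f g = ?Z $$ (i, j)" using regular_action_index[OF e i(1) j(1)] i j g by simp
  also have "\<dots> = vec_index (?Z *\<^sub>v unit_vec ?N j) i"
  proof -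
    have "vec_index (?Z *\<^sub>v unit_vec ?N j) i = (\<Sum>l<?N. if l = j then ?Z $$ (i, j) else 0)"
      unfolding mult_mat_vec_index[OF Zc unit_vec_carrier i(1)] by (intro sum.cong) (auto simp: unit_vec_def)
    then show ?thesis using j by simp
  qed
  also have "?Z *\<^sub>v unit_vec ?N j = 0\<^sub>v ?N" by (rule W0) simp
  finally show ?thesis using i by simp
qed

subsection \<open>Conjugacy classes\<close>

definition conjugacy_class :: "'a \<Rightarrow> 'a set" where
  "conjugacy_class x = (\<lambda>h. h \<otimes> x \<otimes> inv h) ` carrier G"

lemma conjugacy_classes_eq: "conjugacy_classes G = conjugacy_class ` carrier G"
  unfolding conjugacy_classes_def orbits_def orbit_def conjugacy_class_def by auto

lemma finite_conjugacy_classes: "finite (conjugacy_classes G)"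
  unfolding conjugacy_classes_eq using fin by simp

lemma conjugacy_class_self: "x \<in> carrier G \<Longrightarrow> x \<in> conjugacy_class x"
  unfolding conjugacy_class_def by (rule image_eqI[of _ _ \<one>]) auto

lemma conjugacy_class_conj:
  assumes x: "x \<in> carrier G" and h: "h \<in> carrier G"
  shows "conjugacy_class (h \<otimes> x \<otimes> inv h) = conjugacy_class x"
proof -
  have e: "k \<otimes> (h \<otimes> x \<otimes> inv h) \<otimes> inv k = (k \<otimes> h) \<otimes> x \<otimes> inv (k \<otimes> h)" if "k \<in> carrier G" for k
    using x h that by (simp add: m_assoc inv_mult_group)
  have surj: "(\<lambda>k. k \<otimes> h) ` carrier G = carrier G"
  proof (intro equalityI subsetI)
    fix y assume "y \<in> carrier G"
    then show "y \<in> (\<lambda>k. k \<otimes> h) ` carrier G"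
      using h by (intro image_eqI[of _ _ "y \<otimes> inv h"]) (auto simp: m_assoc)
  qed (use h in auto)
  have "conjugacy_class (h \<otimes> x \<otimes> inv h) = (\<lambda>k. k \<otimes> x \<otimes> inv k) ` ((\<lambda>k. k \<otimes> h) ` carrier G)"
    unfolding conjugacy_class_def image_image by (intro image_cong refl e)
  then show ?thesis unfolding surj conjugacy_class_def .
qed

lemma class_function_constant:
  assumes f: "class_function G f" and x: "x \<in> carrier G" and y: "y \<in> conjugacy_class x"
  shows "f y = f x"
  using assms unfolding class_function_def conjugacy_class_def by auto

lemma class_function_of_class: "class_function G (\<lambda>g. x (conjugacy_class g))"
  by (simp add: class_function_def conjugacy_class_conj)

subsection \<open>The number of irreducible representations\<close>

lemma equiv_isomorphic_irreducibles:
  "equiv (irreducible_representations G n) (isomorphic_irreducibles G n)"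
proof (rule equivI)
  show "isomorphic_irreducibles G n \<subseteq> irreducible_representations G n \<times> irreducible_representations G n"
    by (auto simp: isomorphic_irreducibles_def)
  show "refl_on (irreducible_representations G n) (isomorphic_irreducibles G n)"
  proof (rule refl_onI)
    fix \<rho> assume \<rho>: "\<rho> \<in> irreducible_representations G n"
    have "invertible_mat (1\<^sub>m n :: complex mat)"
      unfolding invertible_mat_iff[OF one_carrier_mat] by (intro bexI[of _ "1\<^sub>m n"]) auto
    moreover have "1\<^sub>m n * \<rho> g = \<rho> g * 1\<^sub>m n" if "g \<in> carrier G" for g
      using complex_representationD(1)[OF irreducibleD(1)[OF \<rho>] that] by simp
    ultimately show "(\<rho>, \<rho>) \<in> isomorphic_irreducibles G n"
      using \<rho> one_carrier_mat unfolding isomorphic_irreducibles_def by blast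
  qed
  show "sym (isomorphic_irreducibles G n)"
  proof (rule symI)
    fix \<rho> \<sigma> assume "(\<rho>, \<sigma>) \<in> isomorphic_irreducibles G n"
    then obtain T where \<rho>: "\<rho> \<in> irreducible_representations G n" and \<sigma>: "\<sigma> \<in> irreducible_representations G n"
      and T: "T \<in> carrier_mat n n" "invertible_mat T" and eq: "\<And>g. g \<in> carrier G \<Longrightarrow> T * \<rho> g = \<sigma> g * T"
      unfolding isomorphic_irreducibles_def by blast
    obtain B where B: "B \<in> carrier_mat n n" "T * B = 1\<^sub>m n" "B * T = 1\<^sub>m n"
      using T(2) unfolding invertible_mat_iff[OF T(1)] by blast
    have "B * \<sigma> g = \<rho> g * B" if g: "g \<in> carrier G" for g
    proof -
      have r: "\<rho> g \<in> carrier_mat n n" and s: "\<sigma> g \<in> carrier_mat n n"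
        by (rule complex_representationD(1)[OF irreducibleD(1)[OF \<rho>] g], rule complex_representationD(1)[OF irreducibleD(1)[OF \<sigma>] g])
      have "B * \<sigma> g = B * (\<sigma> g * (T * B))" using B s by simp
      also have "\<sigma> g * (T * B) = T * \<rho> g * B" unfolding eq[OF g] by (rule assoc_mult_mat[OF s T(1) B(1), symmetric])
      also have "T * \<rho> g * B = T * (\<rho> g * B)" by (rule assoc_mult_mat[OF T(1) r B(1)])
      also have "B * \<dots> = B * T * (\<rho> g * B)"
        by (rule assoc_mult_mat[OF B(1) T(1) mult_carrier_mat[OF r B(1)], symmetric])
      also have "\<dots> = \<rho> g * B" unfolding B(3) by (rule left_mult_one_mat[OF mult_carrier_mat[OF r B(1)]])
      finally show ?thesis .
    qed
    moreover have "invertible_mat B"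
      unfolding invertible_mat_iff[OF B(1)] using B T(1) by blast
    ultimately show "(\<sigma>, \<rho>) \<in> isomorphic_irreducibles G n"
      using \<rho> \<sigma> B(1) unfolding isomorphic_irreducibles_def by blast
  qed
  show "trans (isomorphic_irreducibles G n)"
  proof (rule transI)
    fix \<rho> \<sigma> \<tau> assume "(\<rho>, \<sigma>) \<in> isomorphic_irreducibles G n" "(\<sigma>, \<tau>) \<in> isomorphic_irreducibles G n"
    then obtain S T where \<rho>: "\<rho> \<in> irreducible_representations G n" and \<sigma>: "\<sigma> \<in> irreducible_representations G n"
      and \<tau>: "\<tau> \<in> irreducible_representations G n"
      and T: "T \<in> carrier_mat n n" "invertible_mat T" and eqT: "\<And>g. g \<in> carrier G \<Longrightarrow> T * \<rho> g = \<sigma> g * T"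
      and S: "S \<in> carrier_mat n n" "invertible_mat S" and eqS: "\<And>g. g \<in> carrier G \<Longrightarrow> S * \<sigma> g = \<tau> g * S"
      unfolding isomorphic_irreducibles_def by blast
    have "S * T \<noteq> 0\<^sub>m n n"
    proof
      obtain B where B: "B \<in> carrier_mat n n" "S * B = 1\<^sub>m n" "B * S = 1\<^sub>m n"
        using S(2) unfolding invertible_mat_iff[OF S(1)] by blast
      obtain B' where B': "B' \<in> carrier_mat n n" "T * B' = 1\<^sub>m n" "B' * T = 1\<^sub>m n"
        using T(2) unfolding invertible_mat_iff[OF T(1)] by blast
      assume z: "S * T = 0\<^sub>m n n"
      have "T = B * S * T" using B T by simp
      also have "\<dots> = B * (S * T)" by (rule assoc_mult_mat[OF B(1) S(1) T(1)])
      also have "\<dots> = 0\<^sub>m n n" using z B by simp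
      finally have "1\<^sub>m n = (0\<^sub>m n n :: complex mat)" using B' by simp
      then have "(1\<^sub>m n :: complex mat) $$ (0, 0) = 0\<^sub>m n n $$ (0, 0)" by simp
      then show False using irreducibleD(2)[OF \<rho>] by simp
    qed
    moreover have "S * T * \<rho> g = \<tau> g * (S * T)" if g: "g \<in> carrier G" for g
    proof -
      have r: "\<rho> g \<in> carrier_mat n n" and s: "\<sigma> g \<in> carrier_mat n n" and t: "\<tau> g \<in> carrier_mat n n"
        by (rule complex_representationD(1)[OF irreducibleD(1)[OF \<rho>] g], rule complex_representationD(1)[OF irreducibleD(1)[OF \<sigma>] g], rule complex_representationD(1)[OF irreducibleD(1)[OF \<tau>] g])
      have "S * T * \<rho> g = S * (\<sigma> g * T)" using assoc_mult_mat[OF S(1) T(1) r] eqT[OF g] by simp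
      also have "\<dots> = \<tau> g * S * T" using assoc_mult_mat[OF S(1) s T(1)] eqS[OF g] by simp
      also have "\<dots> = \<tau> g * (S * T)" by (rule assoc_mult_mat[OF t S(1) T(1)])
      finally show ?thesis .
    qed
    ultimately show "(\<rho>, \<tau>) \<in> isomorphic_irreducibles G n"
      by (rule intertwiner_iso(2)[OF \<rho> \<tau> mult_carrier_mat[OF S(1) T(1)]])
  qed
qed

abbreviation irreducible_classes :: "(nat \<times> ('a \<Rightarrow> complex mat) set) set" where
  "irreducible_classes \<equiv> (SIGMA n:{1..}. irreducible_representations G n // isomorphic_irreducibles G n)"

lemma character_isomorphic:
  assumes "(\<rho>, \<sigma>) \<in> isomorphic_irreducibles G n" and g: "g \<in> carrier G"
  shows "character n \<rho> g = character n \<sigma> g"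
proof -
  obtain T where \<rho>: "\<rho> \<in> irreducible_representations G n" and \<sigma>: "\<sigma> \<in> irreducible_representations G n"
    and T: "T \<in> carrier_mat n n" "invertible_mat T" and eq: "T * \<rho> g = \<sigma> g * T"
    using assms unfolding isomorphic_irreducibles_def by blast
  obtain B where B: "B \<in> carrier_mat n n" "T * B = 1\<^sub>m n" "B * T = 1\<^sub>m n"
    using T(2) unfolding invertible_mat_iff[OF T(1)] by blast
  have r: "\<rho> g \<in> carrier_mat n n" and s: "\<sigma> g \<in> carrier_mat n n"
    by (rule complex_representationD(1)[OF irreducibleD(1)[OF \<rho>] g], rule complex_representationD(1)[OF irreducibleD(1)[OF \<sigma>] g])
  have "B * (T * \<rho> g) = \<rho> g" using assoc_mult_mat[OF B(1) T(1) r] B r by simp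
  moreover have "T * \<rho> g * B = \<sigma> g" unfolding eq using assoc_mult_mat[OF s T(1) B(1)] B s by simp
  ultimately show ?thesis
    unfolding character_def using trace_mult_commute[OF B(1) mult_carrier_mat[OF T(1) r]] by simp
qed

text \<open>Characters of distinct classes of irreducible representations are linearly independent by
  orthogonality, so there are at most as many classes as the space of class functions has
  dimensions, and this dimension is the class number.  If there were fewer, some nonzero class
  function would be orthogonal to all irreducible characters, contrary to \<open>class_function_eq_zero\<close>.
  Both steps compare the numbers of equations and unknowns in a linear system.\<close>

lemma card_irreducible_classes:
  "finite irreducible_classes" "card irreducible_classes = class_number G"
proof -
  let ?K = "conjugacy_classes G"
  define rep where "rep t = (SOME \<rho>. \<rho> \<in> snd t)" for t :: "nat \<times> ('a \<Rightarrow> complex mat) set"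
  define ch where "ch t = character (fst t) (rep t)" for t
  have rep_in: "rep t \<in> snd t" and rep: "rep t \<in> irreducible_representations G (fst t)"
    if t: "t \<in> irreducible_classes" for t
  proof -
    obtain n q where nq: "t = (n, q)" "q \<in> irreducible_representations G n // isomorphic_irreducibles G n"
      using t by auto
    then obtain \<rho> where "\<rho> \<in> q"
      using in_quotient_imp_non_empty[OF equiv_isomorphic_irreducibles] by blast
    then show "rep t \<in> snd t" unfolding rep_def nq(1) snd_conv by (rule someI[where P = "\<lambda>\<rho>. \<rho> \<in> q"])
    then show "rep t \<in> irreducible_representations G (fst t)"
      using in_quotient_imp_subset[OF equiv_isomorphic_irreducibles nq(2)] nq(1) by auto
  qed
  have distinct: "t = t'"
    if t: "t \<in> irreducible_classes" "t' \<in> irreducible_classes"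
      and iso: "fst t = fst t'" "(rep t, rep t') \<in> isomorphic_irreducibles G (fst t)" for t t'
  proof -
    have "snd t = snd t'"
      using quotient_eqI[OF equiv_isomorphic_irreducibles _ _ rep_in[OF t(1)] rep_in[OF t(2)] iso(2)] t iso(1)
      by auto
    then show ?thesis using iso(1) by (simp add: prod_eq_iff)
  qed
  have cf: "class_function G (ch t)" if "t \<in> irreducible_classes" for t
    unfolding ch_def by (rule class_function_character[OF irreducibleD(1)[OF rep[OF that]]])
  have upper: "card S \<le> card ?K" if S: "finite S" "S \<subseteq> irreducible_classes" for S
  proof (rule ccontr)
    assume "\<not> card S \<le> card ?K"
    then have lt: "card ?K < card S" by simp
    define c where "c C = (SOME x. x \<in> carrier G \<and> C = conjugacy_class x)" for C
    obtain x where x: "\<exists>t\<in>S. x t \<noteq> 0" and xz: "\<And>C. C \<in> ?K \<Longrightarrow> (\<Sum>t\<in>S. ch t (c C) * x t) = 0"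
      using underdetermined_system[OF finite_conjugacy_classes S(1) lt, of "\<lambda>C t. ch t (c C)"] by auto
    have z: "(\<Sum>t\<in>S. ch t g * x t) = 0" if g: "g \<in> carrier G" for g
    proof -
      let ?C = "conjugacy_class g"
      have C: "?C \<in> ?K" unfolding conjugacy_classes_eq using g by blast
      have "c ?C \<in> carrier G \<and> ?C = conjugacy_class (c ?C)" unfolding c_def by (rule someI) (use g in auto)
      then have "ch t g = ch t (c ?C)" if "t \<in> S" for t
        using class_function_constant[OF cf, of t "c ?C" g] conjugacy_class_self[OF g] that S(2) by auto
      then have "(\<Sum>t\<in>S. ch t g * x t) = (\<Sum>t\<in>S. ch t (c ?C) * x t)" by (intro sum.cong) auto
      then show ?thesis using xz[OF C] by simp
    qed
    \<comment> \<open>Pairing the relation with the character of \<open>t\<close> isolates the coefficient at \<open>t\<close>.\<close>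
    have "x t = 0" if t: "t \<in> S" for t
    proof -
      have pair: "(\<Sum>g\<in>carrier G. ch t' g * ch t (inv g)) = (if t' = t then of_nat (order G) else 0)"
        if t': "t' \<in> S" for t'
        using character_orthogonal[OF rep rep, of t t'] character_norm[OF rep, of t]
          distinct[of t t'] t t' S(2) unfolding ch_def by (cases "t' = t") auto
      have "0 = (\<Sum>g\<in>carrier G. ch t (inv g) * (\<Sum>t'\<in>S. ch t' g * x t'))" by (simp add: z)
      also have "\<dots> = (\<Sum>t'\<in>S. \<Sum>g\<in>carrier G. x t' * (ch t' g * ch t (inv g)))"
        unfolding sum_distrib_left by (subst sum.swap) (simp add: mult_ac)
      also have "\<dots> = (\<Sum>t'\<in>S. if t' = t then x t * of_nat (order G) else 0)"
        by (intro sum.cong refl) (simp add: sum_distrib_left[symmetric] pair)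
      also have "\<dots> = x t * of_nat (order G)" using S(1) t by simp
      finally show ?thesis using order_gt_0_iff_finite fin by simp
    qed
    with x show False by blast
  qed
  show finT: "finite irreducible_classes"
  proof (rule ccontr)
    assume "infinite irreducible_classes"
    then obtain S where "finite S" "card S = Suc (card ?K)" "S \<subseteq> irreducible_classes"
      using infinite_arbitrarily_large by blast
    then show False using upper[of S] by simp
  qed
  have "card ?K \<le> card irreducible_classes"
  proof (rule ccontr)
    assume "\<not> card ?K \<le> card irreducible_classes"
    then have lt: "card irreducible_classes < card ?K" by simp
    \<comment> \<open>The unknowns are the values of a class function on the conjugacy classes, and each irreducible character gives one equation.\<close>
    let ?M = "\<lambda>t C. \<Sum>g\<in>{g\<in>carrier G. conjugacy_class g = C}. ch t g"
    have "\<exists>x. (\<exists>C\<in>?K. x C \<noteq> 0) \<and> (\<forall>t\<in>irreducible_classes. (\<Sum>C\<in>?K. ?M t C * x C) = 0)"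
      by (rule underdetermined_system[OF finT finite_conjugacy_classes lt])
    then obtain x where x: "\<exists>C\<in>?K. x C \<noteq> 0"
      and all: "\<forall>t\<in>irreducible_classes. (\<Sum>C\<in>?K. ?M t C * x C) = 0" by (elim exE conjE)
    have xz: "(\<Sum>C\<in>?K. ?M t C * x C) = 0" if "t \<in> irreducible_classes" for t
      by (rule bspec[OF all that])
    let ?f = "\<lambda>g. x (conjugacy_class g)"
    have orth: "(\<Sum>g\<in>carrier G. ?f g * character n \<rho> g) = 0" if \<rho>: "\<rho> \<in> irreducible_representations G n" for n \<rho>
    proof -
      let ?t = "(n, isomorphic_irreducibles G n `` {\<rho>})"
      have t: "?t \<in> irreducible_classes"
        using quotientI[OF \<rho>] irreducibleD(2)[OF \<rho>] by auto
      have "(\<rho>, rep ?t) \<in> isomorphic_irreducibles G n" using rep_in[OF t] by simp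
      then have "character n \<rho> g = ch ?t g" if "g \<in> carrier G" for g
        using character_isomorphic that by (simp add: ch_def)
      then have "(\<Sum>g\<in>carrier G. ?f g * character n \<rho> g) = (\<Sum>g\<in>carrier G. ?f g * ch ?t g)"
        by (intro sum.cong) auto
      also have "\<dots> = (\<Sum>C\<in>?K. \<Sum>g\<in>{g\<in>carrier G. conjugacy_class g = C}. ?f g * ch ?t g)"
        by (rule sum.group[symmetric]) (use fin finite_conjugacy_classes in \<open>auto simp: conjugacy_classes_eq\<close>)
      also have "\<dots> = (\<Sum>C\<in>?K. ?M ?t C * x C)"
      proof (rule sum.cong[OF refl])
        fix C
        have "(\<Sum>g\<in>{g\<in>carrier G. conjugacy_class g = C}. ?f g * ch ?t g)
            = (\<Sum>g\<in>{g\<in>carrier G. conjugacy_class g = C}. ch ?t g * x C)"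
          by (intro sum.cong) auto
        then show "(\<Sum>g\<in>{g\<in>carrier G. conjugacy_class g = C}. ?f g * ch ?t g) = ?M ?t C * x C"
          by (simp add: sum_distrib_right)
      qed
      finally show ?thesis using xz[OF t] by simp
    qed
    have "?f g = 0" if "g \<in> carrier G" for g
      by (rule class_function_eq_zero[OF class_function_of_class orth that])
    then show False using x unfolding conjugacy_classes_eq by blast
  qed
  then show "card irreducible_classes = class_number G"
    using upper[OF finT order_refl] by (simp add: class_number_def)
qed

lemma zeta_irr_zero: "zeta_irr G 0 = of_nat (class_number G)"
  using infsum_card_fibres[OF card_irreducible_classes(1)]
  unfolding zeta_irr_def num_irreducibles_def card_irreducible_classes(2) .

lemma zeta_cc_zero: "zeta_cc G 0 = of_nat (class_number G)"
proof -
  let ?K = "conjugacy_classes G"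
  have pos: "1 \<le> card C" if C: "C \<in> ?K" for C
  proof -
    obtain x where x: "C = conjugacy_class x" "x \<in> carrier G"
      by (rule imageE[OF C[unfolded conjugacy_classes_eq]])
    have "finite C" unfolding x conjugacy_class_def using fin by simp
    then show ?thesis using conjugacy_class_self[OF x(2)] x(1) by (auto simp: Suc_le_eq card_gt_0_iff)
  qed
  have eq: "(SIGMA n:{1..}. {C \<in> ?K. card C = n}) = (\<lambda>C. (card C, C)) ` ?K"
    using pos by auto
  have "card ((\<lambda>C. (card C, C)) ` ?K) = class_number G"
    unfolding class_number_def by (rule card_image) (simp add: inj_on_def)
  moreover have "finite ((\<lambda>C. (card C, C)) ` ?K)" using finite_conjugacy_classes by (rule finite_imageI)
  ultimately show ?thesis
    using infsum_card_fibres[of "\<lambda>n. {C \<in> ?K. card C = n}"]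
    unfolding zeta_cc_def num_classes_def eq by simp
qed

end

section \<open>The identity of the zeta functions\<close>

lemma local_zeta_functions_at_zero:
  fixes G :: "('k::field_char_0, 'a) hopf_algebra"
  assumes K: "number_field TYPE('k)" and G: "affine_group_scheme ring_of_integers G"
    and ft: "finite_type ring_of_integers G" and I: "I \<in> nonzero_ideals ring_of_integers"
  shows "zeta_irr (quotient_points ring_of_integers G I) 0
      = of_nat (class_number (quotient_points ring_of_integers G I))"
    and "zeta_cc (quotient_points ring_of_integers G I) 0
      = of_nat (class_number (quotient_points ring_of_integers G I))"
proof -
  interpret affine_group_scheme ring_of_integers G by (rule G)
  have idl: "ideal I ring_of_integers" using I by (simp add: nonzero_ideals_def)
  have "finite_group (quotient_points ring_of_integers G I)"
    by (intro finite_group.intro finite_group_axioms.intro group_quotient_points[OF idl]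
        finite_quotient_points[OF idl finite_quotient_ring_of_integers[OF K R_cring I] ft])
  then interpret P: finite_group "quotient_points ring_of_integers G I" .
  show "zeta_irr (quotient_points ring_of_integers G I) 0
      = of_nat (class_number (quotient_points ring_of_integers G I))" by (rule P.zeta_irr_zero)
  show "zeta_cc (quotient_points ring_of_integers G I) 0
      = of_nat (class_number (quotient_points ring_of_integers G I))" by (rule P.zeta_cc_zero)
qed

theorem mainTheorem2:
  fixes G :: "('k::field_char_0, 'a) hopf_algebra"
  assumes "number_field TYPE('k)"
    and "unipotent_group_scheme G"
  shows "Z_irr_series ring_of_integers G 0 = Z_cc_series ring_of_integers G 0
       \<and> Z_cc_series ring_of_integers G 0 = zeta_k_series ring_of_integers G
       \<and> (\<forall>s. Z_irr ring_of_integers G 0 s = Z_cc ring_of_integers G 0 s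
            \<and> Z_cc ring_of_integers G 0 s = zeta_k ring_of_integers G s)"
proof -
  have G: "affine_group_scheme ring_of_integers G" "finite_type ring_of_integers G"
    using assms(2) by (simp_all add: unipotent_group_scheme_def)
  note loc = local_zeta_functions_at_zero[OF assms(1) G]
  have series: "ideal_series ring_of_integers w = ideal_series ring_of_integers w'"
    and sums: "ideal_sum ring_of_integers w s = ideal_sum ring_of_integers w' s"
    if "\<And>I. I \<in> nonzero_ideals ring_of_integers \<Longrightarrow> w I = w' I"
    for w w' :: "'k set \<Rightarrow> complex" and s
    using that unfolding ideal_series_def ideal_sum_def
    by (auto intro!: ext sum.cong infsum_cong)
  have irr: "Z_irr_series ring_of_integers G 0 = zeta_k_series ring_of_integers G"
    "Z_irr ring_of_integers G 0 s = zeta_k ring_of_integers G s" for s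
    unfolding Z_irr_series_def zeta_k_series_def Z_irr_def zeta_k_def
    by (rule series sums, rule loc(1), assumption)+
  have cc: "Z_cc_series ring_of_integers G 0 = zeta_k_series ring_of_integers G"
    "Z_cc ring_of_integers G 0 s = zeta_k ring_of_integers G s" for s
    unfolding Z_cc_series_def zeta_k_series_def Z_cc_def zeta_k_def
    by (rule series sums, rule loc(2), assumption)+
  show ?thesis by (simp add: irr cc)
qed

end
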